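(* Let $\mathscr B$ be a mixed quasi-norm space on $\mathbf R^{2d}\simeq \mathbf C^d$ and let $\omega\in\mathscr P_Q^0(\mathbf C^d)$. Then $A_0(\omega,\mathscr B)=A(\omega,\mathscr B)$, and the Bargmann transform $f\mapsto \mathfrak Vf$ from $M(\omega,\mathscr B)$ to $A(\omega,\mathscr B)$ is isometric and bijective.
   Context: Identify $\mathbf R^{2d}\simeq\mathbf C^d$ via $(x,\xi)\leftrightarrow x+i\xi$. Weights. A weight on $\mathbf R^n$ is a positive function $\omega\in L^\infty_{loc}(\mathbf R^n)$ bounded below by a positive constant on each compact set. $\mathscr P_Q^0(\mathbf R^n)$ is the set of weights $\omega$ such that (i) there are $c,C>0$ with $C^{-1}\omega(x)^2\le\omega(x+y)\omega(x-y)\le C\omega(x)^2$ whenever $|x|\ge 2c$ and $|y|\le c/|x|$; (ii) for every $c>0$ there is $C>0$ with $C^{-1}e^{-c|x|^2}\le\omega(x)\le Ce^{c|x|^2}$ for all $x$. $\mathscr P_Q^0(\mathbf C^d)=\mathscr P_Q^0(\mathbf R^{2d})$. Mixed quasi-norm spaces. A mixed quasi-norm space on $\mathbf R^n$ is $\mathscr B=L^p(V)$, where $V=(V_1,\dots,V_m)$ are vector subspaces with $V_1\oplus\cdots\oplus V_m=\mathbf R^n$ and $p=(p_1,\dots,p_m)\in(0,\infty]^m$; $\|f\|_{\mathscr B}$ is obtained by writing $f=f(x_1,\dots,x_m)$, $x_j\in V_j$, and taking successively the $L^{p_1}(V_1)$ quasi-norm in $x_1$, then the $L^{p_2}(V_2)$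 quasi-norm in $x_2$, ..., and finally the $L^{p_m}(V_m)$ quasi-norm in $x_m$. Gelfand-Shilov spaces. $\mathcal S_{1/2}(\mathbf R^d)=\bigcup_{h>0}\mathcal S_{1/2,h}(\mathbf R^d)$ (inductive limit), where $\mathcal S_{s,h}$ is the Banach space of $f\in C^\infty(\mathbf R^d)$ with $\sup_{\alpha,\beta,x}|x^\beta\partial^\alpha f(x)|/(h^{|\alpha|+|\beta|}(\alpha!\beta!)^s)<\infty$; $\mathcal S_{1/2}'(\mathbf R^d)$ is its dual. Modulation spaces. Let $\phi(x)=\pi^{-d/4}e^{-|x|^2/2}$. For $f\in\mathcal S'_{1/2}(\mathbf R^d)$, $V_\phi f(x,\xi)=(2\pi)^{-d/2}\langle f,\phi(\cdot-x)e^{-i\langle\cdot,\xi\rangle}\rangle$. $M(\omega,\mathscr B)$ is the set of $f\in\mathcal S'_{1/2}(\mathbf R^d)$ with $\|f\|_{M(\omega,\mathscr B)}=\|V_\phi f\cdot\omega\|_{\mathscr B}<\infty$. Bargmann transform. $(\mathfrak Vf)(z)=\langle f,\mathfrak A_d(z,\cdot)\rangle$, $z\in\mathbf C^d$, with $\mathfrak A_d(z,y)=\pi^{-d/4}\exp(-\tfrac12(\langle z,z\rangle+|y|^2)+2^{1/2}\langle z,y\rangle)$ and $\langle z,w\rangle=\sum_j z_jw_j$. Spaces of analytic functions. For measurable $F$ on $\mathbf C^d$, $\|F\|_{B(\omega,\mathscr B)}=\|G\,\omega\|_{\mathscr B}$, where $G(x,\xi)=(2\pi)^{-d/2}e^{-(|x|^2+|\xi|^2)/4}e^{-i\langle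 x,\xi\rangle/2}F(2^{-1/2}x-i2^{-1/2}\xi)$. $A(\omega,\mathscr B)$ is the space of entire functions $F$ on $\mathbf C^d$ with $\|F\|_{A(\omega,\mathscr B)}=\|F\|_{B(\omega,\mathscr B)}<\infty$. $A_0(\omega,\mathscr B)=\{\mathfrak Vf : f\in M(\omega,\mathscr B)\}$ with quasi-norm $\|\mathfrak Vf\|_{A_0(\omega,\mathscr B)}=\|f\|_{M(\omega,\mathscr B)}$. *)

theory Defs
  imports "HOL-Analysis.Analysis"
begin

section \<open>Weights\<close>

definition weight :: "('a::euclidean_space \<Rightarrow> real) \<Rightarrow> bool" where
  "weight \<omega> \<longleftrightarrow>
     \<omega> \<in> borel_measurable lebesgue \<and>
     (\<forall>x. 0 < \<omega> x) \<and>
     (\<forall>K. compact K \<longrightarrow> (\<exists>C. AE x in lebesgue. x \<in> K \<longrightarrow> \<omega> x \<le> C)) \<and>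
     (\<forall>K. compact K \<longrightarrow> (\<exists>c>0. \<forall>x\<in>K. c \<le> \<omega> x))"

definition weights_PQ0 :: "('a::euclidean_space \<Rightarrow> real) set" where
  "weights_PQ0 = {\<omega>. weight \<omega> \<and>
     (\<exists>c>0. \<exists>C>0. \<forall>x y. norm x \<ge> 2 * c \<longrightarrow> norm y \<le> c / norm x \<longrightarrow>
        inverse C * (\<omega> x)\<^sup>2 \<le> \<omega> (x + y) * \<omega> (x - y) \<and>
        \<omega> (x + y) * \<omega> (x - y) \<le> C * (\<omega> x)\<^sup>2) \<and>
     (\<forall>c>0. \<exists>C>0. \<forall>x. inverse C * exp (- c * (norm x)\<^sup>2) \<le> \<omega> x \<and>
        \<omega> x \<le> C * exp (c * (norm x)\<^sup>2))}"


section \<open>Mixed quasi-norm spaces\<close>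

text \<open>Lebesgue measure of a subspace \<open>V\<close> with the inner product inherited from the ambient
  space, viewed as a measure on the ambient space concentrated on \<open>V\<close>.  It is built from an
  orthonormal basis of \<open>V\<close> in the same way as \<open>lborel\<close> is built from \<open>Basis\<close>, and does not
  depend on the chosen basis.\<close>

definition lebesgue_subspace :: "'a::euclidean_space set \<Rightarrow> 'a measure" where
  "lebesgue_subspace V =
     (let B = (SOME B. B \<subseteq> V \<and> pairwise orthogonal B \<and> (\<forall>b\<in>B. norm b = 1) \<and> span B = V)
      in completion (distr (\<Pi>\<^sub>M b\<in>B. (lborel :: real measure)) borel (\<lambda>f. \<Sum>b\<in>B. f b *\<^sub>R b)))"

definition ennreal_powr :: "ennreal \<Rightarrow> real \<Rightarrow> ennreal" where
  "ennreal_powr x r = (if x = \<infinity> then \<infinity> else ennreal (enn2real x powr r))"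

text \<open>Sections of a Lebesgue measurable function are measurable only up to a null set of
  parameters, so the essential supremum is written so as to make sense for every function;
  for measurable functions it is the usual one.\<close>

definition Lp_quasinorm :: "'a measure \<Rightarrow> ennreal \<Rightarrow> ('a \<Rightarrow> ennreal) \<Rightarrow> ennreal" where
  "Lp_quasinorm M p g =
     (if p = \<infinity> then Inf {c. AE x in M. g x \<le> c}
      else ennreal_powr (\<integral>\<^sup>+x. ennreal_powr (g x) (enn2real p) \<partial>M) (1 / enn2real p))"

text \<open>The space \<open>L\<^sup>p(V)\<close> is encoded by the list \<open>[(V\<^sub>1, p\<^sub>1), \<dots>, (V\<^sub>m, p\<^sub>m)]\<close>.\<close>

type_synonym 'a mixed_space = "('a set \<times> ennreal) list"

definition internal_direct_sum :: "'a::euclidean_space set list \<Rightarrow> bool" where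
  "internal_direct_sum Vs \<longleftrightarrow>
     (\<forall>x. \<exists>!xs. length xs = length Vs \<and> (\<forall>j<length Vs. xs ! j \<in> Vs ! j) \<and> sum_list xs = x)"

definition mixed_quasinorm_space :: "'a::euclidean_space mixed_space \<Rightarrow> bool" where
  "mixed_quasinorm_space \<B> \<longleftrightarrow>
     (\<forall>(V, p) \<in> set \<B>. subspace V \<and> 0 < p) \<and> internal_direct_sum (map fst \<B>)"

text \<open>The innermost quasi-norm is the one belonging to the head of the list: in the second equation
  \<open>x\<close> stands for \<open>x\<^sub>2 + \<dots> + x\<^sub>m\<close>, and \<open>x\<^sub>1 = y\<close> is the variable in which the
  quasi-norm is taken.  The argument \<open>g\<close> is the modulus of the function.\<close>

fun mixed_quasinorm :: "'a::euclidean_space mixed_space \<Rightarrow> ('a \<Rightarrow> ennreal) \<Rightarrow> ennreal" where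
  "mixed_quasinorm [] g = g 0"
| "mixed_quasinorm ((V, p) # \<B>) g =
     mixed_quasinorm \<B> (\<lambda>x. Lp_quasinorm (lebesgue_subspace V) p (\<lambda>y. g (y + x)))"


section \<open>Gelfand-Shilov spaces and their duals\<close>

definition partial_deriv :: "'d::finite \<Rightarrow> (real^'d \<Rightarrow> complex) \<Rightarrow> real^'d \<Rightarrow> complex" where
  "partial_deriv i f = (\<lambda>x. frechet_derivative f (at x) (axis i 1))"

definition iter_partial :: "'d::finite list \<Rightarrow> (real^'d \<Rightarrow> complex) \<Rightarrow> real^'d \<Rightarrow> complex" where
  "iter_partial is f = foldr partial_deriv is f"

definition smooth :: "(real^'d::finite \<Rightarrow> complex) \<Rightarrow> bool" where
  "smooth f \<longleftrightarrow> (\<forall>is x. iter_partial is f differentiable (at x))"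

text \<open>A multi-index is a function \<open>'d \<Rightarrow> nat\<close>.  The order in which the partial derivatives are taken
  is left unspecified; for smooth functions it is irrelevant.\<close>

definition multi_deriv :: "('d::finite \<Rightarrow> nat) \<Rightarrow> (real^'d \<Rightarrow> complex) \<Rightarrow> real^'d \<Rightarrow> complex" where
  "multi_deriv \<alpha> f = iter_partial (SOME is. \<forall>i. count_list is i = \<alpha> i) f"

definition multi_power :: "real^'d::finite \<Rightarrow> ('d \<Rightarrow> nat) \<Rightarrow> real" where
  "multi_power x \<beta> = (\<Prod>i\<in>UNIV. (x $ i) ^ \<beta> i)"

definition multi_abs :: "('d::finite \<Rightarrow> nat) \<Rightarrow> nat" where
  "multi_abs \<alpha> = (\<Sum>i\<in>UNIV. \<alpha> i)"

definition multi_fact :: "('d::finite \<Rightarrow> nat) \<Rightarrow> real" where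
  "multi_fact \<alpha> = (\<Prod>i\<in>UNIV. fact (\<alpha> i))"

definition GS_norm :: "real \<Rightarrow> real \<Rightarrow> (real^'d::finite \<Rightarrow> complex) \<Rightarrow> ennreal" where
  "GS_norm s h f = (SUP (\<alpha>, \<beta>, x) \<in> UNIV.
     ennreal (norm (multi_power x \<beta> *\<^sub>R multi_deriv \<alpha> f x) /
       (h ^ (multi_abs \<alpha> + multi_abs \<beta>) * (multi_fact \<alpha> * multi_fact \<beta>) powr s)))"

definition GS_step :: "real \<Rightarrow> real \<Rightarrow> (real^'d::finite \<Rightarrow> complex) set" where
  "GS_step s h = {f. smooth f \<and> GS_norm s h f < \<infinity>}"

definition GS :: "real \<Rightarrow> (real^'d::finite \<Rightarrow> complex) set" where
  "GS s = (\<Union>h\<in>{0<..}. GS_step s h)"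

text \<open>Continuous linear functionals on \<open>GS s\<close>.  By the universal property of the (locally convex)
  inductive limit, a linear functional is continuous iff its restriction to each of the
  Banach spaces \<open>GS_step s h\<close> is bounded.  Functionals are represented as total functions that
  vanish outside \<open>GS s\<close>, so that equality of functionals is equality of functions.\<close>

definition GS_dual :: "real \<Rightarrow> ((real^'d::finite \<Rightarrow> complex) \<Rightarrow> complex) set" where
  "GS_dual s = {u.
     (\<forall>f\<in>GS s. \<forall>g\<in>GS s. u (\<lambda>x. f x + g x) = u f + u g) \<and>
     (\<forall>c. \<forall>f\<in>GS s. u (\<lambda>x. c * f x) = c * u f) \<and>
     (\<forall>h>0. \<exists>C::real. \<forall>f\<in>GS_step s h. ennreal (norm (u f)) \<le> ennreal C * GS_norm s h f) \<and>
     (\<forall>f. f \<notin> GS s \<longrightarrow> u f = 0)}"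


section \<open>Modulation spaces\<close>

definition gauss_window :: "real^'d::finite \<Rightarrow> real" where
  "gauss_window x = pi powr (- (real CARD('d) / 4)) * exp (- ((norm x)\<^sup>2 / 2))"

definition STFT :: "((real^'d::finite \<Rightarrow> complex) \<Rightarrow> complex) \<Rightarrow> (real^'d) \<times> (real^'d) \<Rightarrow> complex" where
  "STFT u = (\<lambda>(x, \<xi>). complex_of_real ((2 * pi) powr (- (real CARD('d) / 2))) *
     u (\<lambda>y. complex_of_real (gauss_window (y - x)) * exp (- (\<i> * complex_of_real (y \<bullet> \<xi>)))))"

definition modulation_norm ::
  "((real^'d) \<times> (real^'d) \<Rightarrow> real) \<Rightarrow> ((real^'d) \<times> (real^'d)) mixed_space \<Rightarrow>
     ((real^'d::finite \<Rightarrow> complex) \<Rightarrow> complex) \<Rightarrow> ennreal" where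
  "modulation_norm \<omega> \<B> u = mixed_quasinorm \<B> (\<lambda>X. ennreal (norm (STFT u X * complex_of_real (\<omega> X))))"

definition modulation_space ::
  "((real^'d) \<times> (real^'d) \<Rightarrow> real) \<Rightarrow> ((real^'d) \<times> (real^'d)) mixed_space \<Rightarrow>
     ((real^'d::finite \<Rightarrow> complex) \<Rightarrow> complex) set" where
  "modulation_space \<omega> \<B> = {u \<in> GS_dual (1/2). modulation_norm \<omega> \<B> u < \<infinity>}"


section \<open>The Bargmann transform and spaces of entire functions\<close>

definition cbilin :: "complex^'d::finite \<Rightarrow> complex^'d \<Rightarrow> complex" where
  "cbilin z w = (\<Sum>j\<in>UNIV. z $ j * w $ j)"

definition bargmann_kernel :: "complex^'d::finite \<Rightarrow> real^'d \<Rightarrow> complex" where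
  "bargmann_kernel z y = complex_of_real (pi powr (- (real CARD('d) / 4))) *
     exp (- (1/2) * (cbilin z z + complex_of_real ((norm y)\<^sup>2)) +
       complex_of_real (sqrt 2) * cbilin z (\<chi> j. complex_of_real (y $ j)))"

definition bargmann :: "((real^'d::finite \<Rightarrow> complex) \<Rightarrow> complex) \<Rightarrow> complex^'d \<Rightarrow> complex" where
  "bargmann u z = u (bargmann_kernel z)"

text \<open>Several complex variables: complex differentiability means that the real Frechet derivative is
  complex linear.\<close>

definition entire :: "(complex^'d::finite \<Rightarrow> complex) \<Rightarrow> bool" where
  "entire F \<longleftrightarrow>
     (\<forall>z. \<exists>F'. (F has_derivative F') (at z) \<and> (\<forall>c v. F' (c *s v) = c * F' v))"

definition to_phase_space :: "(complex^'d::finite \<Rightarrow> complex) \<Rightarrow> (real^'d) \<times> (real^'d) \<Rightarrow> complex" where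
  "to_phase_space F = (\<lambda>(x, \<xi>).
     complex_of_real ((2 * pi) powr (- (real CARD('d) / 2)) *
       exp (- (((norm x)\<^sup>2 + (norm \<xi>)\<^sup>2) / 4))) *
     exp (- (\<i> * complex_of_real (x \<bullet> \<xi>) / 2)) *
     F (\<chi> j. complex_of_real (x $ j / sqrt 2) - \<i> * complex_of_real (\<xi> $ j / sqrt 2)))"

definition B_norm ::
  "((real^'d) \<times> (real^'d) \<Rightarrow> real) \<Rightarrow> ((real^'d) \<times> (real^'d)) mixed_space \<Rightarrow>
     (complex^'d::finite \<Rightarrow> complex) \<Rightarrow> ennreal" where
  "B_norm \<omega> \<B> F =
     mixed_quasinorm \<B> (\<lambda>X. ennreal (norm (to_phase_space F X * complex_of_real (\<omega> X))))"

abbreviation A_norm ::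
  "((real^'d) \<times> (real^'d) \<Rightarrow> real) \<Rightarrow> ((real^'d) \<times> (real^'d)) mixed_space \<Rightarrow>
     (complex^'d::finite \<Rightarrow> complex) \<Rightarrow> ennreal" where
  "A_norm \<equiv> B_norm"

definition A_space ::
  "((real^'d) \<times> (real^'d) \<Rightarrow> real) \<Rightarrow> ((real^'d) \<times> (real^'d)) mixed_space \<Rightarrow>
     (complex^'d::finite \<Rightarrow> complex) set" where
  "A_space \<omega> \<B> = {F. entire F \<and> A_norm \<omega> \<B> F < \<infinity>}"

definition A0_space ::
  "((real^'d) \<times> (real^'d) \<Rightarrow> real) \<Rightarrow> ((real^'d) \<times> (real^'d)) mixed_space \<Rightarrow>
     (complex^'d::finite \<Rightarrow> complex) set" where
  "A0_space \<omega> \<B> = bargmann ` modulation_space \<omega> \<B>"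

text \<open>The quasi-norm of \<open>A0_space\<close> is transported from the modulation space; it is well defined
  because the Bargmann transform is injective.\<close>

definition A0_norm ::
  "((real^'d) \<times> (real^'d) \<Rightarrow> real) \<Rightarrow> ((real^'d) \<times> (real^'d)) mixed_space \<Rightarrow>
     (complex^'d::finite \<Rightarrow> complex) \<Rightarrow> ennreal" where
  "A0_norm \<omega> \<B> F = modulation_norm \<omega> \<B> (inv_into (modulation_space \<omega> \<B>) bargmann F)"

end

theory Submission
  imports Defs "HOL-Probability.Probability" "HOL-Complex_Analysis.Complex_Analysis"
begin

text \<open>Up to a unimodular factor and a Gaussian, the Bargmann kernels are the Gabor atoms
  \<open>y \<mapsto> gauss_window (y - x) * exp (- \<i> (y \<bullet> \<xi>))\<close>; hence \<open>STFT u = to_phase_space (bargmann u)\<close> and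
  the transform is isometric.  The kernels have finite \<open>GS_norm\<close>, bounded by
  \<open>K exp ((1/2 + \<delta>) |z|\<^sup>2)\<close> with \<open>\<delta>\<close> as small as one likes at the cost of \<open>h\<close>, and Cauchy estimates in
  \<open>z\<close> make \<open>z \<mapsto> u (bargmann_kernel z)\<close> entire.

  A function \<open>f\<close> in \<open>GS (1/2)\<close> and its Fourier transform have Gaussian decay, so its short-time Fourier
  transform is bounded by \<open>exp (- r |X|\<^sup>2)\<close> for some \<open>r > 0\<close>, and the inversion formula exhibits \<open>f\<close> as a
  limit in \<open>GS_norm\<close> of finite combinations of kernels: this is injectivity.

  If \<open>F\<close> is entire of finite quasi-norm, then \<open>norm (F z)\<close> is at least half its value at a suitable point
  on a ball around that point, and the quasi-norm of the indicator of such a ball is bounded below; the lower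
  bound on the weight then gives \<open>|to_phase_space F X| \<le> C exp (\<epsilon> |X|\<^sup>2)\<close> for all \<open>\<epsilon> > 0\<close>.
  Integrating \<open>to_phase_space F\<close> against the short-time Fourier transform of the test function therefore
  defines a functional, and the mean value property of entire functions shows that its Bargmann transform
  is \<open>F\<close>.\<close>

section \<open>Lower bounds for mixed quasi-norms\<close>

text \<open>For exponents below 1 neither duality nor Minkowski's inequality is at hand, the
  subspaces need not respect the complex structure, and since the weight is only Lebesgue
  measurable, sections may fail to be measurable. So the quasi-norm enters through monotonicity
  alone: a minorant that is constant near one point. This costs a power of the radius of the
  neighbourhood, and the radius cannot be bounded below; the weight
  \<open>(1 - dist z z0) ^ M\<close> in the maximisation is there to pay that power back. The
  exponents fit because \<open>phase_to_complex\<close> halves squared norms: kernels at z grow like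
  exp (|z|^2 / 2) = exp (|X|^2 / 4), and the phase factor decays like exp (- |X|^2 / 4). What is
  left is decided at arbitrarily small rates. The short-time Fourier transform of a test function in
  \<open>GS_step (1/2) h\<close> decays at a rate r that depends on h, and the rates obtained tend
  to 0 as h grows; hence F has to be controlled by exp (\<epsilon> |X|^2) for every \<epsilon>, and
  the kernel seminorms have to stay below rate 1/2 + \<delta> for every \<delta>.\<close>

lemma lebesgue_subspace_cball:
  fixes V :: "'a::euclidean_space set"
  assumes V: "subspace V"
  shows "\<exists>K>0. \<exists>N::nat. \<forall>c\<in>V. \<forall>\<rho>. 0 < \<rho> \<longrightarrow> \<rho> \<le> 1 \<longrightarrow>
    V \<inter> cball c \<rho> \<in> sets (lebesgue_subspace V) \<and>
    ennreal (K * \<rho> ^ N) \<le> emeasure (lebesgue_subspace V) (V \<inter> cball c \<rho>)"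
proof -
  define P where "P = (\<lambda>B::'a set. B \<subseteq> V \<and> pairwise orthogonal B \<and> (\<forall>b\<in>B. norm b = 1) \<and> span B = V)"
  define B where "B = (SOME B. P B)"
  have "\<exists>B. P B"
    using orthonormal_basis_subspace[OF V] unfolding P_def by metis
  then have "P B" unfolding B_def by (rule someI_ex)
  then have BV: "B \<subseteq> V" and orth: "pairwise orthogonal B" and nB: "\<And>b. b \<in> B \<Longrightarrow> norm b = 1" and sp: "span B = V"
    by (auto simp: P_def)
  have "0 \<notin> B" using nB by force
  then have fin: "finite B"
    using pairwise_orthogonal_independent[OF orth] independent_imp_finite by blast
  \<comment> \<open>With half-sides \<rho> / n the coordinate errors add up to at most
    \<open>card B\<close> times \<rho> / n, which is below \<rho>; the summand 1 keeps n nonzero for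
    the trivial subspace.\<close>
  define n where "n = real (card B) + 1"
  have n: "n > 0" by (simp add: n_def)
  define D where "D = distr (\<Pi>\<^sub>M b\<in>B. (lborel :: real measure)) borel (\<lambda>f. \<Sum>b\<in>B. f b *\<^sub>R b)"
  have LD: "lebesgue_subspace V = completion D"
    unfolding lebesgue_subspace_def Let_def D_def B_def P_def by simp
  interpret product_sigma_finite "\<lambda>_::'a. lborel :: real measure" by standard
  have meas: "(\<lambda>f. \<Sum>b\<in>B. f b *\<^sub>R b) \<in> (\<Pi>\<^sub>M b\<in>B. (lborel :: real measure)) \<rightarrow>\<^sub>M borel"
    by measurable
  have "V \<inter> cball c \<rho> \<in> sets (lebesgue_subspace V) \<and>
    ennreal ((2 / n) ^ card B * \<rho> ^ card B) \<le> emeasure (lebesgue_subspace V) (V \<inter> cball c \<rho>)"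
    if c: "c \<in> V" and \<rho>: "0 < \<rho>" for c \<rho>
  proof -
    have "closed (V \<inter> cball c \<rho>)" using closed_subspace[OF V] by (intro closed_Int) auto
    then have S: "V \<inter> cball c \<rho> \<in> sets D" unfolding D_def by simp
    \<comment> \<open>A cube in orthonormal coordinates whose image lies in the ball and whose
      product measure is explicit.\<close>
    define Q where "Q = (\<Pi>\<^sub>E b\<in>B. {c \<bullet> b - \<rho> / n .. c \<bullet> b + \<rho> / n})"
    have cexp: "(\<Sum>b\<in>B. (c \<bullet> b) *\<^sub>R b) = c"
      using orthonormal_basis_expand[OF orth nB _ fin, of c] c sp by auto
    have sub: "Q \<subseteq> (\<lambda>f. \<Sum>b\<in>B. f b *\<^sub>R b) -` (V \<inter> cball c \<rho>) \<inter> space (\<Pi>\<^sub>M b\<in>B. (lborel :: real measure))"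
    proof
      fix f assume f: "f \<in> Q"
      have 1: "(\<Sum>b\<in>B. f b *\<^sub>R b) \<in> V"
        using V BV by (intro subspace_sum subspace_scale) auto
      have "dist c (\<Sum>b\<in>B. f b *\<^sub>R b) = norm (\<Sum>b\<in>B. (c \<bullet> b - f b) *\<^sub>R b)"
        by (simp add: dist_norm scaleR_diff_left sum_subtractf cexp)
      also have "\<dots> \<le> (\<Sum>b\<in>B. norm ((c \<bullet> b - f b) *\<^sub>R b))" by (rule norm_sum)
      also have "\<dots> \<le> (\<Sum>b\<in>B. \<rho> / n)"
      proof (rule sum_mono)
        fix b assume b: "b \<in> B"
        have "f b \<in> {c \<bullet> b - \<rho> / n .. c \<bullet> b + \<rho> / n}" using f b by (auto simp: Q_def PiE_def Pi_def)
        then show "norm ((c \<bullet> b - f b) *\<^sub>R b) \<le> \<rho> / n" using nB[OF b] by auto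
      qed
      also have "\<dots> \<le> \<rho>" using \<rho> n by (simp add: n_def field_simps)
      finally show "f \<in> (\<lambda>f. \<Sum>b\<in>B. f b *\<^sub>R b) -` (V \<inter> cball c \<rho>) \<inter> space (\<Pi>\<^sub>M b\<in>B. (lborel :: real measure))"
        using 1 f by (auto simp: space_PiM Q_def PiE_def)
    qed
    have "emeasure (\<Pi>\<^sub>M b\<in>B. (lborel :: real measure)) Q
        = (\<Prod>b\<in>B. emeasure lborel {c \<bullet> b - \<rho> / n .. c \<bullet> b + \<rho> / n})"
      unfolding Q_def by (rule emeasure_PiM) (auto simp: fin)
    also have "\<dots> = (\<Prod>b\<in>B. ennreal (2 * \<rho> / n))"
      using \<rho> n by (intro prod.cong refl) (simp add: field_simps)
    also have "\<dots> = ennreal ((2 / n) ^ card B * \<rho> ^ card B)"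
      using \<rho> n by (simp add: ennreal_power power_mult_distrib power_divide)
    finally have "ennreal ((2 / n) ^ card B * \<rho> ^ card B) = emeasure (\<Pi>\<^sub>M b\<in>B. (lborel :: real measure)) Q" ..
    also have "\<dots> \<le> emeasure (\<Pi>\<^sub>M b\<in>B. (lborel :: real measure))
        ((\<lambda>f. \<Sum>b\<in>B. f b *\<^sub>R b) -` (V \<inter> cball c \<rho>) \<inter> space (\<Pi>\<^sub>M b\<in>B. (lborel :: real measure)))"
      using measurable_sets[OF meas, of "V \<inter> cball c \<rho>"] S by (intro emeasure_mono sub) (simp add: D_def)
    also have "\<dots> = emeasure D (V \<inter> cball c \<rho>)"
      unfolding D_def using S D_def by (subst emeasure_distr[OF meas]) simp_all
    also have "\<dots> = emeasure (completion D) (V \<inter> cball c \<rho>)"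
      using S by simp
    finally show ?thesis using S LD by auto
  qed
  moreover have "(2 / n) ^ card B > 0" using n by simp
  ultimately show ?thesis by blast
qed

lemma ennreal_powr_mono:
  assumes "x \<le> y" "0 \<le> r"
  shows "ennreal_powr x r \<le> ennreal_powr y r"
proof (cases "y = \<infinity>")
  case False
  then have "x \<noteq> \<infinity>" using assms(1) by (metis infinity_ennreal_def top.extremum_unique)
  moreover have "enn2real x \<le> enn2real y" using assms(1) False by (intro enn2real_mono) (auto simp: top.not_eq_extremum)
  ultimately show ?thesis using False assms unfolding ennreal_powr_def
    by (auto intro!: ennreal_leI powr_mono2)
qed (simp add: ennreal_powr_def)

text \<open>Only monotonicity and the measure of a small ball are used, so the bound covers all
  exponents, also below 1, and needs no measurability of g. The loss is put in the form K \<rho>^N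
  with natural N, the form that survives iteration.\<close>

lemma Lp_quasinorm_lower_bound:
  fixes V :: "'a::euclidean_space set"
  assumes V: "subspace V" and p: "0 < p"
  shows "\<exists>K>0. \<exists>N::nat. \<forall>c\<in>V. \<forall>\<rho> A g. 0 < \<rho> \<longrightarrow> \<rho> \<le> 1 \<longrightarrow> 0 \<le> A \<longrightarrow>
    (\<forall>y\<in>V. dist c y \<le> \<rho> \<longrightarrow> ennreal A \<le> g y) \<longrightarrow>
    ennreal (A * (K * \<rho> ^ N)) \<le> Lp_quasinorm (lebesgue_subspace V) p g"
proof -
  from lebesgue_subspace_cball[OF V] obtain K N where K: "K > 0" and
    N: "\<And>c \<rho>. \<lbrakk>c \<in> V; 0 < \<rho>; \<rho> \<le> 1\<rbrakk> \<Longrightarrow> V \<inter> cball c \<rho> \<in> sets (lebesgue_subspace V)"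
       "\<And>c \<rho>. \<lbrakk>c \<in> V; 0 < \<rho>; \<rho> \<le> 1\<rbrakk> \<Longrightarrow> ennreal (K * \<rho> ^ N) \<le> emeasure (lebesgue_subspace V) (V \<inter> cball c \<rho>)"
    by blast
  show ?thesis
  proof (cases "p = \<infinity>")
    case True
    have "ennreal (A * (1 * \<rho> ^ 0)) \<le> Lp_quasinorm (lebesgue_subspace V) p g"
      if c: "c \<in> V" and \<rho>: "0 < \<rho>" "\<rho> \<le> 1" and A: "0 \<le> A"
        and g: "\<forall>y\<in>V. dist c y \<le> \<rho> \<longrightarrow> ennreal A \<le> g y" for c \<rho> A g
    proof -
      have "ennreal A \<le> b" if b: "AE x in lebesgue_subspace V. g x \<le> b" for b
      proof (rule ccontr)
        assume "\<not> ennreal A \<le> b"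
        from b obtain Z where Z: "{x \<in> space (lebesgue_subspace V). \<not> g x \<le> b} \<subseteq> Z"
          "Z \<in> sets (lebesgue_subspace V)" "emeasure (lebesgue_subspace V) Z = 0" by (rule AE_E)
        \<comment> \<open>On the ball g is at least A, so g x \<le> b fails at each of its points; a
          null ball contradicts the positive lower bound on its measure.\<close>
        have "V \<inter> cball c \<rho> \<subseteq> Z"
          using Z(1) g \<open>\<not> ennreal A \<le> b\<close> sets.sets_into_space[OF N(1)[OF c \<rho>]]
          by (force dest: order_trans)
        then have "emeasure (lebesgue_subspace V) (V \<inter> cball c \<rho>) = 0"
          using Z by (metis emeasure_mono le_zero_eq)
        then show False using N(2)[OF c \<rho>] K \<rho> by simp
      qed
      then show ?thesis using True by (auto simp: Lp_quasinorm_def intro!: Inf_greatest)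
    qed
    then show ?thesis by (metis zero_less_one)
  next
    case False
    define q where "q = enn2real p"
    have q: "q > 0" using p False by (simp add: q_def enn2real_positive_iff top.not_eq_extremum)
    \<comment> \<open>The exponent N / q produced by the outer power 1 / q is rounded up, which only
      lowers the bound because \<rho> \<le> 1.\<close>
    define M where "M = nat \<lceil>real N / q\<rceil>"
    have M: "real N / q \<le> real M" unfolding M_def by linarith
    have "ennreal (A * (K powr (1 / q) * \<rho> ^ M)) \<le> Lp_quasinorm (lebesgue_subspace V) p g"
      if c: "c \<in> V" and \<rho>: "0 < \<rho>" "\<rho> \<le> 1" and A: "0 \<le> A"
        and g: "\<forall>y\<in>V. dist c y \<le> \<rho> \<longrightarrow> ennreal A \<le> g y" for c \<rho> A g
    proof -
      let ?I = "\<integral>\<^sup>+x. ennreal_powr (g x) q \<partial>(lebesgue_subspace V)"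
      have "ennreal (A powr q * (K * \<rho> ^ N)) = ennreal (A powr q) * ennreal (K * \<rho> ^ N)"
        using K \<rho> by (simp add: ennreal_mult)
      also have "\<dots> \<le> ennreal (A powr q) * emeasure (lebesgue_subspace V) (V \<inter> cball c \<rho>)"
        by (intro mult_left_mono N c \<rho>) auto
      also have "\<dots> = (\<integral>\<^sup>+x. ennreal (A powr q) * indicator (V \<inter> cball c \<rho>) x \<partial>(lebesgue_subspace V))"
        using N(1)[OF c \<rho>] by (simp add: nn_integral_cmult_indicator)
      also have "\<dots> \<le> ?I"
      proof (rule nn_integral_mono)
        fix x
        have "ennreal (A powr q) \<le> ennreal_powr (g x) q" if "x \<in> V \<inter> cball c \<rho>"
          using ennreal_powr_mono[of "ennreal A" "g x" q] g that A q by (auto simp: ennreal_powr_def)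
        then show "ennreal (A powr q) * indicator (V \<inter> cball c \<rho>) x \<le> ennreal_powr (g x) q"
          by (auto simp: indicator_def)
      qed
      finally have "ennreal_powr (ennreal (A powr q * (K * \<rho> ^ N))) (1 / q) \<le> ennreal_powr ?I (1 / q)"
        using q by (intro ennreal_powr_mono) auto
      moreover have "ennreal_powr (ennreal (A powr q * (K * \<rho> ^ N))) (1 / q)
          = ennreal (A * (K powr (1 / q) * \<rho> powr (real N / q)))"
        using A K \<rho> q by (simp add: ennreal_powr_def powr_mult powr_powr powr_realpow[symmetric])
      moreover have "A * (K powr (1 / q) * \<rho> ^ M) \<le> A * (K powr (1 / q) * \<rho> powr (real N / q))"
        using A K \<rho> M by (intro mult_left_mono) (auto simp: powr_realpow[symmetric] intro!: powr_mono')
      ultimately have "ennreal (A * (K powr (1 / q) * \<rho> ^ M)) \<le> ennreal_powr ?I (1 / q)"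
        by (metis (no_types, lifting) ennreal_leI order_trans)
      then show ?thesis using False by (simp add: Lp_quasinorm_def q_def)
    qed
    moreover have "K powr (1 / q) > 0" using K by simp
    ultimately show ?thesis by blast
  qed
qed

text \<open>A product of small balls, one per component, replaces a ball of the ambient space: it is
  adapted to a decomposition that need not be orthogonal, and the components can be treated one at a
  time.\<close>

lemma mixed_quasinorm_lower_bound:
  fixes \<B> :: "'a::euclidean_space mixed_space"
  assumes "\<forall>(V, p)\<in>set \<B>. subspace V \<and> 0 < p"
  shows "\<exists>K>0. \<exists>N::nat. \<forall>cs \<rho> A g. length cs = length \<B> \<longrightarrow>
    (\<forall>j<length \<B>. cs ! j \<in> fst (\<B> ! j)) \<longrightarrow> 0 < \<rho> \<longrightarrow> \<rho> \<le> 1 \<longrightarrow> 0 \<le> A \<longrightarrow>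
    (\<forall>xs. length xs = length \<B> \<longrightarrow> (\<forall>j<length \<B>. dist (cs ! j) (xs ! j) \<le> \<rho>) \<longrightarrow>
       ennreal A \<le> g (sum_list xs)) \<longrightarrow>
    ennreal (A * (K * \<rho> ^ N)) \<le> mixed_quasinorm \<B> g"
  using assms
proof (induction \<B>)
  case Nil
  then show ?case by (intro exI[of _ "1::real"] conjI exI[of _ "0::nat"]) auto
next
  case (Cons Vp \<B>)
  obtain V p where Vp: "Vp = (V, p)" by (cases Vp)
  from Cons.prems have V: "subspace V" and p: "0 < p" and \<B>: "\<forall>(V, p)\<in>set \<B>. subspace V \<and> 0 < p"
    by (auto simp: Vp)
  from Lp_quasinorm_lower_bound[OF V p] obtain K1 N1 where K1: "K1 > 0" and
    1: "\<And>c \<rho> A g. \<lbrakk>c \<in> V; 0 < \<rho>; \<rho> \<le> 1; 0 \<le> A; \<forall>y\<in>V. dist c y \<le> \<rho> \<longrightarrow> ennreal A \<le> g y\<rbrakk> \<Longrightarrow>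
      ennreal (A * (K1 * \<rho> ^ N1)) \<le> Lp_quasinorm (lebesgue_subspace V) p g" by blast
  from Cons.IH[OF \<B>] obtain K2 N2 where K2: "K2 > 0" and
    2: "\<And>cs \<rho> A g. \<lbrakk>length cs = length \<B>; \<forall>j<length \<B>. cs ! j \<in> fst (\<B> ! j); 0 < \<rho>; \<rho> \<le> 1; 0 \<le> A;
    \<forall>xs. length xs = length \<B> \<longrightarrow> (\<forall>j<length \<B>. dist (cs ! j) (xs ! j) \<le> \<rho>) \<longrightarrow> ennreal A \<le> g (sum_list xs)\<rbrakk> \<Longrightarrow>
    ennreal (A * (K2 * \<rho> ^ N2)) \<le> mixed_quasinorm \<B> g" by blast
  have "ennreal (A * ((K1 * K2) * \<rho> ^ (N1 + N2))) \<le> mixed_quasinorm (Vp # \<B>) g"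
    if len: "length cs = length (Vp # \<B>)" and cs: "\<forall>j<length (Vp # \<B>). cs ! j \<in> fst ((Vp # \<B>) ! j)"
      and \<rho>: "0 < \<rho>" "\<rho> \<le> 1" and A: "0 \<le> A"
      and g: "\<forall>xs. length xs = length (Vp # \<B>) \<longrightarrow> (\<forall>j<length (Vp # \<B>). dist (cs ! j) (xs ! j) \<le> \<rho>) \<longrightarrow>
       ennreal A \<le> g (sum_list xs)" for cs \<rho> A g
  proof -
    obtain c cs' where c: "cs = c # cs'" using len by (cases cs) auto
    have cV: "c \<in> V" using cs c Vp by force
    have cs': "\<forall>j<length \<B>. cs' ! j \<in> fst (\<B> ! j)" using cs c by force
    \<comment> \<open>The lower bound for the innermost quasi-norm, uniform in the remaining
      variables, becomes the height to which the induction hypothesis is applied.\<close>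
    have "ennreal ((A * (K1 * \<rho> ^ N1)) * (K2 * \<rho> ^ N2)) \<le>
      mixed_quasinorm \<B> (\<lambda>x. Lp_quasinorm (lebesgue_subspace V) p (\<lambda>y. g (y + x)))"
    proof (rule 2[of cs'], goal_cases)
      case 6
      show ?case
      proof (intro allI impI)
        fix xs :: "'a list" assume xs: "length xs = length \<B>" "\<forall>j<length \<B>. dist (cs' ! j) (xs ! j) \<le> \<rho>"
        show "ennreal (A * (K1 * \<rho> ^ N1)) \<le> Lp_quasinorm (lebesgue_subspace V) p (\<lambda>y. g (y + sum_list xs))"
        proof (rule 1[OF cV \<rho> A], intro ballI impI)
          fix y assume "y \<in> V" "dist c y \<le> \<rho>"
          then show "ennreal A \<le> g (y + sum_list xs)"
            using g[rule_format, of "y # xs"] xs c by (auto simp: nth_Cons split: nat.split)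
        qed
      qed
    qed (use len c cs' \<rho> A K1 in auto)
    then show ?thesis by (simp add: Vp power_add mult_ac)
  qed
  moreover have "K1 * K2 > 0" using K1 K2 by simp
  ultimately show ?case by blast
qed

section \<open>Smooth functions and Gelfand-Shilov seminorms\<close>

lemma norm_increment_le:
  fixes g :: "real \<Rightarrow> complex"
  assumes "\<And>s. 0 \<le> s \<Longrightarrow> s \<le> t \<Longrightarrow> (g has_vector_derivative g' s) (at s)"
    and "\<And>s. 0 \<le> s \<Longrightarrow> s \<le> t \<Longrightarrow> norm (g' s) \<le> B" and "0 \<le> t"
  shows "norm (g t - g 0) \<le> B * t"
proof -
  have "norm (g t - g 0) \<le> B * norm (t - 0)"
  proof (rule differentiable_bound[where f' = "\<lambda>s h. h *\<^sub>R g' s" and S = "{0..t}"])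
    fix s assume s: "s \<in> {0..t}"
    then show "(g has_derivative (\<lambda>h. h *\<^sub>R g' s)) (at s within {0..t})"
      using assms(1)[of s] by (auto simp: has_vector_derivative_def intro: has_derivative_at_withinI)
    show "onorm (\<lambda>h. h *\<^sub>R g' s) \<le> B"
      using assms(2)[of s] s by (intro onorm_le) (auto simp: mult.commute[of B] intro: mult_left_mono)
  qed (use assms in auto)
  then show ?thesis using assms by simp
qed

lemma partial_deriv_eqI: "(f has_derivative D) (at x) \<Longrightarrow> partial_deriv i f x = D (axis i 1)"
  unfolding partial_deriv_def by (metis frechet_derivative_at)

lemma partial_deriv_has_vector_derivative:
  assumes "f differentiable (at (x + t *\<^sub>R axis i 1))"
  shows "((\<lambda>s. f (x + s *\<^sub>R axis i 1)) has_vector_derivative partial_deriv i f (x + t *\<^sub>R axis i 1)) (at t)"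
proof -
  let ?D = "frechet_derivative f (at (x + t *\<^sub>R axis i 1))"
  have D: "(f has_derivative ?D) (at (x + t *\<^sub>R axis i 1))"
    using assms frechet_derivative_works by blast
  have "((\<lambda>s. x + s *\<^sub>R axis i 1) has_derivative (\<lambda>h. h *\<^sub>R axis i 1)) (at t)"
    by (auto intro!: derivative_eq_intros)
  from has_derivative_compose[OF this D]
  have "((\<lambda>s. f (x + s *\<^sub>R axis i 1)) has_derivative (\<lambda>h. ?D (h *\<^sub>R axis i 1))) (at t)" by simp
  moreover have "?D (h *\<^sub>R axis i 1) = h *\<^sub>R ?D (axis i 1)" for h
    using has_derivative_linear[OF D] linear_scale by blast
  ultimately show ?thesis by (simp add: has_vector_derivative_def partial_deriv_def)
qed

text \<open>Difference quotients along a sequence, so that dominated convergence and measurability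
  of limits apply to partial derivatives.\<close>

lemma partial_deriv_LIMSEQ:
  assumes "f differentiable (at x)"
  shows "(\<lambda>n. real (Suc n) *\<^sub>R (f (x + inverse (real (Suc n)) *\<^sub>R axis i 1) - f x)) \<longlonglongrightarrow> partial_deriv i f x"
proof -
  have "((\<lambda>s. f (x + s *\<^sub>R axis i 1)) has_vector_derivative partial_deriv i f x) (at 0)"
    using partial_deriv_has_vector_derivative[of f x 0 i] assms by simp
  then have "((\<lambda>y. (f (x + y *\<^sub>R axis i 1) - f x) /\<^sub>R \<bar>y\<bar> - (y *\<^sub>R partial_deriv i f x) /\<^sub>R \<bar>y\<bar>) \<longlongrightarrow> 0) (at 0)"
    unfolding has_vector_derivative_def has_derivative_at_within
    by (simp add: scaleR_diff_right[symmetric] divide_inverse mult.commute del: scaleR_scaleR)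
  moreover have "filterlim (\<lambda>n. inverse (real (Suc n))) (at 0) sequentially"
    using LIMSEQ_inverse_real_of_nat by (auto simp: filterlim_at simp del: of_nat_Suc)
  ultimately have "(\<lambda>n. (f (x + inverse (real (Suc n)) *\<^sub>R axis i 1) - f x) /\<^sub>R \<bar>inverse (real (Suc n))\<bar>
     - (inverse (real (Suc n)) *\<^sub>R partial_deriv i f x) /\<^sub>R \<bar>inverse (real (Suc n))\<bar>) \<longlonglongrightarrow> 0"
    by (rule filterlim_compose)
  then have "(\<lambda>n. real (Suc n) *\<^sub>R (f (x + inverse (real (Suc n)) *\<^sub>R axis i 1) - f x) - partial_deriv i f x) \<longlonglongrightarrow> 0"
    by (simp del: of_nat_Suc)
  then show ?thesis by (simp add: LIM_zero_iff del: of_nat_Suc)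
qed

lemma partial_deriv_increment_le:
  assumes "\<And>s. 0 \<le> s \<Longrightarrow> s \<le> t \<Longrightarrow> f differentiable (at (x + s *\<^sub>R axis i 1))"
    and "\<And>s. 0 \<le> s \<Longrightarrow> s \<le> t \<Longrightarrow> norm (partial_deriv i f (x + s *\<^sub>R axis i 1)) \<le> B" and "0 \<le> t"
  shows "norm (f (x + t *\<^sub>R axis i 1) - f x) \<le> B * t"
  using norm_increment_le[of t "\<lambda>s. f (x + s *\<^sub>R axis i 1)", OF partial_deriv_has_vector_derivative[OF assms(1)] assms(2,3)]
  by simp

section \<open>Algebra of iterated partial derivatives\<close>

lemma iter_partial_Nil [simp]: "iter_partial [] f = f"
  and iter_partial_Cons: "iter_partial (i # is) f = partial_deriv i (iter_partial is f)"
  and iter_partial_append: "iter_partial (is @ js) f = iter_partial is (iter_partial js f)"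
  by (simp_all add: iter_partial_def)

lemma smooth_iter_partial: "smooth f \<Longrightarrow> smooth (iter_partial js f)"
  unfolding smooth_def by (metis iter_partial_append)

lemma smooth_partial_deriv: "smooth f \<Longrightarrow> smooth (partial_deriv i f)"
  using smooth_iter_partial[of f "[i]"] by (simp add: iter_partial_Cons)

lemma smooth_differentiable: "smooth f \<Longrightarrow> f differentiable (at x)"
  unfolding smooth_def by (metis iter_partial_Nil)

lemma smooth_continuous: "smooth f \<Longrightarrow> continuous_on UNIV f"
  by (simp add: continuous_at_imp_continuous_on differentiable_imp_continuous_within smooth_differentiable)

lemma partial_deriv_add:
  assumes "f differentiable (at x)" "g differentiable (at x)"
  shows "partial_deriv i (\<lambda>x. f x + g x) x = partial_deriv i f x + partial_deriv i g x"
  using partial_deriv_eqI[OF has_derivative_add[OF assms[unfolded frechet_derivative_works]]]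
  by (simp add: partial_deriv_def)

lemma partial_deriv_cmult:
  assumes "f differentiable (at x)"
  shows "partial_deriv i (\<lambda>x. c * f x) x = c * partial_deriv i f x"
  using partial_deriv_eqI[OF has_derivative_mult_right[OF assms[unfolded frechet_derivative_works], of c]]
  by (simp add: partial_deriv_def)

lemma iter_partial_add:
  assumes "smooth f" "smooth g"
  shows "iter_partial is (\<lambda>x. f x + g x) = (\<lambda>x. iter_partial is f x + iter_partial is g x)"
  using assms by (induction "is")
    (simp_all add: iter_partial_Cons fun_eq_iff[of "partial_deriv _ _"] partial_deriv_add smooth_differentiable smooth_iter_partial)

lemma iter_partial_cmult:
  assumes "smooth f"
  shows "iter_partial is (\<lambda>x. c * f x) = (\<lambda>x. c * iter_partial is f x)"
  using assms by (induction "is")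
    (simp_all add: iter_partial_Cons fun_eq_iff[of "partial_deriv _ _"] partial_deriv_cmult smooth_differentiable smooth_iter_partial)

lemma smooth_add: "smooth f \<Longrightarrow> smooth g \<Longrightarrow> smooth (\<lambda>x. f x + g x)"
  unfolding smooth_def[of "\<lambda>x. f x + g x"]
  by (simp add: iter_partial_add differentiable_add smooth_differentiable smooth_iter_partial)

lemma smooth_cmult: "smooth f \<Longrightarrow> smooth (\<lambda>x. c * f x)"
  unfolding smooth_def[of "\<lambda>x. c * f x"]
  by (simp add: iter_partial_cmult smooth_differentiable smooth_iter_partial)

lemma smooth_diff:
  assumes "smooth f" "smooth g"
  shows "smooth (\<lambda>x. f x - g x)"
    and "iter_partial is (\<lambda>x. f x - g x) = (\<lambda>x. iter_partial is f x - iter_partial is g x)"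
proof -
  have g: "smooth (\<lambda>x. (-1) * g x)" by (rule smooth_cmult) fact
  have *: "(\<lambda>x. f x - g x) = (\<lambda>x. f x + (-1) * g x)" by simp
  show "smooth (\<lambda>x. f x - g x)" unfolding * by (intro smooth_add assms g)
  show "iter_partial is (\<lambda>x. f x - g x) = (\<lambda>x. iter_partial is f x - iter_partial is g x)"
    unfolding * iter_partial_add[OF assms(1) g] iter_partial_cmult[OF assms(2)] by simp
qed

lemma iter_partial_zero: "iter_partial is (\<lambda>x. 0) = (\<lambda>x. 0)"
proof (induction "is")
  case (Cons i "is")
  have "partial_deriv i (\<lambda>x. 0) x = 0" for x
    using partial_deriv_eqI[OF has_derivative_const] .
  then show ?case by (simp add: iter_partial_Cons Cons.IH fun_eq_iff)
qed simp

lemma smooth_zero: "smooth (\<lambda>x. 0)"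
  by (simp add: smooth_def iter_partial_zero)

lemma smooth_sum: "finite S \<Longrightarrow> (\<And>s. s \<in> S \<Longrightarrow> smooth (f s)) \<Longrightarrow> smooth (\<lambda>x. \<Sum>s\<in>S. f s x)"
  by (induction rule: finite_induct) (auto intro: smooth_zero smooth_add)

text \<open>Symmetry of mixed partials through the second difference
  \<open>f (x + t e\<^sub>i + t e\<^sub>j) - f (x + t e\<^sub>i) - f (x + t e\<^sub>j) + f x\<close>.\<close>

lemma second_difference_partial_deriv:
  assumes f: "smooth f" and e: "0 < e"
  shows "\<exists>d>0. \<forall>t. 0 < t \<longrightarrow> t < d \<longrightarrow>
    norm ((f (x + t *\<^sub>R axis i 1 + t *\<^sub>R axis j 1) - f (x + t *\<^sub>R axis i 1) - f (x + t *\<^sub>R axis j 1) + f x)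
      - (t * t) *\<^sub>R partial_deriv j (partial_deriv i f) x) \<le> e * (t * t)"
proof -
  let ?D = "partial_deriv j (partial_deriv i f)"
  have "continuous_on UNIV ?D" by (intro smooth_continuous smooth_partial_deriv f)
  then have "isCont ?D x" by (simp add: continuous_on_eq_continuous_at)
  then obtain d where d: "d > 0" "\<And>y. dist y x < d \<Longrightarrow> dist (?D y) (?D x) < e"
    using e unfolding continuous_at_eps_delta by blast
  have "norm ((f (x + t *\<^sub>R axis i 1 + t *\<^sub>R axis j 1) - f (x + t *\<^sub>R axis i 1) - f (x + t *\<^sub>R axis j 1) + f x)
      - (t * t) *\<^sub>R ?D x) \<le> e * (t * t)" if t: "0 < t" "t < d / 2" for t
  proof -
    \<comment> \<open>The mean value inequality is used twice: here along the j-th axis for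
      \<open>partial_deriv i f\<close>, afterwards along the i-th axis for a difference of two
      translates of f. All points visited lie within s + r \<le> 2 t of x, whence d / 2.\<close>
    have inner: "norm ((partial_deriv i f ((x + s *\<^sub>R axis i 1) + t *\<^sub>R axis j 1) - partial_deriv i f (x + s *\<^sub>R axis i 1))
        - t *\<^sub>R ?D x) \<le> e * t" if s: "0 \<le> s" "s \<le> t" for s
    proof -
      let ?g = "\<lambda>r. partial_deriv i f ((x + s *\<^sub>R axis i 1) + r *\<^sub>R axis j 1) - r *\<^sub>R ?D x"
      have "norm (?g t - ?g 0) \<le> e * t"
      proof (rule norm_increment_le[where g' = "\<lambda>r. ?D ((x + s *\<^sub>R axis i 1) + r *\<^sub>R axis j 1) - ?D x"])
        fix r assume r: "0 \<le> r" "r \<le> t"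
        show "(?g has_vector_derivative ?D ((x + s *\<^sub>R axis i 1) + r *\<^sub>R axis j 1) - ?D x) (at r)"
          by (intro has_vector_derivative_diff partial_deriv_has_vector_derivative smooth_differentiable
              smooth_partial_deriv f) (auto intro!: derivative_eq_intros)
        have "norm (s *\<^sub>R axis i (1::real) + r *\<^sub>R axis j 1) \<le> s + r"
          using s r by (intro norm_triangle_le) auto
        then have "dist ((x + s *\<^sub>R axis i 1) + r *\<^sub>R axis j 1) x < d"
          using s r t by (simp add: dist_norm algebra_simps)
        from d(2)[OF this] show "norm (?D ((x + s *\<^sub>R axis i 1) + r *\<^sub>R axis j 1) - ?D x) \<le> e"
          by (simp add: dist_norm)
      qed (use t in auto)
      then show ?thesis by (simp add: algebra_simps)
    qed
    let ?h = "\<lambda>s. f (x + t *\<^sub>R axis j 1 + s *\<^sub>R axis i 1) - f (x + s *\<^sub>R axis i 1) - s *\<^sub>R (t *\<^sub>R ?D x)"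
    have "norm (?h t - ?h 0) \<le> (e * t) * t"
    proof (rule norm_increment_le[where g' = "\<lambda>s. partial_deriv i f (x + t *\<^sub>R axis j 1 + s *\<^sub>R axis i 1)
        - partial_deriv i f (x + s *\<^sub>R axis i 1) - t *\<^sub>R ?D x"])
      fix s assume s: "0 \<le> s" "s \<le> t"
      show "(?h has_vector_derivative partial_deriv i f (x + t *\<^sub>R axis j 1 + s *\<^sub>R axis i 1)
        - partial_deriv i f (x + s *\<^sub>R axis i 1) - t *\<^sub>R ?D x) (at s)"
        by (intro has_vector_derivative_diff partial_deriv_has_vector_derivative smooth_differentiable f)
          (auto intro!: derivative_eq_intros)
      show "norm (partial_deriv i f (x + t *\<^sub>R axis j 1 + s *\<^sub>R axis i 1)
        - partial_deriv i f (x + s *\<^sub>R axis i 1) - t *\<^sub>R ?D x) \<le> e * t"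
        using inner[OF s] by (simp add: add_ac)
    qed (use t in auto)
    then show ?thesis by (simp add: algebra_simps)
  qed
  then show ?thesis using d(1) by (intro exI[of _ "d/2"]) auto
qed

lemma partial_deriv_commute:
  assumes f: "smooth f"
  shows "partial_deriv i (partial_deriv j f) = partial_deriv j (partial_deriv i f)"
proof
  fix x
  let ?A = "partial_deriv j (partial_deriv i f) x" and ?B = "partial_deriv i (partial_deriv j f) x"
  have le: "norm (?B - ?A) \<le> 0 + e" if e: "e > 0" for e
  proof -
    obtain d1 where d1: "d1 > 0" "\<And>t. 0 < t \<Longrightarrow> t < d1 \<Longrightarrow>
      norm ((f (x + t *\<^sub>R axis i 1 + t *\<^sub>R axis j 1) - f (x + t *\<^sub>R axis i 1) - f (x + t *\<^sub>R axis j 1) + f x)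
      - (t * t) *\<^sub>R ?A) \<le> e/2 * (t * t)"
      using second_difference_partial_deriv[OF f, of "e/2" x i j] e by auto
    obtain d2 where d2: "d2 > 0" "\<And>t. 0 < t \<Longrightarrow> t < d2 \<Longrightarrow>
      norm ((f (x + t *\<^sub>R axis j 1 + t *\<^sub>R axis i 1) - f (x + t *\<^sub>R axis j 1) - f (x + t *\<^sub>R axis i 1) + f x)
      - (t * t) *\<^sub>R ?B) \<le> e/2 * (t * t)"
      using second_difference_partial_deriv[OF f, of "e/2" x j i] e by auto
    define t where "t = min d1 d2 / 2"
    have t: "0 < t" "t < d1" "t < d2" using d1(1) d2(1) by (auto simp: t_def)
    define X where "X = f (x + t *\<^sub>R axis i 1 + t *\<^sub>R axis j 1) - f (x + t *\<^sub>R axis i 1) - f (x + t *\<^sub>R axis j 1) + f x"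
    \<comment> \<open>The second difference is symmetric in i and j, so one quantity X approximates
      both mixed derivatives.\<close>
    have "norm (X - (t * t) *\<^sub>R ?A) \<le> e/2 * (t * t)" "norm (X - (t * t) *\<^sub>R ?B) \<le> e/2 * (t * t)"
      using d1(2)[of t] d2(2)[of t] t by (simp_all add: X_def add_ac diff_diff_eq)
    then have "norm ((X - (t * t) *\<^sub>R ?A) - (X - (t * t) *\<^sub>R ?B)) \<le> e * (t * t)"
      using norm_triangle_ineq4[of "X - (t * t) *\<^sub>R ?A" "X - (t * t) *\<^sub>R ?B"] by linarith
    moreover have "(X - (t * t) *\<^sub>R ?A) - (X - (t * t) *\<^sub>R ?B) = (t * t) *\<^sub>R (?B - ?A)"
      by (simp add: scaleR_diff_right)
    ultimately have "(t * t) * norm (?B - ?A) \<le> (t * t) * e" by (simp add: mult.commute)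
    then show ?thesis using t by simp
  qed
  have "norm (?B - ?A) \<le> 0" by (rule field_le_epsilon) (rule le)
  then show "?B = ?A" by simp
qed

text \<open>\<open>multi_deriv\<close> differentiates in an unspecified order. Since the order is
  irrelevant, estimates can be stated for lists of directions, on which induction is available, and
  then transferred to multi-indices.\<close>

lemma iter_partial_perm:
  assumes f: "smooth f" and "mset is = mset js"
  shows "iter_partial is f = iter_partial js f"
  using assms(2)
proof (induction "is" arbitrary: js)
  case (Cons i "is")
  have "i \<in> set js" using Cons.prems by (metis list.set_intros(1) set_mset_mset)
  then obtain us vs where js: "js = us @ i # vs" by (metis split_list)
  \<comment> \<open>Adjacent transpositions carry the direction i from the inner end of
    \<open>us\<close> to the front.\<close>
  have move: "iter_partial (us @ [i]) g = iter_partial (i # us) g" if "smooth g" for us :: "'a list" and g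
    using that by (induction us) (auto simp: iter_partial_Cons intro: partial_deriv_commute smooth_iter_partial)
  have "iter_partial js f = iter_partial (us @ [i]) (iter_partial vs f)"
    by (simp add: js flip: iter_partial_append)
  also have "\<dots> = iter_partial (i # us @ vs) f"
    using move[OF smooth_iter_partial[OF f]] by (simp add: iter_partial_append flip: append_Cons)
  also have "\<dots> = partial_deriv i (iter_partial (us @ vs) f)" by (simp add: iter_partial_Cons)
  also have "iter_partial (us @ vs) f = iter_partial is f"
    using Cons.prems by (intro Cons.IH[symmetric]) (simp add: js)
  finally show ?case by (simp add: iter_partial_Cons)
qed simp

lemma ex_count_list: "\<exists>is :: 'd::finite list. \<forall>i. count_list is i = \<alpha> i"
proof -
  obtain "is" where "mset is = (\<Sum>i\<in>UNIV. replicate_mset (\<alpha> i) i)" using ex_mset by blast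
  then have "count_list is i = \<alpha> i" for i
    by (simp add: count_sum flip: count_mset)
  then show ?thesis by blast
qed

lemma multi_deriv_count_list:
  assumes f: "smooth f"
  shows "multi_deriv (count_list is) f = iter_partial is f"
proof -
  let ?js = "SOME js. \<forall>i. count_list js i = count_list is i"
  have "\<forall>i. count_list ?js i = count_list is i"
    by (rule someI_ex) (auto intro: exI[of _ "is"])
  then have "mset ?js = mset is" by (intro multiset_eqI) (simp add: count_mset)
  then show ?thesis unfolding multi_deriv_def by (intro iter_partial_perm f)
qed

lemma multi_abs_count_list: "multi_abs (count_list is) = length is"
  unfolding multi_abs_def by (simp add: sum_count_set)

lemma multi_fact_pos: "multi_fact \<alpha> > 0"
  unfolding multi_fact_def by (simp add: prod_pos)

section \<open>Seminorm bounds as real inequalities indexed by lists of directions\<close>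

lemma GS_stepD:
  assumes f: "f \<in> GS_step s h" and h: "0 < h"
  shows "smooth f" and "\<bar>multi_power x \<beta>\<bar> * norm (iter_partial is f x) \<le>
    enn2real (GS_norm s h f) * (h ^ (length is + multi_abs \<beta>) * (multi_fact (count_list is) * multi_fact \<beta>) powr s)"
proof -
  show sm: "smooth f" using f by (simp add: GS_step_def)
  have fin: "GS_norm s h f < \<infinity>" using f by (simp add: GS_step_def)
  let ?w = "h ^ (length is + multi_abs \<beta>) * (multi_fact (count_list is) * multi_fact \<beta>) powr s"
  have w: "?w > 0" using h multi_fact_pos by (metis mult_pos_pos powr_gt_zero zero_less_power order_less_irrefl)
  have "ennreal (norm (multi_power x \<beta> *\<^sub>R iter_partial is f x) / ?w) \<le> GS_norm s h f"
    unfolding GS_norm_def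
    by (rule SUP_upper2[of "(count_list is, \<beta>, x)"])
      (auto simp: multi_deriv_count_list[OF sm] multi_abs_count_list)
  then have "norm (multi_power x \<beta> *\<^sub>R iter_partial is f x) / ?w \<le> enn2real (GS_norm s h f)"
    using fin w by (metis enn2real_ennreal enn2real_mono zero_le_divide_iff norm_ge_zero less_imp_le infinity_ennreal_def)
  then show "\<bar>multi_power x \<beta>\<bar> * norm (iter_partial is f x) \<le> enn2real (GS_norm s h f) * ?w"
    using w by (simp add: pos_divide_le_eq)
qed

text \<open>Every multi-index is \<open>count_list\<close> of some list, so testing lists exhausts
  the supremum.\<close>

lemma GS_norm_le:
  fixes f :: "real^'a::finite \<Rightarrow> complex"
  assumes sm: "smooth f" and h: "0 < h"
    and "\<And>x \<beta> is. \<bar>multi_power x \<beta>\<bar> * norm (iter_partial is f x) \<le>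
    M * (h ^ (length is + multi_abs \<beta>) * (multi_fact (count_list is) * multi_fact \<beta>) powr s)"
  shows "GS_norm s h f \<le> ennreal M" and "f \<in> GS_step s h"
proof -
  show "GS_norm s h f \<le> ennreal M"
    unfolding GS_norm_def
  proof (rule SUP_least, clarify)
    fix \<alpha> \<beta> :: "'a \<Rightarrow> nat" and x
    obtain "is" where cl: "count_list is = \<alpha>" using ex_count_list[of \<alpha>] by auto
    let ?w = "h ^ (length is + multi_abs \<beta>) * (multi_fact (count_list is) * multi_fact \<beta>) powr s"
    have w: "?w > 0" using h multi_fact_pos by (metis mult_pos_pos powr_gt_zero zero_less_power order_less_irrefl)
    show "ennreal (norm (multi_power x \<beta> *\<^sub>R multi_deriv \<alpha> f x) / (h ^ (multi_abs \<alpha> + multi_abs \<beta>) * (multi_fact \<alpha> * multi_fact \<beta>) powr s)) \<le> ennreal M"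
      using assms(3)[of x \<beta> "is"] w unfolding cl[symmetric]
      by (intro ennreal_leI) (simp add: multi_deriv_count_list[OF sm] multi_abs_count_list pos_divide_le_eq)
  qed
  then show "f \<in> GS_step s h" using sm by (auto simp: GS_step_def intro: le_less_trans)
qed

text \<open>Differentiation under the integral sign: by the mean value inequality each difference
  quotient is dominated by the bound on the next derivative. The majorant b depends on the parameter
  w only; the constant in front may change with the list.\<close>

lemma iter_partial_integral:
  fixes N :: "'m \<Rightarrow> real^'d::finite \<Rightarrow> complex"
  assumes f: "smooth f" and N: "\<And>w. smooth (N w)"
    and \<Phi>[measurable]: "\<Phi> \<in> borel_measurable M" and m: "\<And>y. (\<lambda>w. N w y) \<in> borel_measurable M"
    and b: "\<And>is. \<exists>C. \<forall>w y. norm (iter_partial is (N w) y) \<le> C * b w"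
    and int: "integrable M (\<lambda>w. norm (\<Phi> w) * b w)"
    and eq: "\<And>y. f y = (\<integral>w. \<Phi> w * N w y \<partial>M)"
  shows "(\<lambda>w. iter_partial is (N w) y) \<in> borel_measurable M \<and>
    iter_partial is f y = (\<integral>w. \<Phi> w * iter_partial is (N w) y \<partial>M)"
proof (induction "is" arbitrary: y)
  case Nil
  then show ?case using m eq by simp
next
  case (Cons i "is")
  let ?t = "\<lambda>n. inverse (real (Suc n))"
  let ?q = "\<lambda>g n. real (Suc n) *\<^sub>R (g (y + ?t n *\<^sub>R axis i 1) - g y)"
  have [measurable]: "(\<lambda>w. iter_partial is (N w) z) \<in> borel_measurable M" for z
    using Cons.IH by blast
  obtain C1 where C1: "\<And>w y. norm (iter_partial (i # is) (N w) y) \<le> C1 * b w" using b by blast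
  obtain C0 where C0: "\<And>w y. norm (iter_partial is (N w) y) \<le> C0 * b w" using b by blast
  have lim: "(\<lambda>n. ?q (iter_partial is (N w)) n) \<longlonglongrightarrow> iter_partial (i # is) (N w) y" for w
    unfolding iter_partial_Cons by (intro partial_deriv_LIMSEQ smooth_differentiable smooth_iter_partial N)
  \<comment> \<open>A pointwise limit of measurable difference quotients; this is why measurability
    is carried along in the induction.\<close>
  have meas: "(\<lambda>w. iter_partial (i # is) (N w) y) \<in> borel_measurable M"
    by (rule borel_measurable_LIMSEQ_metric[OF _ lim]) measurable
  have int0: "integrable M (\<lambda>w. \<Phi> w * iter_partial is (N w) z)" for z
  proof (rule Bochner_Integration.integrable_bound[OF integrable_mult_right[OF int, of C0]])
    show "AE w in M. norm (\<Phi> w * iter_partial is (N w) z) \<le> norm (C0 * (norm (\<Phi> w) * b w))"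
    proof (rule AE_I2)
      fix w
      have "norm (\<Phi> w * iter_partial is (N w) z) \<le> norm (\<Phi> w) * (C0 * b w)"
        unfolding norm_mult by (intro mult_left_mono C0) auto
      then show "norm (\<Phi> w * iter_partial is (N w) z) \<le> norm (C0 * (norm (\<Phi> w) * b w))"
        by (simp add: mult_ac)
    qed
  qed simp
  have "(\<lambda>n. \<integral>w. \<Phi> w * ?q (iter_partial is (N w)) n \<partial>M) \<longlonglongrightarrow> (\<integral>w. \<Phi> w * iter_partial (i # is) (N w) y \<partial>M)"
  proof (rule integral_dominated_convergence[where w = "\<lambda>w. C1 * (norm (\<Phi> w) * b w)"])
    show "AE w in M. norm (\<Phi> w * ?q (iter_partial is (N w)) n) \<le> C1 * (norm (\<Phi> w) * b w)" for n
    proof (rule AE_I2)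
      fix w
      have "norm (iter_partial is (N w) (y + ?t n *\<^sub>R axis i 1) - iter_partial is (N w) y) \<le> (C1 * b w) * ?t n"
        using C1 by (intro partial_deriv_increment_le)
          (auto intro!: smooth_differentiable smooth_iter_partial N simp: iter_partial_Cons)
      then have "norm (?q (iter_partial is (N w)) n) \<le> C1 * b w"
        by (simp add: divide_simps mult_ac del: of_nat_Suc)
      then show "norm (\<Phi> w * ?q (iter_partial is (N w)) n) \<le> C1 * (norm (\<Phi> w) * b w)"
        unfolding norm_mult by (metis mult.left_commute mult_left_mono norm_ge_zero)
    qed
    show "AE w in M. (\<lambda>n. \<Phi> w * ?q (iter_partial is (N w)) n) \<longlonglongrightarrow> \<Phi> w * iter_partial (i # is) (N w) y"
      by (intro AE_I2 tendsto_mult tendsto_const lim)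
  qed (use meas int in auto)
  moreover have "(\<integral>w. \<Phi> w * ?q (iter_partial is (N w)) n \<partial>M) = ?q (iter_partial is f) n" for n
  proof -
    have "\<Phi> w * ?q (iter_partial is (N w)) n = real (Suc n) *\<^sub>R
      (\<Phi> w * iter_partial is (N w) (y + ?t n *\<^sub>R axis i 1) - \<Phi> w * iter_partial is (N w) y)" for w
      by (simp add: right_diff_distrib del: of_nat_Suc)
    then show ?thesis using Cons.IH int0 by (simp del: of_nat_Suc)
  qed
  moreover have "(\<lambda>n. ?q (iter_partial is f) n) \<longlonglongrightarrow> iter_partial (i # is) f y"
    unfolding iter_partial_Cons by (intro partial_deriv_LIMSEQ smooth_differentiable smooth_iter_partial f)
  ultimately have "iter_partial (i # is) f y = (\<integral>w. \<Phi> w * iter_partial (i # is) (N w) y \<partial>M)"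
    using LIMSEQ_unique by simp
  with meas show ?case by simp
qed

section \<open>The Bargmann kernel as an element of the Gelfand-Shilov space\<close>

abbreviation (input) GS_weight :: "real \<Rightarrow> real \<Rightarrow> 'd::finite list \<Rightarrow> ('d \<Rightarrow> nat) \<Rightarrow> real" where
  "GS_weight s h is \<beta> \<equiv> h ^ (length is + multi_abs \<beta>) * (multi_fact (count_list is) * multi_fact \<beta>) powr s"

lemma GS_weight_pos: "0 < h \<Longrightarrow> 0 < GS_weight s h is \<beta>"
  using multi_fact_pos by (metis mult_pos_pos powr_gt_zero zero_less_power order_less_irrefl)

text \<open>For products of entire functions of single coordinates, mixed real partials factor into
  complex derivatives in one variable, which makes Cauchy's inequality available for all of
  them.\<close>

lemma smooth_iter_partial_prod:
  fixes g :: "'d::finite \<Rightarrow> complex \<Rightarrow> complex"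
  assumes g: "\<And>j. g j holomorphic_on UNIV"
  shows "iter_partial is (\<lambda>y. \<Prod>j\<in>UNIV. g j (of_real (y $ j))) =
      (\<lambda>y. \<Prod>j\<in>UNIV. (deriv ^^ count_list is j) (g j) (of_real (y $ j)))"
    and "smooth (\<lambda>y. \<Prod>j\<in>UNIV. g j (of_real (y $ j)))"
proof -
  have der: "((\<lambda>y::real^'d. \<Prod>j\<in>UNIV. (deriv ^^ n j) (g j) (of_real (y $ j))) has_derivative
     (\<lambda>v. \<Sum>i\<in>UNIV. (of_real (v $ i) * deriv ((deriv ^^ n i) (g i)) (of_real (y $ i)))
        * (\<Prod>j\<in>UNIV - {i}. (deriv ^^ n j) (g j) (of_real (y $ j))))) (at y)" for n y
  proof (rule has_derivative_prod)
    fix i :: 'd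
    have "(deriv ^^ n i) (g i) holomorphic_on UNIV" by (intro holomorphic_higher_deriv g) auto
    then have "((deriv ^^ n i) (g i) has_field_derivative deriv ((deriv ^^ n i) (g i)) (of_real (y $ i))) (at (of_real (y $ i)))"
      using holomorphic_derivI open_UNIV by blast
    moreover have "((\<lambda>y. complex_of_real (y $ i)) has_derivative (\<lambda>v. of_real (v $ i))) (at y)"
      by (intro bounded_linear_imp_has_derivative
        bounded_linear_compose[OF bounded_linear_of_real bounded_linear_vec_nth])
    ultimately show "((\<lambda>y::real^'d. (deriv ^^ n i) (g i) (of_real (y $ i))) has_derivative
       (\<lambda>v. of_real (v $ i) * deriv ((deriv ^^ n i) (g i)) (of_real (y $ i)))) (at y)"
      unfolding has_field_derivative_def
      using has_derivative_compose[of "\<lambda>y. complex_of_real (y $ i)"] by (fastforce simp: mult.commute)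
  qed
  show eq: "iter_partial is (\<lambda>y. \<Prod>j\<in>UNIV. g j (of_real (y $ j))) =
      (\<lambda>y. \<Prod>j\<in>UNIV. (deriv ^^ count_list is j) (g j) (of_real (y $ j)))" for "is"
  proof (induction "is")
    case (Cons i "is")
    show ?case
    proof
      fix y :: "real^'d"
      let ?n = "count_list is"
      have "iter_partial (i # is) (\<lambda>y. \<Prod>j\<in>UNIV. g j (of_real (y $ j))) y =
        (\<Sum>k\<in>UNIV. (of_real (axis i 1 $ k) * deriv ((deriv ^^ ?n k) (g k)) (of_real (y $ k)))
        * (\<Prod>j\<in>UNIV - {k}. (deriv ^^ ?n j) (g j) (of_real (y $ j))))"
        unfolding iter_partial_Cons Cons.IH by (rule partial_deriv_eqI[OF der])
      also have "\<dots> = (\<Sum>k\<in>UNIV. if k = i then deriv ((deriv ^^ ?n k) (g k)) (of_real (y $ k))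
        * (\<Prod>j\<in>UNIV - {k}. (deriv ^^ ?n j) (g j) (of_real (y $ j))) else 0)"
        by (intro sum.cong refl) (auto simp: axis_def)
      also have "\<dots> = deriv ((deriv ^^ ?n i) (g i)) (of_real (y $ i))
        * (\<Prod>j\<in>UNIV - {i}. (deriv ^^ ?n j) (g j) (of_real (y $ j)))"
        by simp
      also have "\<dots> = (\<Prod>j\<in>UNIV. (deriv ^^ count_list (i # is) j) (g j) (of_real (y $ j)))"
        by (subst prod.remove[of UNIV i]) (auto intro!: prod.cong)
      finally show "iter_partial (i # is) (\<lambda>y. \<Prod>j\<in>UNIV. g j (of_real (y $ j))) y =
        (\<Prod>j\<in>UNIV. (deriv ^^ count_list (i # is) j) (g j) (of_real (y $ j)))" .
    qed
  qed simp
  show "smooth (\<lambda>y. \<Prod>j\<in>UNIV. g j (of_real (y $ j)))"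
    unfolding smooth_def eq using der by (auto simp: differentiable_def)
qed

text \<open>The one-dimensional Bargmann kernel without its constant. The variable y is complex
  because derivatives in y are estimated on circles around real points.\<close>

definition bkernel1 :: "complex \<Rightarrow> complex \<Rightarrow> complex" where
  "bkernel1 \<zeta> y = exp (- (1/2) * (\<zeta>\<^sup>2 + y\<^sup>2) + of_real (sqrt 2) * \<zeta> * y)"

definition bkernel1_deriv :: "complex \<Rightarrow> complex \<Rightarrow> complex" where
  "bkernel1_deriv \<zeta> y = (of_real (sqrt 2) * y - \<zeta>) * bkernel1 \<zeta> y"

text \<open>The probabilists' Hermite polynomials. They serve to show that differentiations in y and
  in \<zeta> commute; the estimates come from Cauchy's inequality instead.\<close>

fun hermite_poly :: "nat \<Rightarrow> complex poly" where
  "hermite_poly 0 = 1"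
| "hermite_poly (Suc n) = [:0, 1:] * hermite_poly n - pderiv (hermite_poly n)"

lemma bargmann_kernel_prod:
  "bargmann_kernel z y = complex_of_real (pi powr (- (real CARD('d) / 4))) *
     (\<Prod>j\<in>UNIV. bkernel1 (z $ j) (of_real (y $ j)))" for z :: "complex^'d::finite"
proof -
  have "complex_of_real ((norm y)\<^sup>2) = (\<Sum>j\<in>UNIV. (of_real (y $ j))\<^sup>2)"
    by (simp add: norm_vec_def L2_set_def sum_nonneg)
  then have "- (1/2) * (cbilin z z + complex_of_real ((norm y)\<^sup>2)) +
       complex_of_real (sqrt 2) * cbilin z (\<chi> j. complex_of_real (y $ j)) =
     (\<Sum>j\<in>UNIV. - (1/2) * ((z $ j)\<^sup>2 + (of_real (y $ j))\<^sup>2) + of_real (sqrt 2) * z $ j * of_real (y $ j))"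
    by (simp add: cbilin_def sum.distrib sum_distrib_left sum_subtractf sum_negf sum_divide_distrib power2_eq_square algebra_simps)
  then show ?thesis by (simp add: bargmann_kernel_def bkernel1_def exp_sum)
qed

lemma holomorphic_bkernel1: "bkernel1 \<zeta> holomorphic_on S" "bkernel1_deriv \<zeta> holomorphic_on S"
  unfolding bkernel1_def bkernel1_deriv_def by (intro holomorphic_intros)+

lemma bkernel1_higher_deriv:
  "(deriv ^^ n) (bkernel1 \<zeta>) = (\<lambda>y. poly (hermite_poly n) (of_real (sqrt 2) * \<zeta> - y) * bkernel1 \<zeta> y)"
proof (induction n)
  case (Suc n)
  have "((\<lambda>y. poly (hermite_poly n) (of_real (sqrt 2) * \<zeta> - y) * bkernel1 \<zeta> y) has_field_derivative
    poly (hermite_poly (Suc n)) (of_real (sqrt 2) * \<zeta> - y) * bkernel1 \<zeta> y) (at y)" for y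
    unfolding bkernel1_def
    by (auto intro!: derivative_eq_intros simp: algebra_simps)
  then show ?case unfolding funpow.simps comp_def Suc by (intro ext DERIV_imp_deriv)
qed simp

lemma bkernel1_deriv_higher_deriv:
  "(deriv ^^ n) (bkernel1_deriv \<zeta>) = (\<lambda>y. (of_real (sqrt 2) * poly (pderiv (hermite_poly n)) (of_real (sqrt 2) * \<zeta> - y)
     + poly (hermite_poly n) (of_real (sqrt 2) * \<zeta> - y) * (of_real (sqrt 2) * y - \<zeta>)) * bkernel1 \<zeta> y)"
proof (induction n)
  case 0
  then show ?case by (simp add: bkernel1_deriv_def fun_eq_iff)
next
  case (Suc n)
  have "((\<lambda>y. (of_real (sqrt 2) * poly (pderiv (hermite_poly n)) (of_real (sqrt 2) * \<zeta> - y)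
     + poly (hermite_poly n) (of_real (sqrt 2) * \<zeta> - y) * (of_real (sqrt 2) * y - \<zeta>)) * bkernel1 \<zeta> y) has_field_derivative
    (of_real (sqrt 2) * poly (pderiv (hermite_poly (Suc n))) (of_real (sqrt 2) * \<zeta> - y)
     + poly (hermite_poly (Suc n)) (of_real (sqrt 2) * \<zeta> - y) * (of_real (sqrt 2) * y - \<zeta>)) * bkernel1 \<zeta> y) (at y)" for y
    unfolding bkernel1_def
    by (auto intro!: derivative_eq_intros simp: pderiv_diff pderiv_mult pderiv_pCons algebra_simps)
  then show ?case unfolding funpow.simps comp_def Suc by (intro ext DERIV_imp_deriv)
qed

text \<open>\<open>bkernel1_deriv\<close> is the \<zeta>-derivative of \<open>bkernel1\<close>, and
  it commutes with derivatives in y: compare the two closed forms.\<close>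

lemma bkernel1_higher_deriv_has_field_derivative:
  "((\<lambda>\<zeta>. (deriv ^^ n) (bkernel1 \<zeta>) y) has_field_derivative (deriv ^^ n) (bkernel1_deriv \<zeta>) y) (at \<zeta>)"
  unfolding bkernel1_higher_deriv bkernel1_deriv_higher_deriv bkernel1_def
  by (auto intro!: derivative_eq_intros simp: algebra_simps)

lemma power_le_fact_exp:
  fixes s :: real
  assumes "0 \<le> s"
  shows "s ^ n \<le> fact n * exp s"
proof -
  have "(\<lambda>n. s ^ n /\<^sub>R fact n) sums exp s" by (rule exp_converges)
  then have "s ^ n /\<^sub>R fact n \<le> exp s"
    using assms sum_le_suminf[of "\<lambda>n. s ^ n /\<^sub>R fact n" "{n}"] by (auto simp: sums_iff)
  then show ?thesis by (simp add: field_simps)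
qed

text \<open>At t = 0 and with x, \<xi> equal to sqrt 2 times the real and imaginary part of \<zeta>,
  the exponent has real part |\<zeta>|^2 / 2 - (y - x)^2 / 2. The extra \<delta> |\<zeta>|^2 buys
  Gaussian decay around 0 instead of x, and absorbs the cross term between \<xi> and t.\<close>

lemma norm_bkernel1_le:
  fixes y :: real
  assumes \<delta>: "0 < \<delta>" "\<delta> \<le> 1/2" and t: "norm t \<le> \<rho>"
  shows "norm (bkernel1 \<zeta> (of_real y + t)) \<le>
    exp ((1/2 + \<delta>) * (norm \<zeta>)\<^sup>2 - \<delta>/4 * y\<^sup>2 + (3/2 + 1 / (2 * \<delta>)) * \<rho>\<^sup>2)"
proof -
  define x where "x = sqrt 2 * Re \<zeta>"
  define \<xi> where "\<xi> = sqrt 2 * Im \<zeta>"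
  have \<rho>: "0 \<le> \<rho>" using t norm_ge_zero order_trans by blast
  have nz: "(norm \<zeta>)\<^sup>2 = (x\<^sup>2 + \<xi>\<^sup>2) / 2"
    by (simp add: x_def \<xi>_def cmod_power2 power_mult_distrib)
  have xs: "Re \<zeta> = x / sqrt 2" "Im \<zeta> = \<xi> / sqrt 2" by (auto simp: x_def \<xi>_def)
  have "Re (- (1/2) * (\<zeta>\<^sup>2 + (of_real y + t)\<^sup>2) + of_real (sqrt 2) * \<zeta> * (of_real y + t)) =
     (norm \<zeta>)\<^sup>2 / 2 - (y - x)\<^sup>2 / 2 - (y - x) * Re t - \<xi> * Im t - ((Re t)\<^sup>2 - (Im t)\<^sup>2) / 2"
    unfolding nz by (simp add: xs power2_eq_square field_simps)
  also have "\<dots> \<le> (norm \<zeta>)\<^sup>2 / 2 - (y - x)\<^sup>2 / 2 + \<bar>y - x\<bar> * \<rho> + \<bar>\<xi>\<bar> * \<rho> + \<rho>\<^sup>2 / 2"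
  proof -
    have rt: "\<bar>Re t\<bar> \<le> \<rho>" "\<bar>Im t\<bar> \<le> \<rho>" using t abs_Re_le_cmod abs_Im_le_cmod order_trans by blast+
    have ab: "- (a * b) \<le> \<bar>a\<bar> * \<rho>" if "\<bar>b\<bar> \<le> \<rho>" for a b :: real
    proof -
      have "- (a * b) \<le> \<bar>a\<bar> * \<bar>b\<bar>" by (simp flip: abs_mult)
      also have "\<dots> \<le> \<bar>a\<bar> * \<rho>" using that by (intro mult_left_mono) auto
      finally show ?thesis .
    qed
    have "- ((y - x) * Re t) \<le> \<bar>y - x\<bar> * \<rho>"
      using rt by (intro ab)
    moreover have "- (\<xi> * Im t) \<le> \<bar>\<xi>\<bar> * \<rho>"
      using rt by (intro ab)
    moreover have "(Im t)\<^sup>2 \<le> \<rho>\<^sup>2" using rt \<rho> by (simp add: abs_le_square_iff[symmetric])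
    moreover have "0 \<le> (Re t)\<^sup>2" by simp
    ultimately show ?thesis by argo
  qed
  also have "\<dots> \<le> (1/2 + \<delta>) * (norm \<zeta>)\<^sup>2 - \<delta>/4 * y\<^sup>2 + (3/2 + 1 / (2 * \<delta>)) * \<rho>\<^sup>2"
  proof -
    have "0 \<le> (\<bar>y - x\<bar> / 2 - \<rho>)\<^sup>2" by simp
    then have 1: "\<bar>y - x\<bar> * \<rho> \<le> (y - x)\<^sup>2 / 4 + \<rho>\<^sup>2"
      by (simp add: power2_diff power_divide)
    have "0 \<le> (sqrt (\<delta>/2) * \<bar>\<xi>\<bar> - \<rho> / (2 * sqrt (\<delta>/2)))\<^sup>2" by simp
    also have "\<dots> = \<delta>/2 * \<xi>\<^sup>2 + \<rho>\<^sup>2 / (2 * \<delta>) - \<bar>\<xi>\<bar> * \<rho>"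
      using \<delta> by (simp add: power2_diff power_mult_distrib power_divide)
    finally have 2: "\<bar>\<xi>\<bar> * \<rho> \<le> \<delta>/2 * \<xi>\<^sup>2 + \<rho>\<^sup>2 / (2 * \<delta>)" by simp
    \<comment> \<open>One half of (y - x)^2 / 2 has paid for the cross term with \<rho>; the other
      half, together with \<delta> x^2 / 2, yields decay in y because (y - 2 x)^2 is
      nonnegative.\<close>
    have "\<delta>/2 * (y - x)\<^sup>2 \<le> 1/4 * (y - x)\<^sup>2" using \<delta> by (intro mult_right_mono) auto
    moreover have "0 \<le> \<delta>/4 * (y - 2 * x)\<^sup>2" using \<delta> by simp
    moreover have "\<delta>/4 * (y - 2 * x)\<^sup>2 = \<delta>/2 * (y - x)\<^sup>2 + \<delta>/2 * x\<^sup>2 - \<delta>/4 * y\<^sup>2"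
      by (simp add: power2_eq_square algebra_simps)
    ultimately have 3: "- ((y - x)\<^sup>2 / 4) \<le> - (\<delta>/4 * y\<^sup>2) + \<delta>/2 * x\<^sup>2"
      by linarith
    have 4: "(1/2 + \<delta>) * (norm \<zeta>)\<^sup>2 = (norm \<zeta>)\<^sup>2 / 2 + \<delta>/2 * x\<^sup>2 + \<delta>/2 * \<xi>\<^sup>2"
      unfolding nz by (simp add: field_simps)
    have 5: "(3/2 + 1 / (2 * \<delta>)) * \<rho>\<^sup>2 = 3/2 * \<rho>\<^sup>2 + \<rho>\<^sup>2 / (2 * \<delta>)" by (simp add: field_simps)
    show ?thesis using 1 2 3 unfolding 4 5 by argo
  qed
  finally show ?thesis unfolding bkernel1_def by simp
qed

text \<open>Cauchy's inequality on a circle of radius about sqrt n gives n! / n^(n/2) up to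
  geometric factors, that is, sqrt (n!): the Gaussian growth in complex directions is what matches
  the index 1/2. The decay in y bounds the powers in the same way.\<close>

lemma bkernel1_GS_bound:
  assumes \<delta>: "0 < \<delta>" "\<delta> \<le> 1/2"
  shows "\<exists>h>0. \<exists>K>0. \<forall>\<zeta> n b (y::real). \<bar>y\<bar> ^ b * norm ((deriv ^^ n) (bkernel1 \<zeta>) (of_real y)) \<le>
    K * h ^ (n + b) * sqrt (fact n * fact b) * exp ((1/2 + \<delta>) * (norm \<zeta>)\<^sup>2)"
proof -
  define C where "C = 3/2 + 1 / (2 * \<delta>)"
  \<comment> \<open>\<open>exp C\<close> absorbs the growth on the Cauchy circle, the square root
    absorbs the powers of y.\<close>
  define h where "h = max (exp C) (sqrt (2 / \<delta>))"
  have "C > 0" using \<delta> by (simp add: C_def add_pos_pos)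
  have h: "exp C \<le> h" "sqrt (2/\<delta>) \<le> h" "h > 0" by (auto simp: h_def less_max_iff_disj)
  have "\<bar>y\<bar> ^ b * norm ((deriv ^^ n) (bkernel1 \<zeta>) (of_real y)) \<le>
    exp C * h ^ (n + b) * sqrt (fact n * fact b) * exp ((1/2 + \<delta>) * (norm \<zeta>)\<^sup>2)" for \<zeta> n b and y :: real
  proof -
    \<comment> \<open>The radius balances n! / \<rho>^n against exp (C \<rho>^2); the summand 1
      keeps it positive for n = 0.\<close>
    define \<rho> where "\<rho> = sqrt (real n + 1)"
    have \<rho>: "\<rho> > 0" "\<rho>\<^sup>2 = real n + 1" by (auto simp: \<rho>_def)
    let ?E = "exp ((1/2 + \<delta>) * (norm \<zeta>)\<^sup>2)"
    have "norm ((deriv ^^ n) (bkernel1 \<zeta>) (of_real y)) \<le> fact n *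
      exp ((1/2 + \<delta>) * (norm \<zeta>)\<^sup>2 - \<delta>/4 * y\<^sup>2 + C * \<rho>\<^sup>2) / \<rho> ^ n"
    proof (rule Cauchy_inequality)
      show "continuous_on (cball (of_real y) \<rho>) (bkernel1 \<zeta>)"
        by (intro holomorphic_on_imp_continuous_on holomorphic_bkernel1)
      fix x :: complex assume "norm (of_real y - x) = \<rho>"
      then show "norm (bkernel1 \<zeta> x) \<le> exp ((1/2 + \<delta>) * (norm \<zeta>)\<^sup>2 - \<delta>/4 * y\<^sup>2 + C * \<rho>\<^sup>2)"
        using norm_bkernel1_le[OF \<delta>, where t = "x - of_real y" and \<rho> = \<rho> and \<zeta> = \<zeta> and y = y] by (simp add: norm_minus_commute C_def)
    qed (use \<rho> holomorphic_bkernel1 in auto)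
    also have "\<dots> = ?E * exp (- \<delta>/4 * y\<^sup>2) * (exp C * exp C ^ n) * (fact n / \<rho> ^ n)"
    proof -
      have "exp ((1/2 + \<delta>) * (norm \<zeta>)\<^sup>2 - \<delta>/4 * y\<^sup>2 + C * \<rho>\<^sup>2) = ?E * exp (- \<delta>/4 * y\<^sup>2) * (exp C * exp C ^ n)"
        unfolding exp_of_nat_mult[symmetric] exp_add[symmetric] by (simp add: \<rho> algebra_simps)
      then show ?thesis by simp
    qed
    also have "\<dots> \<le> ?E * exp (- \<delta>/4 * y\<^sup>2) * (exp C * h ^ n) * sqrt (fact n)"
    proof (intro mult_mono power_mono h)
      have "sqrt (fact n) \<le> \<rho> ^ n"
      proof -
        have "(fact n :: real) \<le> (real n + 1) ^ n"
        proof -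
          have "(fact n :: real) \<le> real n ^ n" using fact_le_power[of n, where 'a = real] by simp
          also have "\<dots> \<le> (real n + 1) ^ n" by (intro power_mono) auto
          finally show ?thesis .
        qed
        then show ?thesis by (simp add: \<rho>_def real_sqrt_power[symmetric])
      qed
      then have "fact n \<le> sqrt (fact n) * \<rho> ^ n"
        using mult_left_mono[of "sqrt (fact n)" "\<rho> ^ n" "sqrt (fact n)"] by simp
      then show "fact n / \<rho> ^ n \<le> sqrt (fact n)" using \<rho> by (simp add: pos_divide_le_eq)
    qed (use \<rho> h in auto)
    finally have 1: "norm ((deriv ^^ n) (bkernel1 \<zeta>) (of_real y)) \<le> ?E * exp (- \<delta>/4 * y\<^sup>2) * (exp C * h ^ n) * sqrt (fact n)" .
    have pw: "(a\<^sup>2) ^ b = (a ^ b)\<^sup>2" for a :: real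
      unfolding power_mult[symmetric] by (simp only: mult.commute)
    \<comment> \<open>Squaring reduces the claim to one term of the exponential series at \<delta>
      y^2 / 2.\<close>
    have "(\<bar>y\<bar> ^ b * exp (- \<delta>/4 * y\<^sup>2))\<^sup>2 \<le> (h ^ b * sqrt (fact b))\<^sup>2"
    proof -
      have "(\<delta>/2 * y\<^sup>2) ^ b \<le> fact b * exp (\<delta>/2 * y\<^sup>2)"
        using \<delta> by (intro power_le_fact_exp) auto
      then have "(\<delta>/2) ^ b * ((y\<^sup>2) ^ b * exp (- (\<delta>/2 * y\<^sup>2))) \<le> fact b"
        by (simp add: exp_minus power_mult_distrib field_simps)
      then have "(y\<^sup>2) ^ b * exp (- (\<delta>/2 * y\<^sup>2)) \<le> (2/\<delta>) ^ b * fact b"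
        using \<delta> by (simp add: power_divide field_simps)
      also have "\<dots> \<le> (h\<^sup>2) ^ b * fact b"
      proof (intro mult_right_mono power_mono)
        have "(sqrt (2/\<delta>))\<^sup>2 \<le> h\<^sup>2" using h \<delta> by (intro power_mono) auto
        then show "2/\<delta> \<le> h\<^sup>2" using \<delta> by simp
      qed (use \<delta> in auto)
      also have "(y\<^sup>2) ^ b * exp (- (\<delta>/2 * y\<^sup>2)) = (\<bar>y\<bar> ^ b * exp (- \<delta>/4 * y\<^sup>2))\<^sup>2"
      proof -
        have "(exp (- \<delta>/4 * y\<^sup>2))\<^sup>2 = exp (- (\<delta>/2 * y\<^sup>2))"
          by (simp add: power2_eq_square flip: exp_add)
        moreover have "(\<bar>y\<bar> ^ b)\<^sup>2 = (y\<^sup>2) ^ b"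
          unfolding pw[symmetric] by simp
        ultimately show ?thesis by (simp add: power_mult_distrib)
      qed
      finally show ?thesis by (simp add: power_mult_distrib pw)
    qed
    then have 2: "\<bar>y\<bar> ^ b * exp (- \<delta>/4 * y\<^sup>2) \<le> h ^ b * sqrt (fact b)"
      using h by (intro power2_le_imp_le[OF _ mult_nonneg_nonneg]) auto
    have "\<bar>y\<bar> ^ b * norm ((deriv ^^ n) (bkernel1 \<zeta>) (of_real y)) \<le>
       \<bar>y\<bar> ^ b * (?E * exp (- \<delta>/4 * y\<^sup>2) * (exp C * h ^ n) * sqrt (fact n))"
      by (intro mult_left_mono 1) auto
    also have "\<dots> = (\<bar>y\<bar> ^ b * exp (- \<delta>/4 * y\<^sup>2)) * (?E * (exp C * h ^ n) * sqrt (fact n))" by (simp add: mult_ac)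
    also have "\<dots> \<le> (h ^ b * sqrt (fact b)) * (?E * (exp C * h ^ n) * sqrt (fact n))"
      using h by (intro mult_right_mono 2) auto
    finally show ?thesis by (simp add: power_add real_sqrt_mult mult_ac)
  qed
  then show ?thesis using h by (intro exI[of _ h] conjI exI[of _ "exp C"]) auto
qed

section \<open>The Bargmann kernel in several variables\<close>

lemma norm_vec_power2: "(norm z)\<^sup>2 = (\<Sum>j\<in>UNIV. (norm (z $ j))\<^sup>2)" for z :: "'a::real_normed_vector^'d::finite"
  by (simp add: norm_vec_def L2_set_def sum_nonneg)

lemma norm_smult_complex: "norm (c *s v) = norm c * norm v" for v :: "complex^'d::finite"
proof -
  have "(norm (c *s v))\<^sup>2 = (norm c * norm v)\<^sup>2"
    by (simp add: norm_vec_power2 norm_mult power_mult_distrib sum_distrib_left)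
  then show ?thesis by (simp add: power2_eq_iff_nonneg)
qed

lemma smooth_bargmann_kernel: "smooth (bargmann_kernel z)"
  and iter_partial_bargmann_kernel: "iter_partial is (bargmann_kernel z) y = complex_of_real (pi powr (- (real CARD('d) / 4))) *
     (\<Prod>j\<in>UNIV. (deriv ^^ count_list is j) (bkernel1 (z $ j)) (of_real (y $ j)))" for z :: "complex^'d::finite"
  using smooth_iter_partial_prod[of "\<lambda>j. bkernel1 (z $ j)"] holomorphic_bkernel1
  by (simp_all add: bargmann_kernel_prod[abs_def] smooth_cmult iter_partial_cmult)

lemma real_sqrt_prod: "sqrt (\<Prod>i\<in>A. f i) = (\<Prod>i\<in>A. sqrt (f i))"
  by (induction A rule: infinite_finite_induct) (auto simp: real_sqrt_mult)

text \<open>Neither h nor K depends on z, so all kernels lie in one step and superpositions of them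
  can be controlled there by the exponential factor alone.\<close>

lemma bargmann_kernel_GS_bound:
  assumes \<delta>: "0 < \<delta>" "\<delta> \<le> 1/2"
  shows "\<exists>h>0. \<exists>K>0. \<forall>(z::complex^'d::finite) \<beta> is y. \<bar>multi_power y \<beta>\<bar> * norm (iter_partial is (bargmann_kernel z) y) \<le>
    K * exp ((1/2 + \<delta>) * (norm z)\<^sup>2) * GS_weight (1/2) h is \<beta>"
proof -
  obtain h K where h: "h > 0" and K: "K > 0" and
    1: "\<And>\<zeta> n b (y::real). \<bar>y\<bar> ^ b * norm ((deriv ^^ n) (bkernel1 \<zeta>) (of_real y)) \<le>
    K * h ^ (n + b) * sqrt (fact n * fact b) * exp ((1/2 + \<delta>) * (norm \<zeta>)\<^sup>2)"
    using bkernel1_GS_bound[OF \<delta>] by blast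
  let ?c = "pi powr (- (real CARD('d) / 4))"
  have "\<bar>multi_power y \<beta>\<bar> * norm (iter_partial is (bargmann_kernel z) y) \<le>
    (?c * K ^ CARD('d)) * exp ((1/2 + \<delta>) * (norm z)\<^sup>2) * GS_weight (1/2) h is \<beta>"
    for z :: "complex^'d" and \<beta> "is" y
  proof -
    have "\<bar>multi_power y \<beta>\<bar> * norm (iter_partial is (bargmann_kernel z) y) =
      ?c * (\<Prod>j\<in>UNIV. \<bar>y $ j\<bar> ^ \<beta> j * norm ((deriv ^^ count_list is j) (bkernel1 (z $ j)) (of_real (y $ j))))"
      by (simp add: iter_partial_bargmann_kernel multi_power_def norm_mult prod_norm[symmetric] abs_prod power_abs prod.distrib)
    also have "\<dots> \<le> ?c * (\<Prod>j\<in>UNIV. K * h ^ (count_list is j + \<beta> j) * sqrt (fact (count_list is j) * fact (\<beta> j)) * exp ((1/2 + \<delta>) * (norm (z $ j))\<^sup>2))"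
      by (intro mult_left_mono prod_mono conjI 1) auto
    also have "\<dots> = ?c * (K ^ CARD('d) * h ^ (length is + multi_abs \<beta>) * sqrt (multi_fact (count_list is) * multi_fact \<beta>) * exp ((1/2 + \<delta>) * (norm z)\<^sup>2))"
    proof -
      have "length is = (\<Sum>j\<in>UNIV. count_list is j)"
        using multi_abs_count_list[of "is"] by (simp add: multi_abs_def)
      then show ?thesis
        by (simp add: prod.distrib power_sum exp_sum[symmetric] sum_distrib_left[symmetric] norm_vec_power2
            multi_abs_def sum.distrib[symmetric] multi_fact_def real_sqrt_prod real_sqrt_mult)
    qed
    finally show ?thesis
      by (subst powr_half_sqrt) (simp_all add: multi_fact_pos less_imp_le mult_ac)
  qed
  moreover have "?c * K ^ CARD('d) > 0" using K by simp
  ultimately show ?thesis using h by blast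
qed

definition bargmann_kernel_deriv :: "'d::finite \<Rightarrow> complex^'d \<Rightarrow> real^'d \<Rightarrow> complex" where
  "bargmann_kernel_deriv j z y = complex_of_real (pi powr (- (real CARD('d) / 4))) *
     (\<Prod>i\<in>UNIV. (if i = j then bkernel1_deriv else bkernel1) (z $ i) (of_real (y $ i)))"

lemma smooth_bargmann_kernel_deriv: "smooth (bargmann_kernel_deriv k z)"
  and iter_partial_bargmann_kernel_deriv: "iter_partial is (bargmann_kernel_deriv k z) y = complex_of_real (pi powr (- (real CARD('d) / 4))) *
     (\<Prod>j\<in>UNIV. (deriv ^^ count_list is j) ((if j = k then bkernel1_deriv else bkernel1) (z $ j)) (of_real (y $ j)))"
  for z :: "complex^'d::finite"
proof -
  have *: "(if j = k then bkernel1_deriv else bkernel1) (z $ j) holomorphic_on UNIV" for j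
    by (simp add: holomorphic_bkernel1)
  show "smooth (bargmann_kernel_deriv k z)" "iter_partial is (bargmann_kernel_deriv k z) y = complex_of_real (pi powr (- (real CARD('d) / 4))) *
     (\<Prod>j\<in>UNIV. (deriv ^^ count_list is j) ((if j = k then bkernel1_deriv else bkernel1) (z $ j)) (of_real (y $ j)))"
    using smooth_iter_partial_prod[of "\<lambda>j. (if j = k then bkernel1_deriv else bkernel1) (z $ j)", OF *]
    by (simp_all add: bargmann_kernel_deriv_def[abs_def] smooth_cmult iter_partial_cmult)
qed

text \<open>On a complex line the kernel is a function of one complex variable, so one-variable
  Cauchy estimates suffice for everything that concerns z.\<close>

lemma iter_partial_bargmann_kernel_line:
  "((\<lambda>t. iter_partial is (bargmann_kernel (z + t *s v)) y) has_field_derivative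
    (\<Sum>k\<in>UNIV. v $ k * iter_partial is (bargmann_kernel_deriv k (z + t *s v)) y)) (at t)"
  for z :: "complex^'d::finite"
proof -
  let ?w = "z + t *s v"
  have 1: "((\<lambda>t. (deriv ^^ n) (bkernel1 ((z + t *s v) $ j)) Y) has_derivative
     (\<lambda>h. (v $ j * (deriv ^^ n) (bkernel1_deriv (?w $ j)) Y) * h)) (at t)" for j n Y
  proof -
    have "((\<lambda>t. (z + t *s v) $ j) has_field_derivative v $ j) (at t)"
      by (auto intro!: derivative_eq_intros)
    from DERIV_chain2[OF bkernel1_higher_deriv_has_field_derivative this]
    show ?thesis unfolding has_field_derivative_def by (simp only: mult.commute[of _ "v $ j"])
  qed
  have "((\<lambda>t. \<Prod>j\<in>UNIV. (deriv ^^ count_list is j) (bkernel1 ((z + t *s v) $ j)) (of_real (y $ j))) has_derivative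
     (\<lambda>h. \<Sum>k\<in>UNIV. ((v $ k * (deriv ^^ count_list is k) (bkernel1_deriv (?w $ k)) (of_real (y $ k))) * h)
       * (\<Prod>j\<in>UNIV - {k}. (deriv ^^ count_list is j) (bkernel1 (?w $ j)) (of_real (y $ j))))) (at t)"
    by (rule has_derivative_prod[OF 1])
  moreover have "(\<lambda>h. \<Sum>k\<in>UNIV. ((v $ k * (deriv ^^ count_list is k) (bkernel1_deriv (?w $ k)) (of_real (y $ k))) * h)
       * (\<Prod>j\<in>UNIV - {k}. (deriv ^^ count_list is j) (bkernel1 (?w $ j)) (of_real (y $ j))))
    = (*) (\<Sum>k\<in>UNIV. v $ k * (\<Prod>j\<in>UNIV. (deriv ^^ count_list is j) ((if j = k then bkernel1_deriv else bkernel1) (?w $ j)) (of_real (y $ j))))"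
  proof
    fix h
    have "(\<Prod>j\<in>UNIV. (deriv ^^ count_list is j) ((if j = k then bkernel1_deriv else bkernel1) (?w $ j)) (of_real (y $ j)))
      = (deriv ^^ count_list is k) (bkernel1_deriv (?w $ k)) (of_real (y $ k)) *
        (\<Prod>j\<in>UNIV - {k}. (deriv ^^ count_list is j) (bkernel1 (?w $ j)) (of_real (y $ j)))" for k
      by (subst prod.remove[of UNIV k]) (auto intro!: prod.cong)
    then show "(\<Sum>k\<in>UNIV. ((v $ k * (deriv ^^ count_list is k) (bkernel1_deriv (?w $ k)) (of_real (y $ k))) * h)
       * (\<Prod>j\<in>UNIV - {k}. (deriv ^^ count_list is j) (bkernel1 (?w $ j)) (of_real (y $ j))))
      = (\<Sum>k\<in>UNIV. v $ k * (\<Prod>j\<in>UNIV. (deriv ^^ count_list is j) ((if j = k then bkernel1_deriv else bkernel1) (?w $ j)) (of_real (y $ j)))) * h"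
      by (simp add: sum_distrib_right mult.assoc) (simp only: mult_ac)
  qed
  ultimately have "((\<lambda>t. \<Prod>j\<in>UNIV. (deriv ^^ count_list is j) (bkernel1 ((z + t *s v) $ j)) (of_real (y $ j))) has_field_derivative
    (\<Sum>k\<in>UNIV. v $ k * (\<Prod>j\<in>UNIV. (deriv ^^ count_list is j) ((if j = k then bkernel1_deriv else bkernel1) (?w $ j)) (of_real (y $ j))))) (at t)"
    unfolding has_field_derivative_def by metis
  from DERIV_cmult[OF this, of "complex_of_real (pi powr (- (real CARD('d) / 4)))"] show ?thesis
    unfolding iter_partial_bargmann_kernel iter_partial_bargmann_kernel_deriv sum_distrib_left
    by (simp only: mult.left_commute[of "complex_of_real (pi powr (- (real CARD('d) / 4)))"])
qed

section \<open>The Bargmann transform of a functional is entire\<close>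

lemma GS_norm_bound_nonneg:
  fixes f :: "real^'d::finite \<Rightarrow> complex"
  assumes h: "0 < h"
    and "\<And>x \<beta> is. \<bar>multi_power x \<beta>\<bar> * norm (iter_partial is f x) \<le> M * GS_weight s h is \<beta>"
  shows "0 \<le> M"
proof -
  have "0 \<le> M * GS_weight s h [] (\<lambda>_::'d. 0)"
    using assms(2)[of 0 "\<lambda>_. 0" "[]"] by (meson abs_ge_zero mult_nonneg_nonneg norm_ge_zero order_trans)
  moreover have "0 < GS_weight s h [] (\<lambda>_::'d. 0)" using h by (rule GS_weight_pos)
  ultimately show ?thesis by (simp add: zero_le_mult_iff)
qed

text \<open>Continuity in a form free of \<open>ennreal\<close>: any majorant M of all weighted
  derivatives bounds the value, with C independent of f and M.\<close>

lemma GS_dual_bound: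
  fixes u :: "(real^'d::finite \<Rightarrow> complex) \<Rightarrow> complex"
  assumes u: "u \<in> GS_dual s" and h: "0 < h"
  shows "\<exists>C\<ge>0. \<forall>f M. smooth f \<longrightarrow>
    (\<forall>x \<beta> is. \<bar>multi_power x \<beta>\<bar> * norm (iter_partial is f x) \<le> M * GS_weight s h is \<beta>) \<longrightarrow>
    norm (u f) \<le> C * M"
proof -
  obtain C where C: "\<And>f. f \<in> GS_step s h \<Longrightarrow> ennreal (norm (u f)) \<le> ennreal C * GS_norm s h f"
    using u h unfolding GS_dual_def by blast
  \<comment> \<open>\<open>C\<close> may be negative, and then \<open>ennreal C\<close> is 0;
    \<open>max C 0\<close> covers both cases.\<close>
  have "norm (u f) \<le> max C 0 * M" if f: "smooth f" and
    M: "\<forall>x \<beta> is. \<bar>multi_power x \<beta>\<bar> * norm (iter_partial is f x) \<le> M * GS_weight s h is \<beta>" for f M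
  proof -
    have M0: "0 \<le> M" using GS_norm_bound_nonneg[OF h] M by blast
    have "f \<in> GS_step s h" "GS_norm s h f \<le> ennreal M" using GS_norm_le[OF f h, of M] M by auto
    then have "ennreal (norm (u f)) \<le> ennreal C * ennreal M"
      using C by (meson mult_left_mono order_trans zero_le)
    also have "\<dots> = ennreal (max C 0 * M)"
      using M0 by (simp add: ennreal_mult max_def) (simp add: ennreal_neg)
    finally show ?thesis using M0 by (simp add: ennreal_le_iff)
  qed
  then show ?thesis by (intro exI[of _ "max C 0"]) auto
qed

lemma GS_step_imp_GS: "0 < h \<Longrightarrow> f \<in> GS_step s h \<Longrightarrow> f \<in> GS s"
  by (auto simp: GS_def)

lemma GS_step_add:
  assumes h: "0 < h" and f: "f \<in> GS_step s h" and g: "g \<in> GS_step s h"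
  shows "(\<lambda>x. f x + g x) \<in> GS_step s h"
proof (rule GS_norm_le(2)[OF smooth_add[OF GS_stepD(1)[OF f h] GS_stepD(1)[OF g h]] h])
  fix x \<beta> "is"
  have "\<bar>multi_power x \<beta>\<bar> * norm (iter_partial is (\<lambda>x. f x + g x) x) \<le>
    \<bar>multi_power x \<beta>\<bar> * norm (iter_partial is f x) + \<bar>multi_power x \<beta>\<bar> * norm (iter_partial is g x)"
    unfolding iter_partial_add[OF GS_stepD(1)[OF f h] GS_stepD(1)[OF g h]]
    by (metis abs_ge_zero distrib_left mult_left_mono norm_triangle_ineq)
  also have "\<dots> \<le> enn2real (GS_norm s h f) * GS_weight s h is \<beta> + enn2real (GS_norm s h g) * GS_weight s h is \<beta>"
    by (intro add_mono GS_stepD f g h)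
  finally show "\<bar>multi_power x \<beta>\<bar> * norm (iter_partial is (\<lambda>x. f x + g x) x) \<le>
      (enn2real (GS_norm s h f) + enn2real (GS_norm s h g)) * GS_weight s h is \<beta>"
    by (simp add: distrib_right)
qed

lemma GS_step_cmult:
  assumes h: "0 < h" and f: "f \<in> GS_step s h"
  shows "(\<lambda>x. c * f x) \<in> GS_step s h"
proof (rule GS_norm_le(2)[OF smooth_cmult[OF GS_stepD(1)[OF f h]] h])
  fix x \<beta> "is"
  have "\<bar>multi_power x \<beta>\<bar> * norm (iter_partial is (\<lambda>x. c * f x) x) =
    norm c * (\<bar>multi_power x \<beta>\<bar> * norm (iter_partial is f x))"
    unfolding iter_partial_cmult[OF GS_stepD(1)[OF f h]] by (simp add: norm_mult)
  also have "\<dots> \<le> norm c * (enn2real (GS_norm s h f) * GS_weight s h is \<beta>)"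
    by (intro mult_left_mono GS_stepD f h) auto
  finally show "\<bar>multi_power x \<beta>\<bar> * norm (iter_partial is (\<lambda>x. c * f x) x) \<le>
      (norm c * enn2real (GS_norm s h f)) * GS_weight s h is \<beta>"
    by (simp add: mult.assoc)
qed

lemma GS_step_zero:
  assumes h: "0 < h" shows "(\<lambda>x. 0) \<in> GS_step s h"
  by (rule GS_norm_le(2)[OF smooth_zero h, of 0]) (simp add: iter_partial_zero)

lemma GS_step_sum:
  assumes h: "0 < h" and "finite S" and "\<And>i. i \<in> S \<Longrightarrow> f i \<in> GS_step s h"
  shows "(\<lambda>x. \<Sum>i\<in>S. c i * f i x) \<in> GS_step s h"
  using assms(2,3)
  by (induction rule: finite_induct) (auto intro!: GS_step_zero GS_step_add GS_step_cmult h)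

lemma GS_dual_linear:
  assumes "u \<in> GS_dual s" "f \<in> GS s"
  shows "g \<in> GS s \<Longrightarrow> u (\<lambda>x. f x + g x) = u f + u g" and "u (\<lambda>x. c * f x) = c * u f"
  using assms by (simp_all add: GS_dual_def)

lemma GS_dual_sum:
  assumes u: "u \<in> GS_dual s" and h: "0 < h" and "finite S" and "\<And>i. i \<in> S \<Longrightarrow> f i \<in> GS_step s h"
  shows "u (\<lambda>x. \<Sum>i\<in>S. c i * f i x) = (\<Sum>i\<in>S. c i * u (f i))"
  using assms(3,4)
proof (induction rule: finite_induct)
  case empty
  have "u (\<lambda>x. 0 * 0) = 0 * u (\<lambda>x. 0)"
    by (rule GS_dual_linear(2)[OF u GS_step_imp_GS[OF h GS_step_zero[OF h]]])
  then show ?case by simp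
next
  case (insert i S)
  have "u (\<lambda>x. c i * f i x + (\<Sum>i\<in>S. c i * f i x)) = u (\<lambda>x. c i * f i x) + u (\<lambda>x. \<Sum>i\<in>S. c i * f i x)"
    using insert by (intro GS_dual_linear(1)[OF u] GS_step_imp_GS[OF h] GS_step_cmult GS_step_sum h) auto
  also have "u (\<lambda>x. c i * f i x) = c i * u (f i)"
    using insert by (intro GS_dual_linear(2)[OF u] GS_step_imp_GS[OF h]) auto
  finally show ?case using insert by simp
qed

text \<open>Cauchy's inequality on discs of radius 1/2 inside the unit disc bounds the first two
  derivatives by 1! M / (1/2) = 2 M and 2! M / (1/4) = 8 M; Taylor's formula does the rest.\<close>

lemma holomorphic_first_order_bounds:
  fixes g :: "complex \<Rightarrow> complex"
  assumes g: "\<And>t. (g has_field_derivative g' t) (at t)"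
    and M: "\<And>t. norm t \<le> 1 \<Longrightarrow> norm (g t) \<le> M"
  shows "norm (g' 0) \<le> M"
    and "norm t \<le> 1/2 \<Longrightarrow> norm (g t - g 0) \<le> 2 * M * norm t"
    and "norm t \<le> 1/2 \<Longrightarrow> norm (g t - g 0 - t * g' 0) \<le> 8 * M * (norm t)\<^sup>2"
proof -
  have hol: "g holomorphic_on S" for S using g by (meson field_differentiable_at_within field_differentiable_def holomorphic_on_def)
  have d: "deriv g = g'" using g DERIV_imp_deriv by blast
  have C: "norm ((deriv ^^ n) g w) \<le> fact n * M / r ^ n" if "norm w + r \<le> 1" "0 < r" for n w r
  proof (rule Cauchy_inequality[OF hol holomorphic_on_imp_continuous_on[OF hol] that(2)])
    fix x assume "norm (w - x) = r"
    then show "norm (g x) \<le> M" using that norm_triangle_sub[of x w] by (intro M) (simp add: norm_minus_commute)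
  qed
  show "norm (g' 0) \<le> M" using C[of 0 1 1] by (simp add: d)
  have der: "((deriv ^^ i) g has_field_derivative (deriv ^^ Suc i) g x) (at x within S)" for i x S
    using holomorphic_higher_deriv[OF hol, of UNIV i] holomorphic_derivI[OF _ open_UNIV]
    by (simp add: has_field_derivative_at_within)
  have D1: "norm (deriv g w) \<le> 2 * M" and D2: "norm (deriv (deriv g) w) \<le> 8 * M" if "norm w \<le> 1/2" for w
    using C[of w "1/2" 1] C[of w "1/2" 2] that by (simp_all add: numeral_2_eq_2 power2_eq_square)
  show "norm (g t - g 0) \<le> 2 * M * norm t" if t: "norm t \<le> 1/2"
  proof -
    have "cmod ((deriv ^^ 0) g t - (\<Sum>i\<le>0. (deriv ^^ i) g 0 * (t - 0) ^ i / fact i)) \<le> 2 * M * cmod (t - 0) ^ Suc 0 / fact 0"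
      by (rule complex_Taylor[where f = "\<lambda>i. (deriv ^^ i) g" and S = "cball 0 (1/2)", OF convex_cball der]) (use D1 t in auto)
    then show ?thesis by simp
  qed
  show "norm (g t - g 0 - t * g' 0) \<le> 8 * M * (norm t)\<^sup>2" if t: "norm t \<le> 1/2"
  proof -
    have "cmod ((deriv ^^ 0) g t - (\<Sum>i\<le>1. (deriv ^^ i) g 0 * (t - 0) ^ i / fact i)) \<le> 8 * M * cmod (t - 0) ^ Suc 1 / fact 1"
      by (rule complex_Taylor[where f = "\<lambda>i. (deriv ^^ i) g" and S = "cball 0 (1/2)", OF convex_cball der]) (use D2 t in auto)
    then show ?thesis by (simp add: d power2_eq_square diff_diff_eq mult.commute)
  qed
qed

text \<open>The difference quotients of \<open>z \<mapsto> bargmann_kernel z\<close> are controlled in \<open>GS_norm\<close> by its size alone,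
  through Cauchy estimates in \<open>z\<close> on complex lines.\<close>

lemma bargmann_kernel_increment:
  assumes \<delta>: "0 < \<delta>" "\<delta> \<le> 1/2"
  shows "\<exists>h>0. \<exists>K>0. \<forall>(z::complex^'d::finite) \<beta> is y.
    \<bar>multi_power y \<beta>\<bar> * norm (iter_partial is (bargmann_kernel z) y) \<le>
      K * exp ((1/2 + \<delta>) * (norm z)\<^sup>2) * GS_weight (1/2) h is \<beta> \<and>
    (\<forall>k. \<bar>multi_power y \<beta>\<bar> * norm (iter_partial is (bargmann_kernel_deriv k z) y) \<le>
      K * exp ((1/2 + \<delta>) * (norm z + 1)\<^sup>2) * GS_weight (1/2) h is \<beta>) \<and>
    (\<forall>z'. norm z' \<le> norm z + 1 \<longrightarrow> \<bar>multi_power y \<beta>\<bar> * norm (iter_partial is (bargmann_kernel z') y - iter_partial is (bargmann_kernel z) y) \<le>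
      (4 * K * exp ((1/2 + \<delta>) * (norm z + 1)\<^sup>2) * norm (z' - z)) * GS_weight (1/2) h is \<beta>) \<and>
    (\<forall>v. norm v \<le> 1/2 \<longrightarrow> \<bar>multi_power y \<beta>\<bar> * norm (iter_partial is (bargmann_kernel (z + v)) y - iter_partial is (bargmann_kernel z) y
        - (\<Sum>k\<in>UNIV. v $ k * iter_partial is (bargmann_kernel_deriv k z) y)) \<le>
      (8 * K * exp ((1/2 + \<delta>) * (norm z + 1)\<^sup>2) * (norm v)\<^sup>2) * GS_weight (1/2) h is \<beta>)"
proof -
  obtain h K where h: "h > 0" and K: "K > 0" and
    bd: "\<And>(z::complex^'d) \<beta> is y. \<bar>multi_power y \<beta>\<bar> * norm (iter_partial is (bargmann_kernel z) y) \<le>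
    K * exp ((1/2 + \<delta>) * (norm z)\<^sup>2) * GS_weight (1/2) h is \<beta>"
    using bargmann_kernel_GS_bound[OF \<delta>] by blast
  have bd': "\<bar>multi_power y \<beta>\<bar> * norm (iter_partial is (bargmann_kernel z) y) \<le>
    K * exp ((1/2 + \<delta>) * R\<^sup>2) * GS_weight (1/2) h is \<beta>" if "norm z \<le> R" for z :: "complex^'d" and R \<beta> "is" y
  proof (rule order_trans[OF bd mult_right_mono])
    have "(norm z)\<^sup>2 \<le> R\<^sup>2" using that by (intro power_mono) auto
    then show "K * exp ((1/2 + \<delta>) * (norm z)\<^sup>2) \<le> K * exp ((1/2 + \<delta>) * R\<^sup>2)"
      using \<delta> K by simp
    show "0 \<le> GS_weight (1/2) h is \<beta>" by (rule less_imp_le[OF GS_weight_pos[OF h]])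
  qed
  have "\<bar>multi_power y \<beta>\<bar> * norm (iter_partial is (bargmann_kernel_deriv k z) y) \<le>
      K * exp ((1/2 + \<delta>) * (norm z + 1)\<^sup>2) * GS_weight (1/2) h is \<beta> \<and>
    (norm z' \<le> norm z + 1 \<longrightarrow> \<bar>multi_power y \<beta>\<bar> * norm (iter_partial is (bargmann_kernel z') y - iter_partial is (bargmann_kernel z) y) \<le>
      (4 * K * exp ((1/2 + \<delta>) * (norm z + 1)\<^sup>2) * norm (z' - z)) * GS_weight (1/2) h is \<beta>) \<and>
    (norm v \<le> 1/2 \<longrightarrow> \<bar>multi_power y \<beta>\<bar> * norm (iter_partial is (bargmann_kernel (z + v)) y - iter_partial is (bargmann_kernel z) y
        - (\<Sum>k\<in>UNIV. v $ k * iter_partial is (bargmann_kernel_deriv k z) y)) \<le>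
      (8 * K * exp ((1/2 + \<delta>) * (norm z + 1)\<^sup>2) * (norm v)\<^sup>2) * GS_weight (1/2) h is \<beta>)"
    for z z' v :: "complex^'d" and y \<beta> "is" k
  proof -
    define M where "M = K * exp ((1/2 + \<delta>) * (norm z + 1)\<^sup>2) * GS_weight (1/2) h is \<beta>"
    define m where "m = multi_power y \<beta>"
    \<comment> \<open>The weighted derivative on the line through z in direction w. Each seminorm is
      treated separately, but M carries the same constants for all of them.\<close>
    define g where "g = (\<lambda>w t. of_real m * iter_partial is (bargmann_kernel (z + t *s w)) y)"
    define g' where "g' = (\<lambda>w t. of_real m * (\<Sum>k\<in>UNIV. w $ k * iter_partial is (bargmann_kernel_deriv k (z + t *s w)) y))"
    have g: "(g w has_field_derivative g' w t) (at t)" for w t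
      unfolding g_def g'_def by (intro DERIV_cmult iter_partial_bargmann_kernel_line)
    have M0: "0 \<le> M" unfolding M_def using K h by (intro mult_nonneg_nonneg) auto
    have gM: "norm (g w t) \<le> M" if "norm w \<le> 1" "norm t \<le> 1" for w t
    proof -
      have "norm (t *s w) \<le> 1" using that by (simp add: norm_smult_complex mult_le_one)
      then have "norm (z + t *s w) \<le> norm z + 1" using norm_triangle_ineq[of z "t *s w"] by linarith
      from bd'[OF this, of y \<beta> "is"] show ?thesis by (simp add: g_def norm_mult m_def M_def)
    qed
    \<comment> \<open>Splitting a vector into a direction in the unit ball and a complex parameter
      of the same norm as the vector turns bounds in the parameter into bounds in the
      vector.\<close>
    have scale: "\<exists>w \<tau>. norm w \<le> 1 \<and> v = \<tau> *s w \<and> norm \<tau> = norm v" for v :: "complex^'d"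
    proof (cases "v = 0")
      case False
      have "norm (of_real (inverse (norm v)) *s v) = 1"
        using False unfolding norm_smult_complex norm_of_real by simp
      moreover have "v = of_real (norm v) *s (of_real (inverse (norm v)) *s v)"
        using False by (simp add: vec_eq_iff)
      ultimately show ?thesis by (intro exI[of _ "of_real (inverse (norm v)) *s v"] exI[of _ "of_real (norm v)"]) auto
    qed (auto intro!: exI[of _ 0])
    have "norm (g' (axis k 1) 0) \<le> M"
      by (rule holomorphic_first_order_bounds(1)[OF g gM]) (auto simp: norm_axis_1)
    moreover have "g' (axis k 1) 0 = of_real m * (\<Sum>i\<in>UNIV. if i = k then iter_partial is (bargmann_kernel_deriv i z) y else 0)"
      unfolding g'_def by (intro arg_cong2[where f = "(*)"] sum.cong refl) (auto simp: axis_def)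
    ultimately have 1: "\<bar>multi_power y \<beta>\<bar> * norm (iter_partial is (bargmann_kernel_deriv k z) y) \<le> M"
      by (simp add: norm_mult m_def)
    \<comment> \<open>Cauchy's inequality handles short increments. For long ones the triangle
      inequality gives 2 M, which is at most 4 M times the increment since that exceeds 1/2; hence
      the factor 4.\<close>
    have 2: "\<bar>multi_power y \<beta>\<bar> * norm (iter_partial is (bargmann_kernel z') y - iter_partial is (bargmann_kernel z) y) \<le>
      4 * M * norm (z' - z)" if z': "norm z' \<le> norm z + 1"
    proof (cases "norm (z' - z) \<le> 1/2")
      case True
      obtain w \<tau> where w: "norm w \<le> 1" "z' - z = \<tau> *s w" "norm \<tau> = norm (z' - z)" using scale by blast
      have "z' = z + \<tau> *s w" using w(2) by (simp add: algebra_simps)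
      then have "g w \<tau> - g w 0 = of_real m * (iter_partial is (bargmann_kernel z') y - iter_partial is (bargmann_kernel z) y)"
        by (simp add: g_def algebra_simps)
      moreover have "norm (g w \<tau> - g w 0) \<le> 2 * M * norm \<tau>"
        using True w by (intro holomorphic_first_order_bounds(2)[OF g gM]) auto
      moreover have "2 * M * norm \<tau> \<le> 4 * M * norm (z' - z)" using w M0 by (auto intro!: mult_right_mono)
      ultimately show ?thesis by (simp add: norm_mult m_def)
    next
      case False
      have "\<bar>m\<bar> * norm (iter_partial is (bargmann_kernel z') y - iter_partial is (bargmann_kernel z) y) \<le>
        \<bar>m\<bar> * norm (iter_partial is (bargmann_kernel z') y) + \<bar>m\<bar> * norm (iter_partial is (bargmann_kernel z) y)"
        by (metis abs_ge_zero distrib_left mult_left_mono norm_triangle_ineq4)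
      also have "\<dots> \<le> M + M"
        unfolding M_def m_def using z' by (intro add_mono bd') auto
      also have "\<dots> \<le> 4 * M * norm (z' - z)"
        using False mult_left_mono[of "1/2" "norm (z' - z)" "4 * M"] M0 by simp
      finally show ?thesis by (simp add: m_def)
    qed
    have 3: "\<bar>multi_power y \<beta>\<bar> * norm (iter_partial is (bargmann_kernel (z + v)) y - iter_partial is (bargmann_kernel z) y
        - (\<Sum>k\<in>UNIV. v $ k * iter_partial is (bargmann_kernel_deriv k z) y)) \<le> 8 * M * (norm v)\<^sup>2" if v: "norm v \<le> 1/2"
    proof -
      obtain w \<tau> where w: "norm w \<le> 1" "v = \<tau> *s w" "norm \<tau> = norm v" using scale by blast
      have "g w \<tau> - g w 0 - \<tau> * g' w 0 = of_real m * (iter_partial is (bargmann_kernel (z + v)) y - iter_partial is (bargmann_kernel z) y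
        - (\<Sum>k\<in>UNIV. v $ k * iter_partial is (bargmann_kernel_deriv k z) y))"
        unfolding g_def g'_def w(2) by (simp add: right_diff_distrib sum_distrib_left mult_ac)
      moreover have "norm (g w \<tau> - g w 0 - \<tau> * g' w 0) \<le> 8 * M * (norm \<tau>)\<^sup>2"
        using v w by (intro holomorphic_first_order_bounds(3)[OF g gM]) auto
      ultimately show ?thesis using w by (simp add: norm_mult m_def)
    qed
    show ?thesis using 1 2 3 unfolding M_def by (auto simp: mult_ac)
  qed
  then show ?thesis using h K bd by blast
qed

lemma bargmann_kernel_GS: "bargmann_kernel z \<in> GS (1/2)" for z :: "complex^'d::finite"
proof -
  obtain h K where h: "h > 0" and
    bd: "\<And>(z::complex^'d) \<beta> is y. \<bar>multi_power y \<beta>\<bar> * norm (iter_partial is (bargmann_kernel z) y) \<le>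
    K * exp ((1/2 + 1/2) * (norm z)\<^sup>2) * GS_weight (1/2) h is \<beta>"
    using bargmann_kernel_GS_bound[OF half_gt_zero[OF zero_less_one] order_refl, where 'd = 'd] by blast
  show ?thesis by (rule GS_step_imp_GS[OF h GS_norm_le(2)[OF smooth_bargmann_kernel h bd]])
qed

lemma sum_UNIV_option: "(\<Sum>i\<in>UNIV. G i) = G None + (\<Sum>k\<in>UNIV. G (Some k))"
  for G :: "'e::finite option \<Rightarrow> complex"
  by (simp add: UNIV_option_conv sum.reindex)

text \<open>The functional is applied to the first-order Taylor remainder of the kernel in z. That
  remainder is quadratic in the increment in every seminorm of one fixed step, so the image of the
  linear term is the derivative, and it is visibly complex linear.\<close>

lemma entire_bargmann:
  fixes u :: "(real^'d::finite \<Rightarrow> complex) \<Rightarrow> complex"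
  assumes u: "u \<in> GS_dual (1/2)"
  shows "entire (bargmann u)"
  unfolding entire_def
proof
  fix z :: "complex^'d"
  obtain h K where h: "h > 0" and K: "K > 0" and
    bd: "\<And>(z::complex^'d) \<beta> is y. \<bar>multi_power y \<beta>\<bar> * norm (iter_partial is (bargmann_kernel z) y) \<le>
    K * exp ((1/2 + 1/2) * (norm z)\<^sup>2) * GS_weight (1/2) h is \<beta>" and
    bdd: "\<And>k (z::complex^'d) \<beta> is y. \<bar>multi_power y \<beta>\<bar> * norm (iter_partial is (bargmann_kernel_deriv k z) y) \<le>
      K * exp ((1/2 + 1/2) * (norm z + 1)\<^sup>2) * GS_weight (1/2) h is \<beta>" and
    bdt: "\<And>(z::complex^'d) \<beta> is y v. norm v \<le> 1/2 \<Longrightarrow> \<bar>multi_power y \<beta>\<bar> * norm (iter_partial is (bargmann_kernel (z + v)) y - iter_partial is (bargmann_kernel z) y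
        - (\<Sum>k\<in>UNIV. v $ k * iter_partial is (bargmann_kernel_deriv k z) y)) \<le>
      (8 * K * exp ((1/2 + 1/2) * (norm z + 1)\<^sup>2) * (norm v)\<^sup>2) * GS_weight (1/2) h is \<beta>"
    using bargmann_kernel_increment[OF half_gt_zero[OF zero_less_one] order_refl, where 'd = 'd] by blast
  obtain C where C: "C \<ge> 0" and uC: "\<And>f M. smooth f \<Longrightarrow>
    (\<forall>x \<beta> is. \<bar>multi_power x \<beta>\<bar> * norm (iter_partial is f x) \<le> M * GS_weight (1/2) h is \<beta>) \<Longrightarrow> norm (u f) \<le> C * M"
    using GS_dual_bound[OF u h] by blast
  have A: "bargmann_kernel w \<in> GS_step (1/2) h" for w :: "complex^'d"
    by (rule GS_norm_le(2)[OF smooth_bargmann_kernel h bd])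
  have Ad: "bargmann_kernel_deriv k w \<in> GS_step (1/2) h" for w :: "complex^'d" and k
    by (rule GS_norm_le(2)[OF smooth_bargmann_kernel_deriv h bdd])
  define F' where "F' = (\<lambda>v. \<Sum>k\<in>UNIV. v $ k * u (bargmann_kernel_deriv k z))"
  define B where "B = C * (8 * K * exp ((1/2 + 1/2) * (norm z + 1)\<^sup>2))"
  have rem: "norm (bargmann u (z + v) - bargmann u z - F' v) \<le> B * (norm v)\<^sup>2" if v: "norm v \<le> 1/2" for v
  proof -
    \<comment> \<open>The remainder consists of two kernels and one derivative kernel per
      coordinate. Indexing by \<open>'d option option\<close> makes it a single linear combination
      over a finite type, to which finite linearity applies.\<close>
    define f where "f = (\<lambda>i::'d option option. case i of None \<Rightarrow> bargmann_kernel (z + v)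
      | Some None \<Rightarrow> bargmann_kernel z | Some (Some k) \<Rightarrow> bargmann_kernel_deriv k z)"
    define c where "c = (\<lambda>i::'d option option. case i of None \<Rightarrow> 1 | Some None \<Rightarrow> -1 | Some (Some k) \<Rightarrow> - (v $ k))"
    have fG: "f i \<in> GS_step (1/2) h" for i using A Ad by (auto simp: f_def split: option.splits)
    have S: "(\<Sum>i\<in>UNIV. G i) = G None + G (Some None) + (\<Sum>k\<in>UNIV. G (Some (Some k)))" for G :: "'d option option \<Rightarrow> complex"
      by (simp add: sum_UNIV_option add.assoc)
    define R where "R = (\<lambda>y. \<Sum>i\<in>UNIV. c i * f i y)"
    have R: "smooth R" unfolding R_def using fG GS_stepD(1)[OF _ h]
      by (intro smooth_sum smooth_cmult) auto
    have it: "iter_partial is R y = (\<Sum>i\<in>UNIV. c i * iter_partial is (f i) y)" for "is" y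
    proof -
      have fin: "finite (UNIV :: 'd option option set)" by simp
      have "iter_partial is (\<lambda>y. \<Sum>i\<in>S. c i * f i y) = (\<lambda>y. \<Sum>i\<in>S. c i * iter_partial is (f i) y)" if "finite S" for S
        using that
      proof (induction rule: finite_induct)
        case (insert i S)
        have "smooth (\<lambda>y. c i * f i y)" "smooth (\<lambda>y. \<Sum>i\<in>S. c i * f i y)"
          using fG GS_stepD(1)[OF _ h] insert by (auto intro!: smooth_sum smooth_cmult)
        then show ?case using insert GS_stepD(1)[OF fG h] by (simp add: iter_partial_add iter_partial_cmult)
      qed (simp add: iter_partial_zero)
      from this[OF fin] show ?thesis unfolding R_def by simp
    qed
    have "norm (u R) \<le> C * (8 * K * exp ((1/2 + 1/2) * (norm z + 1)\<^sup>2) * (norm v)\<^sup>2)"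
    proof (rule uC[OF R], intro allI)
      fix x \<beta> "is"
      have "iter_partial is R x = iter_partial is (bargmann_kernel (z + v)) x - iter_partial is (bargmann_kernel z) x
        - (\<Sum>k\<in>UNIV. v $ k * iter_partial is (bargmann_kernel_deriv k z) x)"
        unfolding it S by (simp add: c_def f_def sum_negf)
      then show "\<bar>multi_power x \<beta>\<bar> * norm (iter_partial is R x) \<le>
        8 * K * exp ((1/2 + 1/2) * (norm z + 1)\<^sup>2) * (norm v)\<^sup>2 * GS_weight (1/2) h is \<beta>"
        using bdt[OF v, of x \<beta> "is" z] by simp
    qed
    moreover have "u R = bargmann u (z + v) - bargmann u z - F' v"
    proof -
      have "u R = (\<Sum>i\<in>UNIV. c i * u (f i))" unfolding R_def by (rule GS_dual_sum[OF u h finite fG])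
      then show ?thesis unfolding S by (simp add: c_def f_def F'_def bargmann_def sum_negf)
    qed
    ultimately show ?thesis by (simp add: B_def mult.assoc)
  qed
  have lin: "bounded_linear F'"
    unfolding F'_def by (intro bounded_linear_sum bounded_linear_mult_left[THEN bounded_linear_compose] bounded_linear_vec_nth)
  have "(bargmann u has_derivative F') (at z)"
  proof (rule has_derivativeI_sandwich[where e = "1/2" and H = "\<lambda>w. B * norm (w - z)"])
    show "norm ((bargmann u w - bargmann u z) - F' (w - z)) / norm (w - z) \<le> B * norm (w - z)"
      if "w \<in> UNIV" "w \<noteq> z" "dist w z < 1/2" for w
      using rem[of "w - z"] that by (simp add: dist_norm divide_simps power2_eq_square mult.assoc)
    have "((\<lambda>w. B * norm (w - z)) \<longlongrightarrow> B * norm (z - z)) (at z)" by (intro tendsto_intros)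
    then show "((\<lambda>w. B * norm (w - z)) \<longlongrightarrow> 0) (at z)" by simp
  qed (use lin in auto)
  moreover have "F' (c *s v) = c * F' v" for c v
    by (simp add: F'_def sum_distrib_left mult.assoc)
  ultimately show "\<exists>F'. (bargmann u has_derivative F') (at z) \<and> (\<forall>c v. F' (c *s v) = c * F' v)" by blast
qed

section \<open>Gaussian integrals and Fourier inversion\<close>

abbreviation (input) gaussian :: "real \<Rightarrow> 'a::real_normed_vector \<Rightarrow> real" where
  "gaussian a x \<equiv> exp (- a * (norm x)\<^sup>2)"

type_synonym 'd phase = "(real^'d) \<times> (real^'d)"

lemma integral_lborel_affine:
  fixes f :: "'a::euclidean_space \<Rightarrow> 'b::{banach, second_countable_topology}"
  assumes [measurable]: "f \<in> borel_measurable borel" and c: "c \<noteq> 0"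
  shows "(\<integral>x. f x \<partial>lborel) = \<bar>c\<bar> ^ DIM('a) *\<^sub>R (\<integral>x. f (t + c *\<^sub>R x) \<partial>lborel)"
  by (subst lborel_affine[OF c, of t]) (simp add: integral_density integral_distr)

lemma integrable_lborel_translate:
  fixes f :: "'a::euclidean_space \<Rightarrow> 'b::{banach, second_countable_topology}"
  assumes f: "integrable lborel f"
  shows "integrable lborel (\<lambda>x. f (t + x))"
proof -
  have [measurable]: "f \<in> borel_measurable borel" using f by auto
  have "integrable (distr lborel borel ((+) t)) f" using f by (simp add: lborel_distr_plus)
  then show ?thesis by (subst (asm) integrable_distr_eq) auto
qed

lemma integral_lborel_translate:
  fixes f :: "'a::euclidean_space \<Rightarrow> 'b::{banach, second_countable_topology}"
  assumes [measurable]: "f \<in> borel_measurable borel"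
  shows "(\<integral>x. f (t + x) \<partial>lborel) = (\<integral>x. f x \<partial>lborel)"
  using integral_lborel_affine[of f 1 t] by simp

lemma integral_lborel_prod_Basis:
  fixes f :: "'a::euclidean_space \<Rightarrow> real \<Rightarrow> complex"
  assumes f: "\<And>b. b \<in> Basis \<Longrightarrow> integrable lborel (f b)"
  shows "integrable lborel (\<lambda>x::'a. \<Prod>b\<in>Basis. f b (x \<bullet> b))"
    and "(\<integral>x. (\<Prod>b\<in>Basis. f b (x \<bullet> b)) \<partial>(lborel::'a measure)) = (\<Prod>b\<in>Basis. \<integral>t. f b t \<partial>lborel)"
proof -
  interpret product_sigma_finite "\<lambda>_::'a. lborel :: real measure" by standard
  let ?P = "\<Pi>\<^sub>M b\<in>(Basis::'a set). (lborel :: real measure)"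
  let ?T = "\<lambda>g. \<Sum>b\<in>(Basis::'a set). g b *\<^sub>R b"
  have [measurable]: "f b \<in> borel_measurable borel" if "b \<in> Basis" for b using f[OF that] by auto
  have meas: "(\<lambda>x::'a. \<Prod>b\<in>Basis. f b (x \<bullet> b)) \<in> borel_measurable borel" by measurable
  have T: "?T \<in> ?P \<rightarrow>\<^sub>M borel" by measurable
  have eq: "(\<Prod>b\<in>Basis. f b (?T g \<bullet> b)) = (\<Prod>b\<in>Basis. f b (g b))" for g
    by (intro prod.cong refl) (simp add: inner_sum_left inner_Basis if_distrib sum.delta cong: if_cong)
  have I: "integrable ?P (\<lambda>g. \<Prod>b\<in>Basis. f b (g b))" by (rule product_integrable_prod) (auto simp: f)
  show "integrable lborel (\<lambda>x::'a. \<Prod>b\<in>Basis. f b (x \<bullet> b))"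
    by (subst lborel_eq[where 'a = 'a], subst integrable_distr_eq[OF T meas]) (simp add: eq I)
  show "(\<integral>x. (\<Prod>b\<in>Basis. f b (x \<bullet> b)) \<partial>(lborel::'a measure)) = (\<Prod>b\<in>Basis. \<integral>t. f b t \<partial>lborel)"
    by (subst lborel_eq[where 'a = 'a], subst integral_distr[OF T meas]) (simp add: eq product_integral_prod f)
qed

text \<open>A rescaling of the characteristic function of the standard normal distribution.\<close>

lemma gaussian_integral_std:
  "integrable lborel (\<lambda>x::real. complex_of_real (exp (- x\<^sup>2 / 2)) * iexp (t * x))"
  "(\<integral>x. complex_of_real (exp (- x\<^sup>2 / 2)) * iexp (t * x) \<partial>lborel) = complex_of_real (sqrt (2 * pi) * exp (- t\<^sup>2 / 2))"
proof -
  have e: "exp (- x\<^sup>2 / 2) = sqrt (2 * pi) * std_normal_density x" for x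
    by (simp add: std_normal_density_def)
  have I: "integrable lborel (\<lambda>x. std_normal_density x *\<^sub>R iexp (t * x))"
  proof (rule Bochner_Integration.integrable_bound[of _ std_normal_density])
    show "integrable lborel std_normal_density" using integrable_normal_moment[of 1 0 0] by simp
  qed (auto simp: norm_mult)
  have "char std_normal_distribution t = (\<integral>x. std_normal_density x *\<^sub>R iexp (t * x) \<partial>lborel)"
    unfolding char_def by (subst integral_density) auto
  then have c: "(\<integral>x. std_normal_density x *\<^sub>R iexp (t * x) \<partial>lborel) = complex_of_real (exp (- t\<^sup>2 / 2))"
    by (simp add: char_std_normal_distribution)
  have eq: "complex_of_real (exp (- x\<^sup>2 / 2)) * iexp (t * x) = complex_of_real (sqrt (2 * pi)) * (std_normal_density x *\<^sub>R iexp (t * x))" for x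
    unfolding e by (simp add: scaleR_conv_of_real)
  show "integrable lborel (\<lambda>x::real. complex_of_real (exp (- x\<^sup>2 / 2)) * iexp (t * x))"
    unfolding eq by (intro integrable_mult_right I)
  show "(\<integral>x. complex_of_real (exp (- x\<^sup>2 / 2)) * iexp (t * x) \<partial>lborel) = complex_of_real (sqrt (2 * pi) * exp (- t\<^sup>2 / 2))"
    unfolding eq integral_mult_right_zero c by simp
qed

text \<open>The real part of \<zeta> is removed by the real translation that completes the square;
  the imaginary part is the frequency in the characteristic function. No contour has to be
  moved.\<close>

lemma gaussian_integral_1:
  fixes \<zeta> :: complex
  assumes l: "0 < l"
  shows "integrable lborel (\<lambda>y::real. exp (of_real (- (l / 2) * y\<^sup>2) + \<zeta> * of_real y))"
    and "(\<integral>y. exp (of_real (- (l / 2) * y\<^sup>2) + \<zeta> * of_real y) \<partial>lborel) = of_real (sqrt (2 * pi / l)) * exp (\<zeta>\<^sup>2 / (2 * of_real l))"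
proof -
  define s where "s = Re \<zeta>"
  define r where "r = Im \<zeta>"
  have \<zeta>: "\<zeta> = of_real s + \<i> * of_real r" by (simp add: s_def r_def complex_eq)
  define c where "c = 1 / sqrt l"
  have c: "c > 0" "l * c * c = 1" using l by (simp_all add: c_def)
  let ?f = "\<lambda>y::real. exp (of_real (- (l / 2) * y\<^sup>2) + \<zeta> * of_real y)"
  let ?g = "\<lambda>x::real. complex_of_real (exp (- x\<^sup>2 / 2)) * iexp ((r * c) * x)"
  have eq: "?f (s / l + c * x) = exp (\<zeta>\<^sup>2 / (2 * of_real l)) * of_real (exp (r\<^sup>2 / (2 * l))) * ?g x" for x
  proof -
    have "- (l / 2) * (s / l + c * x)\<^sup>2 + s * (s / l + c * x) = s\<^sup>2 / (2 * l) - (l * c * c) * x\<^sup>2 / 2"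
      using l by (simp add: power2_eq_square field_simps)
    then have 1: "- (l / 2) * (s / l + c * x)\<^sup>2 + s * (s / l + c * x) = s\<^sup>2 / (2 * l) - x\<^sup>2 / 2" by (simp add: c)
    have "of_real (- (l / 2) * (s / l + c * x)\<^sup>2) + \<zeta> * of_real (s / l + c * x) =
      of_real (- (l / 2) * (s / l + c * x)\<^sup>2 + s * (s / l + c * x)) + \<i> * of_real (r * (s / l + c * x))"
      unfolding \<zeta> by (simp add: algebra_simps)
    also have "\<dots> = \<zeta>\<^sup>2 / (2 * of_real l) + of_real (r\<^sup>2 / (2 * l)) + (of_real (- x\<^sup>2 / 2) + \<i> * of_real ((r * c) * x))"
      unfolding 1 \<zeta> using l by (simp add: power2_eq_square field_simps)
    finally show ?thesis by (simp only: exp_add exp_of_real mult.assoc)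
  qed
  have g: "integrable lborel ?g" "(\<integral>x. ?g x \<partial>lborel) = complex_of_real (sqrt (2 * pi) * exp (- (r * c)\<^sup>2 / 2))"
    using gaussian_integral_std[of "r * c"] by auto
  have "integrable lborel (\<lambda>x. ?f (s / l + c * x))" unfolding eq by (intro integrable_mult_right g)
  then show "integrable lborel ?f" using lborel_integrable_real_affine_iff[of c ?f "s / l"] c by simp
  have "(\<integral>y. ?f y \<partial>lborel) = \<bar>c\<bar> *\<^sub>R (\<integral>x. ?f (s / l + c * x) \<partial>lborel)"
    using lborel_integral_real_affine[of c ?f "s / l"] c by simp
  also have "\<dots> = of_real c * (exp (\<zeta>\<^sup>2 / (2 * of_real l)) * of_real (exp (r\<^sup>2 / (2 * l))) * complex_of_real (sqrt (2 * pi) * exp (- (r * c)\<^sup>2 / 2)))"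
    unfolding eq using c g by (simp add: scaleR_conv_of_real)
  also have "\<dots> = of_real (c * sqrt (2 * pi)) * exp (\<zeta>\<^sup>2 / (2 * of_real l)) * of_real (exp (r\<^sup>2 / (2 * l)) * exp (- (r * c)\<^sup>2 / 2))"
    by (simp add: mult_ac)
  also have "exp (r\<^sup>2 / (2 * l)) * exp (- (r * c)\<^sup>2 / 2) = 1"
    using l by (simp add: exp_add[symmetric] c_def power_mult_distrib power_divide field_simps)
  also have "c * sqrt (2 * pi) = sqrt (2 * pi / l)" by (simp add: c_def real_sqrt_divide)
  finally show "(\<integral>y. ?f y \<partial>lborel) = of_real (sqrt (2 * pi / l)) * exp (\<zeta>\<^sup>2 / (2 * of_real l))" by simp
qed

lemma Basis_vec_real: "(Basis :: (real^'d::finite) set) = range (\<lambda>j. axis j 1)"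
  by (auto simp: Basis_vec_def)

lemma inj_axis: "inj (\<lambda>j::'d::finite. axis j (1::real))"
  by (auto simp: inj_def axis_eq_axis)

lemma gaussian_integral:
  fixes \<zeta> :: "complex^'d::finite"
  assumes l: "0 < l"
  shows "integrable lborel (\<lambda>y::real^'d. exp (of_real (- (l / 2) * (norm y)\<^sup>2) + cbilin \<zeta> (\<chi> j. of_real (y $ j))))"
    and "(\<integral>y. exp (of_real (- (l / 2) * (norm y)\<^sup>2) + cbilin \<zeta> (\<chi> j. of_real (y $ j))) \<partial>lborel) =
      of_real (sqrt (2 * pi / l) ^ CARD('d)) * exp (cbilin \<zeta> \<zeta> / (2 * of_real l))"
proof -
  \<comment> \<open>Basis vectors are the \<open>axis j 1\<close>; inverting that map recovers the
    coordinate of \<zeta> belonging to b.\<close>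
  define F where "F = (\<lambda>b::real^'d. \<lambda>t::real. exp (of_real (- (l / 2) * t\<^sup>2) + \<zeta> $ (the_inv (\<lambda>j. axis j (1::real)) b) * of_real t))"
  have Fj: "F (axis j 1) = (\<lambda>t. exp (of_real (- (l / 2) * t\<^sup>2) + \<zeta> $ j * of_real t))" for j
    by (simp add: F_def the_inv_f_f[OF inj_axis])
  have prod: "(\<Prod>b\<in>Basis. G b) = (\<Prod>j\<in>UNIV. G (axis j (1::real)))" for G :: "real^'d \<Rightarrow> complex"
    unfolding Basis_vec_real by (subst prod.reindex[OF inj_axis]) simp
  have eq: "exp (of_real (- (l / 2) * (norm y)\<^sup>2) + cbilin \<zeta> (\<chi> j. of_real (y $ j))) = (\<Prod>b\<in>Basis. F b (y \<bullet> b))" for y :: "real^'d"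
  proof -
    have "of_real (- (l / 2) * (norm y)\<^sup>2) + cbilin \<zeta> (\<chi> j. of_real (y $ j)) =
       (\<Sum>j\<in>UNIV. of_real (- (l / 2) * (y $ j)\<^sup>2) + \<zeta> $ j * of_real (y $ j))"
      by (simp add: norm_vec_power2 cbilin_def sum.distrib sum_distrib_left sum_negf sum_subtractf)
    then show ?thesis unfolding prod Fj by (simp add: exp_sum cart_eq_inner_axis[symmetric])
  qed
  have I: "integrable lborel (F b)" if "b \<in> Basis" for b
    using that gaussian_integral_1(1)[OF l] unfolding Basis_vec_real by (auto simp: Fj)
  show "integrable lborel (\<lambda>y::real^'d. exp (of_real (- (l / 2) * (norm y)\<^sup>2) + cbilin \<zeta> (\<chi> j. of_real (y $ j))))"
    unfolding eq by (rule integral_lborel_prod_Basis(1)[OF I])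
  have "(\<integral>y. exp (of_real (- (l / 2) * (norm y)\<^sup>2) + cbilin \<zeta> (\<chi> j. of_real (y $ j))) \<partial>lborel) =
      (\<Prod>j\<in>UNIV. of_real (sqrt (2 * pi / l)) * exp ((\<zeta> $ j)\<^sup>2 / (2 * of_real l)))"
  proof -
    have "(\<integral>y. exp (of_real (- (l / 2) * (norm y)\<^sup>2) + cbilin \<zeta> (\<chi> j. of_real (y $ j))) \<partial>lborel) =
      (\<Prod>b\<in>Basis. \<integral>t. F b t \<partial>lborel)"
      unfolding eq by (rule integral_lborel_prod_Basis(2)[OF I])
    then show ?thesis unfolding prod Fj gaussian_integral_1(2)[OF l] .
  qed
  also have "\<dots> = of_real (sqrt (2 * pi / l) ^ CARD('d)) * exp (cbilin \<zeta> \<zeta> / (2 * of_real l))"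
    by (simp add: prod.distrib exp_sum[symmetric] cbilin_def sum_divide_distrib power2_eq_square)
  finally show "(\<integral>y. exp (of_real (- (l / 2) * (norm y)\<^sup>2) + cbilin \<zeta> (\<chi> j. of_real (y $ j))) \<partial>lborel) =
      of_real (sqrt (2 * pi / l) ^ CARD('d)) * exp (cbilin \<zeta> \<zeta> / (2 * of_real l))" .
qed

lemma integrable_gaussian:
  assumes a: "0 < a"
  shows "integrable lborel (\<lambda>y::real^'d::finite. gaussian a y)"
proof -
  have "integrable lborel (\<lambda>y::real^'d. exp (of_real (- (2 * a / 2) * (norm y)\<^sup>2) + cbilin 0 (\<chi> j. of_real (y $ j))))"
    using a by (intro gaussian_integral) auto
  then have "integrable lborel (\<lambda>y::real^'d. complex_of_real (gaussian a y))"
    by (simp add: cbilin_def exp_of_real[symmetric])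
  then show ?thesis using integrable_Re by fastforce
qed

lemma integral_gaussian:
  assumes a: "0 < a"
  shows "(\<integral>y. gaussian a y \<partial>(lborel :: (real^'d::finite) measure)) = sqrt (pi / a) ^ CARD('d)"
proof -
  have "complex_of_real (\<integral>y. gaussian a y \<partial>(lborel :: (real^'d::finite) measure)) =
    (\<integral>y. complex_of_real (gaussian a y) \<partial>(lborel :: (real^'d::finite) measure))"
    by (rule integral_complex_of_real[symmetric])
  also have "\<dots> = (\<integral>y. exp (of_real (- (2 * a / 2) * (norm y)\<^sup>2) + cbilin 0 (\<chi> j. of_real (y $ j))) \<partial>(lborel :: (real^'d::finite) measure))"
    by (simp add: cbilin_def exp_of_real[symmetric])
  also have "\<dots> = of_real (sqrt (pi / a) ^ CARD('d))"
    using a by (subst gaussian_integral) (auto simp: cbilin_def)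
  finally show ?thesis using of_real_eq_iff by blast
qed

lemma norm_Pair_power2: "(norm (x, y))\<^sup>2 = (norm x)\<^sup>2 + (norm y)\<^sup>2"
  by (simp add: norm_Pair)

lemma integrable_gaussian_pair:
  assumes a: "0 < a" and b: "0 < b"
  shows "integrable lborel (\<lambda>(x::real^'d::finite, y::real^'d). gaussian a x * gaussian b y)"
  unfolding lborel_prod[symmetric]
proof (rule lborel_pair.Fubini_integrable)
  have "(\<lambda>x. \<integral>y. norm (case (x, y) of (x::real^'d, y::real^'d) \<Rightarrow> gaussian a x * gaussian b y) \<partial>lborel) =
    (\<lambda>x. gaussian a x * (\<integral>y. gaussian b (y::real^'d) \<partial>lborel))"
    by (simp add: abs_mult)
  then show "integrable lborel (\<lambda>x. \<integral>y. norm (case (x, y) of (x::real^'d, y::real^'d) \<Rightarrow> gaussian a x * gaussian b y) \<partial>lborel)"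
    using integrable_gaussian[OF a, where 'd = 'd] by simp
  show "AE x in lborel. integrable lborel (\<lambda>y. case (x, y) of (x::real^'d, y::real^'d) \<Rightarrow> gaussian a x * gaussian b y)"
    using integrable_gaussian[OF b, where 'd = 'd] by simp
qed (simp add: split_def)

text \<open>The sign is + and there is no constant, so that \<open>stft_pair\<close> is the pairing
  with a conjugated Gabor atom; the inversion formula carries the factor (2 pi)^(-d).\<close>

definition fourier :: "(real^'d::finite \<Rightarrow> complex) \<Rightarrow> real^'d \<Rightarrow> complex" where
  "fourier f \<xi> = (\<integral>y. f y * iexp (y \<bullet> \<xi>) \<partial>lborel)"

lemma iexp_inner: "iexp (y \<bullet> \<xi>) = exp (cbilin (\<chi> j. \<i> * of_real (\<xi> $ j)) (\<chi> j. of_real (y $ j)))"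
  by (simp add: cbilin_def inner_vec_def sum_distrib_left mult_ac)

lemma fourier_gaussian:
  fixes \<xi> :: "real^'d::finite"
  assumes l: "0 < l"
  shows "(\<integral>y. of_real (gaussian (l / 2) y) * iexp (y \<bullet> \<xi>) \<partial>lborel) =
      complex_of_real (sqrt (2 * pi / l) ^ CARD('d) * exp (- (norm \<xi>)\<^sup>2 / (2 * l)))"
proof -
  have A: "of_real (gaussian (l / 2) y) * iexp (y \<bullet> \<xi>) =
     exp (of_real (- (l / 2) * (norm y)\<^sup>2) + cbilin (\<chi> j. \<i> * of_real (\<xi> $ j)) (\<chi> j. of_real (y $ j)))" for y :: "real^'d"
    unfolding iexp_inner exp_add exp_of_real ..
  have B: "cbilin (\<chi> j. \<i> * of_real (\<xi> $ j)) (\<chi> j. \<i> * of_real (\<xi> $ j)) = of_real (- (norm \<xi>)\<^sup>2)"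
    by (subst norm_vec_power2) (simp add: cbilin_def sum_negf[symmetric] power2_eq_square algebra_simps)
  show ?thesis unfolding A gaussian_integral(2)[OF l] B by (simp flip: exp_of_real)
qed

text \<open>Gaussian regularisation: with the factor exp (- e |\<xi>|^2 / 2) inserted, Fubini turns
  the integral into a convolution of g with a Gaussian of width sqrt e. The limit e \<rightarrow> 0
  is taken on both sides by dominated convergence.\<close>

lemma fourier_inversion:
  fixes g :: "real^'d::finite \<Rightarrow> complex"
  assumes g: "continuous_on UNIV g" and a: "0 < a" and ga: "\<And>y. norm (g y) \<le> C * gaussian a y"
    and b: "0 < b" and gb: "\<And>\<xi>. norm (fourier g \<xi>) \<le> D * exp (- b * (norm \<xi>)\<^sup>2)"
  shows "g y = of_real ((2 * pi) powr (- real CARD('d))) * (\<integral>\<xi>. fourier g \<xi> * exp (- (\<i> * of_real (y \<bullet> \<xi>))) \<partial>lborel)"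
proof -
  have gm[measurable]: "g \<in> borel_measurable borel" using g by (rule borel_measurable_continuous_onI)
  have fm[measurable]: "fourier g \<in> borel_measurable borel"
  proof -
    have "(\<lambda>\<xi>. \<integral>y. g y * iexp (y \<bullet> \<xi>) \<partial>lborel) \<in> borel_measurable borel"
      by (rule lborel.borel_measurable_lebesgue_integral) (auto simp: split_def)
    then show ?thesis by (simp add: fourier_def[abs_def])
  qed
  have C: "0 \<le> C" using order_trans[OF norm_ge_zero ga[of 0]] by simp
  have gC: "norm (g x) \<le> C" for x
    using order_trans[OF ga[of x], of C] C a by (simp add: mult_left_le)
  define e where "e = (\<lambda>n. inverse (real (Suc n)))"
  have e: "e n > 0" for n by (simp add: e_def)
  have elim: "e \<longlonglongrightarrow> 0" unfolding e_def by (rule LIMSEQ_inverse_real_of_nat)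
  define J where "J = (\<lambda>n. \<integral>\<xi>. fourier g \<xi> * exp (- (\<i> * of_real (y \<bullet> \<xi>))) * of_real (exp (- (e n / 2) * (norm \<xi>)\<^sup>2)) \<partial>lborel)"
  have J1: "J \<longlonglongrightarrow> (\<integral>\<xi>. fourier g \<xi> * exp (- (\<i> * of_real (y \<bullet> \<xi>))) \<partial>lborel)"
    unfolding J_def
  proof (rule integral_dominated_convergence[where w = "\<lambda>\<xi>. D * exp (- b * (norm \<xi>)\<^sup>2)"])
    show "integrable lborel (\<lambda>\<xi>::real^'d. D * exp (- b * (norm \<xi>)\<^sup>2))"
      by (intro integrable_mult_right integrable_gaussian b)
    show "AE \<xi> in lborel. (\<lambda>n. fourier g \<xi> * exp (- (\<i> * of_real (y \<bullet> \<xi>))) * of_real (exp (- (e n / 2) * (norm \<xi>)\<^sup>2)))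
       \<longlonglongrightarrow> fourier g \<xi> * exp (- (\<i> * of_real (y \<bullet> \<xi>)))"
    proof (rule AE_I2)
      fix \<xi> :: "real^'d"
      have "(\<lambda>n. fourier g \<xi> * exp (- (\<i> * of_real (y \<bullet> \<xi>))) * of_real (exp (- (e n / 2) * (norm \<xi>)\<^sup>2)))
       \<longlonglongrightarrow> fourier g \<xi> * exp (- (\<i> * of_real (y \<bullet> \<xi>))) * of_real (exp (- (0 / 2) * (norm \<xi>)\<^sup>2))"
        by (intro tendsto_intros elim) auto
      then show "(\<lambda>n. fourier g \<xi> * exp (- (\<i> * of_real (y \<bullet> \<xi>))) * of_real (exp (- (e n / 2) * (norm \<xi>)\<^sup>2)))
       \<longlonglongrightarrow> fourier g \<xi> * exp (- (\<i> * of_real (y \<bullet> \<xi>)))" by simp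
    qed
    show "AE \<xi> in lborel. norm (fourier g \<xi> * exp (- (\<i> * of_real (y \<bullet> \<xi>))) * of_real (exp (- (e n / 2) * (norm \<xi>)\<^sup>2)))
      \<le> D * exp (- b * (norm \<xi>)\<^sup>2)" for n
    proof (rule AE_I2)
      fix \<xi> :: "real^'d"
      have "exp (- (e n / 2) * (norm \<xi>)\<^sup>2) \<le> 1" using e[of n] by simp
      then have "norm (fourier g \<xi>) * exp (- (e n / 2) * (norm \<xi>)\<^sup>2) \<le> norm (fourier g \<xi>)"
        by (intro mult_left_le) auto
      also note gb
      finally show "norm (fourier g \<xi> * exp (- (\<i> * of_real (y \<bullet> \<xi>))) * of_real (exp (- (e n / 2) * (norm \<xi>)\<^sup>2)))
      \<le> D * exp (- b * (norm \<xi>)\<^sup>2)" by (simp add: norm_mult)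
    qed
  qed measurable
  let ?c = "complex_of_real (sqrt (2 * pi) ^ CARD('d))"
  \<comment> \<open>The second evaluation of J: integrate in \<xi> first, then substitute x = y +
    sqrt (e n) v, which makes the Gaussian independent of n.\<close>
  have Jn: "J n = ?c * (\<integral>v. g (y + sqrt (e n) *\<^sub>R v) * of_real (gaussian (1 / 2) v) \<partial>lborel)" for n
  proof -
    let ?k = "\<lambda>x \<xi>. g x * iexp (x \<bullet> \<xi>) * (exp (- (\<i> * of_real (y \<bullet> \<xi>))) * of_real (exp (- (e n / 2) * (norm \<xi>)\<^sup>2)))"
    have int: "integrable (lborel \<Otimes>\<^sub>M lborel) (\<lambda>(x, \<xi>). ?k x \<xi>)"
    proof (rule Bochner_Integration.integrable_bound)
      show "integrable (lborel \<Otimes>\<^sub>M lborel) (\<lambda>X. C * (\<lambda>(x::real^'d, \<xi>::real^'d). gaussian a x * exp (- (e n / 2) * (norm \<xi>)\<^sup>2)) X)"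
        unfolding lborel_prod using a e[of n] by (intro integrable_mult_right integrable_gaussian_pair) auto
      show "AE X in lborel \<Otimes>\<^sub>M lborel. norm ((\<lambda>(x, \<xi>). ?k x \<xi>) X) \<le>
        norm (C * (\<lambda>(x::real^'d, \<xi>::real^'d). gaussian a x * exp (- (e n / 2) * (norm \<xi>)\<^sup>2)) X)"
        using ga by (intro AE_I2) (auto simp: norm_mult abs_mult C mult.assoc[symmetric] intro!: mult_right_mono)
    qed (auto simp: split_def)
    have inner: "(\<integral>\<xi>. ?k x \<xi> \<partial>lborel) = g x * of_real (sqrt (2 * pi / e n) ^ CARD('d) * exp (- (norm (x - y))\<^sup>2 / (2 * e n)))" for x
    proof -
      have "?k x \<xi> = g x * (of_real (exp (- (e n / 2) * (norm \<xi>)\<^sup>2)) * iexp (\<xi> \<bullet> (x - y)))" for \<xi>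
        by (simp add: exp_add[symmetric] inner_diff_right inner_commute algebra_simps exp_diff exp_minus divide_simps)
      then show ?thesis
        by (simp only: integral_mult_right_zero fourier_gaussian[OF e[of n]])
    qed
    have "J n = (\<integral>\<xi>. (\<integral>x. ?k x \<xi> \<partial>lborel) \<partial>lborel)"
    proof -
      have "(\<integral>x. ?k x \<xi> \<partial>lborel) = fourier g \<xi> * (exp (- (\<i> * of_real (y \<bullet> \<xi>))) * of_real (exp (- (e n / 2) * (norm \<xi>)\<^sup>2)))" for \<xi>
        unfolding fourier_def by (rule integral_mult_left_zero)
      then show ?thesis by (simp only: J_def mult.assoc)
    qed
    also have "\<dots> = (\<integral>x. (\<integral>\<xi>. ?k x \<xi> \<partial>lborel) \<partial>lborel)"
      by (rule lborel_pair.Fubini_integral[OF int])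
    also have "\<dots> = (\<integral>x. g x * of_real (sqrt (2 * pi / e n) ^ CARD('d) * exp (- (norm (x - y))\<^sup>2 / (2 * e n))) \<partial>lborel)"
      by (simp only: inner)
    also have "\<dots> =
      \<bar>sqrt (e n)\<bar> ^ DIM(real^'d) *\<^sub>R (\<integral>v. g (y + sqrt (e n) *\<^sub>R v) * of_real (sqrt (2 * pi / e n) ^ CARD('d) * exp (- (norm (y + sqrt (e n) *\<^sub>R v - y))\<^sup>2 / (2 * e n))) \<partial>lborel)"
      using e[of n] by (intro integral_lborel_affine) auto
    also have "\<dots> = of_real (sqrt (e n) ^ CARD('d)) * (\<integral>v. of_real (sqrt (2 * pi / e n) ^ CARD('d)) * (g (y + sqrt (e n) *\<^sub>R v) * of_real (gaussian (1 / 2) v)) \<partial>lborel)"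
    proof -
      have "- (norm (y + sqrt (e n) *\<^sub>R v - y))\<^sup>2 / (2 * e n) = - (1 / 2) * (norm v)\<^sup>2" for v :: "real^'d"
        using e[of n] by (simp add: power_mult_distrib)
      then show ?thesis using e[of n] by (simp only: scaleR_conv_of_real[where 'a = complex]) (simp add: mult_ac)
    qed
    also have "\<dots> = of_real (sqrt (e n) ^ CARD('d) * sqrt (2 * pi / e n) ^ CARD('d)) * (\<integral>v. g (y + sqrt (e n) *\<^sub>R v) * of_real (gaussian (1 / 2) v) \<partial>lborel)"
      by simp
    also have "sqrt (e n) ^ CARD('d) * sqrt (2 * pi / e n) ^ CARD('d) = sqrt (2 * pi) ^ CARD('d)"
      using e[of n] by (simp add: power_mult_distrib[symmetric] real_sqrt_mult[symmetric])
    finally show ?thesis .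
  qed
  have "J \<longlonglongrightarrow> ?c * (\<integral>v. g y * of_real (gaussian (1 / 2) v) \<partial>(lborel :: (real^'d) measure))"
    unfolding Jn[abs_def]
  proof (intro tendsto_mult tendsto_const integral_dominated_convergence[where w = "\<lambda>v. C * gaussian (1 / 2) v"])
    show "integrable lborel (\<lambda>v::real^'d. C * gaussian (1 / 2) v)"
      by (intro integrable_mult_right integrable_gaussian) auto
    show "AE v in lborel. norm (g (y + sqrt (e n) *\<^sub>R v) * of_real (gaussian (1 / 2) v)) \<le> C * gaussian (1 / 2) v" for n
      using gC by (intro AE_I2) (auto simp: norm_mult intro!: mult_right_mono)
    show "AE v in lborel. (\<lambda>n. g (y + sqrt (e n) *\<^sub>R v) * of_real (gaussian (1 / 2) v)) \<longlonglongrightarrow> g y * of_real (gaussian (1 / 2) v)"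
    proof (rule AE_I2, intro tendsto_mult tendsto_const)
      fix v :: "real^'d"
      have "(\<lambda>n. y + sqrt (e n) *\<^sub>R v) \<longlonglongrightarrow> y + sqrt 0 *\<^sub>R v" by (intro tendsto_intros elim)
      moreover have "isCont g y" using g by (simp add: continuous_on_eq_continuous_at)
      ultimately show "(\<lambda>n. g (y + sqrt (e n) *\<^sub>R v)) \<longlonglongrightarrow> g y"
        by (intro isCont_tendsto_compose[where g = g]) auto
    qed
  qed measurable
  also have "(\<integral>v. g y * of_real (gaussian (1 / 2) v) \<partial>(lborel :: (real^'d) measure)) = g y * ?c"
    using integral_gaussian[of "1/2", where 'd = 'd] by (simp only: integral_mult_right_zero integral_complex_of_real) (simp add: mult.commute)
  finally have "(\<integral>\<xi>. fourier g \<xi> * exp (- (\<i> * of_real (y \<bullet> \<xi>))) \<partial>lborel) = ?c * (g y * ?c)"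
    using J1 LIMSEQ_unique by blast
  also have "\<dots> = of_real ((sqrt (2 * pi) ^ CARD('d)) * (sqrt (2 * pi) ^ CARD('d))) * g y" by simp
  also have "(sqrt (2 * pi) ^ CARD('d)) * (sqrt (2 * pi) ^ CARD('d)) = (2 * pi) powr real CARD('d)"
    by (subst power_mult_distrib[symmetric]) (simp add: powr_realpow)
  finally show ?thesis by (simp add: powr_minus)
qed

section \<open>Decay of Gelfand-Shilov functions and of their Fourier transforms\<close>

text \<open>If every term s^n / n! were below exp (s/2) / 4, summing with weights 2^(-n) would give
  exp (s/2) \<le> exp (s/2) / 2. Thus some single term of the series is large, and bounds for each
  power separately give exponential decay without summing seminorms.\<close>

lemma ex_exp_le_power:
  fixes s :: real
  assumes s: "0 \<le> s"
  shows "\<exists>n. exp (s / 2) \<le> 4 * (s ^ n / fact n)"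
proof (rule ccontr)
  assume "\<not> ?thesis"
  then have nle: "\<not> exp (s / 2) \<le> 4 * (s ^ n / fact n)" for n by blast
  have lt: "s ^ n / fact n \<le> exp (s / 2) / 4" for n using nle[of n] by linarith
  have 1: "(\<lambda>n. (s / 2) ^ n /\<^sub>R fact n) sums exp (s / 2)" by (rule exp_converges)
  have 2: "(\<lambda>n. (1 / 2) ^ n * (exp (s / 2) / 4)) sums (1 / (1 - 1 / 2) * (exp (s / 2) / 4))"
    by (intro sums_mult2 geometric_sums) auto
  have 3: "(s / 2) ^ n /\<^sub>R fact n \<le> (1 / 2) ^ n * (exp (s / 2) / 4)" for n
  proof -
    have "(s / 2) ^ n /\<^sub>R fact n = (1 / 2) ^ n * (s ^ n / fact n)"
      by (simp add: power_divide field_simps)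
    also have "\<dots> \<le> (1 / 2) ^ n * (exp (s / 2) / 4)" by (intro mult_left_mono lt) auto
    finally show ?thesis .
  qed
  have "exp (s / 2) \<le> 1 / (1 - 1 / 2) * (exp (s / 2) / 4)" by (rule sums_le[OF 3 1 2])
  then show False by simp
qed

text \<open>(2 n)! is (n!)^2 times a central binomial coefficient, and the latter is at most
  4^n.\<close>

lemma sqrt_fact_double_le: "sqrt (fact (2 * n)) \<le> 2 ^ n * fact n"
proof -
  have "(fact (2 * n) :: real) = fact n * fact n * real (2 * n choose n)"
    using binomial_fact_lemma[of n "2 * n"] by (metis (no_types, lifting) mult_2 add_diff_cancel_left' le_add1 of_nat_fact of_nat_mult)
  also have "\<dots> \<le> fact n * fact n * 2 ^ (2 * n)"
  proof (rule mult_left_mono)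
    have "real (2 * n choose n) \<le> real (2 ^ (2 * n))"
      using binomial_le_pow2[of "2 * n" n] by (subst of_nat_le_iff)
    then show "real (2 * n choose n) \<le> 2 ^ (2 * n)" by simp
  qed simp
  also have "\<dots> = (2 ^ n * fact n)\<^sup>2" by (simp add: power2_eq_square mult_2 power_add)
  finally show ?thesis by (intro real_le_lsqrt) auto
qed

text \<open>The multi-index is chosen for the given y: in each coordinate an even exponent whose
  term dominates the exponential. The losses are the factor 4 per coordinate and half of the
  rate.\<close>

lemma gaussian_decay_from_powers:
  fixes y :: "real^'d::finite"
  assumes h: "0 < h" and X: "0 \<le> X"
    and le: "\<And>\<beta>. \<bar>multi_power y \<beta>\<bar> * X \<le> M * (h ^ multi_abs \<beta> * sqrt (multi_fact \<beta>))"
  shows "X \<le> 4 ^ CARD('d) * M * gaussian (1 / (4 * h\<^sup>2)) y"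
proof -
  \<comment> \<open>The 2 in the denominator produces 2^n n!, the upper bound for sqrt ((2
    n)!).\<close>
  define s where "s = (\<lambda>j. (y $ j)\<^sup>2 / (2 * h\<^sup>2))"
  have "\<exists>n. exp (s j / 2) \<le> 4 * (s j ^ n / fact n)" for j
    by (rule ex_exp_le_power) (simp add: s_def)
  then obtain n where n: "\<And>j. exp (s j / 2) \<le> 4 * (s j ^ n j / fact (n j))" by metis
  define \<beta> where "\<beta> = (\<lambda>j. 2 * n j)"
  define Q where "Q = h ^ multi_abs \<beta> * sqrt (multi_fact \<beta>)"
  have Q: "Q > 0" unfolding Q_def using h multi_fact_pos[of \<beta>] by simp
  have one: "exp (s j / 2) \<le> 4 * (\<bar>y $ j\<bar> ^ \<beta> j / (h ^ \<beta> j * sqrt (fact (\<beta> j))))" for j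
  proof -
    have "s j ^ n j / fact (n j) = \<bar>y $ j\<bar> ^ \<beta> j / (h ^ \<beta> j * (2 ^ n j * fact (n j)))"
      by (simp add: s_def \<beta>_def power_divide power_mult_distrib power_mult)
    also have "\<dots> \<le> \<bar>y $ j\<bar> ^ \<beta> j / (h ^ \<beta> j * sqrt (fact (\<beta> j)))"
      using h sqrt_fact_double_le[of "n j"] by (intro divide_left_mono mult_left_mono) (auto simp: \<beta>_def)
    finally show ?thesis using n[of j] by linarith
  qed
  have "exp ((1 / (4 * h\<^sup>2)) * (norm y)\<^sup>2) = (\<Prod>j\<in>UNIV. exp (s j / 2))"
    by (simp add: norm_vec_power2 s_def sum_distrib_left sum_divide_distrib exp_sum[symmetric] mult_ac)
  also have "\<dots> \<le> (\<Prod>j\<in>UNIV. 4 * (\<bar>y $ j\<bar> ^ \<beta> j / (h ^ \<beta> j * sqrt (fact (\<beta> j)))))"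
    by (intro prod_mono conjI one) auto
  also have "\<dots> = 4 ^ CARD('d) * (\<bar>multi_power y \<beta>\<bar> / Q)"
    by (simp add: prod.distrib prod_dividef multi_power_def abs_prod power_abs Q_def multi_abs_def power_sum multi_fact_def real_sqrt_prod)
  finally have E: "exp ((1 / (4 * h\<^sup>2)) * (norm y)\<^sup>2) \<le> 4 ^ CARD('d) * (\<bar>multi_power y \<beta>\<bar> / Q)" .
  have "X * exp ((1 / (4 * h\<^sup>2)) * (norm y)\<^sup>2) \<le> X * (4 ^ CARD('d) * (\<bar>multi_power y \<beta>\<bar> / Q))"
    by (intro mult_left_mono E X)
  also have "\<dots> = 4 ^ CARD('d) * ((\<bar>multi_power y \<beta>\<bar> * X) / Q)" by simp
  also have "\<dots> \<le> 4 ^ CARD('d) * M"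
    using le[of \<beta>] Q by (intro mult_left_mono) (auto simp: pos_divide_le_eq Q_def)
  finally show ?thesis by (simp add: exp_minus field_simps)
qed

lemma GS_iter_partial_decay:
  fixes f :: "real^'d::finite \<Rightarrow> complex"
  assumes h: "0 < h" and f: "f \<in> GS_step (1/2) h"
  shows "norm (iter_partial is f y) \<le>
    4 ^ CARD('d) * (enn2real (GS_norm (1/2) h f) * h ^ length is * sqrt (multi_fact (count_list is))) * gaussian (1 / (4 * h\<^sup>2)) y"
proof (rule gaussian_decay_from_powers[OF h])
  fix \<beta>
  have "\<bar>multi_power y \<beta>\<bar> * norm (iter_partial is f y) \<le>
    enn2real (GS_norm (1/2) h f) * GS_weight (1/2) h is \<beta>" by (rule GS_stepD(2)[OF f h])
  also have "\<dots> = enn2real (GS_norm (1/2) h f) * h ^ length is * sqrt (multi_fact (count_list is)) * (h ^ multi_abs \<beta> * sqrt (multi_fact \<beta>))"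
    by (subst powr_half_sqrt) (simp_all add: multi_fact_pos less_imp_le real_sqrt_mult power_add mult_ac)
  finally show "\<bar>multi_power y \<beta>\<bar> * norm (iter_partial is f y) \<le>
    enn2real (GS_norm (1/2) h f) * h ^ length is * sqrt (multi_fact (count_list is)) * (h ^ multi_abs \<beta> * sqrt (multi_fact \<beta>))" .
qed simp

section \<open>Fourier transforms of Gelfand-Shilov functions\<close>

lemma smooth_borel_measurable: "smooth f \<Longrightarrow> f \<in> borel_measurable borel"
  by (intro borel_measurable_continuous_onI smooth_continuous)

lemma fourier_borel_measurable:
  assumes [measurable]: "f \<in> borel_measurable borel"
  shows "fourier f \<in> borel_measurable borel"
proof -
  have "(\<lambda>\<xi>. \<integral>y. f y * iexp (y \<bullet> \<xi>) \<partial>lborel) \<in> borel_measurable borel"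
    by (rule lborel.borel_measurable_lebesgue_integral) (auto simp: split_def)
  then show ?thesis by (simp add: fourier_def[abs_def])
qed

text \<open>Equivalent to |x + 2 y|^2 \<ge> 0. It compares a shifted Gaussian with a centred one of
  half the rate.\<close>

lemma norm_diff_power2_ge:
  fixes x y :: "'a::real_inner"
  shows "(norm x)\<^sup>2 / 2 - (norm y)\<^sup>2 \<le> (norm (x + y))\<^sup>2"
proof -
  have "0 \<le> (norm (x + 2 *\<^sub>R y))\<^sup>2" by simp
  also have "\<dots> = 2 * ((norm (x + y))\<^sup>2 - ((norm x)\<^sup>2 / 2 - (norm y)\<^sup>2))"
    by (simp add: power2_norm_eq_inner inner_simps inner_commute algebra_simps)
  finally show ?thesis by simp
qed

lemma integrable_gaussian_bound:
  fixes f :: "real^'d::finite \<Rightarrow> complex"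
  assumes f: "f \<in> borel_measurable borel" and a: "0 < a" and le: "\<And>y. norm (f y) \<le> B * gaussian a y"
  shows "integrable lborel f"
proof (rule Bochner_Integration.integrable_bound)
  show "integrable lborel (\<lambda>y::real^'d. B * gaussian a y)"
    by (intro integrable_mult_right integrable_gaussian a)
  show "AE y in lborel. norm (f y) \<le> norm (B * gaussian a y)"
    using order_trans[OF le abs_ge_self] by (intro AE_I2) (simp del: abs_mult)
qed (use f in simp)

text \<open>Integration by parts through translation invariance: with G the integrand of the
  transform, every difference quotient of G has integral 0, hence so has its partial derivative, and
  the product rule splits the latter into the two sides.\<close>

lemma fourier_partial_deriv:
  fixes g :: "real^'d::finite \<Rightarrow> complex"
  assumes g: "smooth g" and a: "0 < a" and B0: "\<And>y. norm (g y) \<le> B0 * gaussian a y"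
    and B1: "\<And>y. norm (partial_deriv i g y) \<le> B1 * gaussian a y"
  shows "fourier (partial_deriv i g) \<xi> = - \<i> * of_real (\<xi> $ i) * fourier g \<xi>"
proof -
  have [measurable]: "g \<in> borel_measurable borel" "partial_deriv i g \<in> borel_measurable borel"
    using g smooth_partial_deriv smooth_borel_measurable by blast+
  have B: "0 \<le> B0" "0 \<le> B1" using order_trans[OF norm_ge_zero B0[of 0]] order_trans[OF norm_ge_zero B1[of 0]] by simp_all
  define G where "G = (\<lambda>y. g y * iexp (y \<bullet> \<xi>))"
  have [measurable]: "G \<in> borel_measurable borel" unfolding G_def by measurable
  have dG: "G differentiable (at y)"
    and pG: "partial_deriv i G y = partial_deriv i g y * iexp (y \<bullet> \<xi>) + \<i> * of_real (\<xi> $ i) * (g y * iexp (y \<bullet> \<xi>))" for y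
  proof -
    have dg: "(g has_derivative frechet_derivative g (at y)) (at y)"
      using smooth_differentiable[OF g] frechet_derivative_works by blast
    have "((\<lambda>y. \<i> * complex_of_real (y \<bullet> \<xi>)) has_derivative (\<lambda>v. \<i> * of_real (v \<bullet> \<xi>))) (at y)"
      by (intro bounded_linear_imp_has_derivative bounded_linear_compose[OF bounded_linear_mult_right]
          bounded_linear_compose[OF bounded_linear_of_real bounded_linear_inner_left])
    from has_derivative_compose[OF this DERIV_exp[unfolded has_field_derivative_def]]
    have de: "((\<lambda>y. iexp (y \<bullet> \<xi>)) has_derivative (\<lambda>v. iexp (y \<bullet> \<xi>) * (\<i> * of_real (v \<bullet> \<xi>)))) (at y)" .
    have D: "(G has_derivative (\<lambda>v. g y * (iexp (y \<bullet> \<xi>) * (\<i> * of_real (v \<bullet> \<xi>))) + frechet_derivative g (at y) v * iexp (y \<bullet> \<xi>))) (at y)"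
      unfolding G_def by (rule has_derivative_mult[OF dg de])
    then show "G differentiable (at y)" by (auto simp: differentiable_def)
    show "partial_deriv i G y = partial_deriv i g y * iexp (y \<bullet> \<xi>) + \<i> * of_real (\<xi> $ i) * (g y * iexp (y \<bullet> \<xi>))"
      unfolding partial_deriv_eqI[OF D] by (simp add: partial_deriv_def inner_axis' inner_axis algebra_simps)
  qed
  define K where "K = B1 + \<bar>\<xi> $ i\<bar> * B0"
  have K: "0 \<le> K" using B by (simp add: K_def)
  have pGK: "norm (partial_deriv i G y) \<le> K * gaussian a y" for y
  proof -
    have "norm (partial_deriv i G y) \<le> norm (partial_deriv i g y) + \<bar>\<xi> $ i\<bar> * norm (g y)"
      unfolding pG by (rule norm_triangle_le) (simp add: norm_mult)
    also have "\<dots> \<le> B1 * gaussian a y + \<bar>\<xi> $ i\<bar> * (B0 * gaussian a y)"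
      by (intro add_mono mult_left_mono B0 B1) auto
    finally show ?thesis by (simp add: K_def algebra_simps)
  qed
  have intG: "integrable lborel G"
    by (rule integrable_gaussian_bound[OF _ a, of _ B0]) (use B0 in \<open>auto simp: G_def norm_mult\<close>)
  have intpg: "integrable lborel (\<lambda>y. partial_deriv i g y * iexp (y \<bullet> \<xi>))"
    by (rule integrable_gaussian_bound[OF _ a, of _ B1]) (use B1 in \<open>auto simp: norm_mult\<close>)
  let ?q = "\<lambda>n y. real (Suc n) *\<^sub>R (G (y + inverse (real (Suc n)) *\<^sub>R axis i 1) - G y)"
  \<comment> \<open>A shift of length at most 1 replaces rate a by a / 2 at the cost of the factor
    exp a; this gives the dominating function.\<close>
  have lim: "(\<lambda>n. \<integral>y. ?q n y \<partial>lborel) \<longlonglongrightarrow> (\<integral>y. partial_deriv i G y \<partial>lborel)"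
  proof (rule integral_dominated_convergence[where w = "\<lambda>y. K * exp a * gaussian (a / 2) y"])
    show "partial_deriv i G \<in> borel_measurable lborel" unfolding pG[abs_def] by measurable
    show "integrable lborel (\<lambda>y::real^'d. K * exp a * gaussian (a / 2) y)"
      using a by (intro integrable_mult_right integrable_gaussian) auto
    show "AE y in lborel. (\<lambda>n. ?q n y) \<longlonglongrightarrow> partial_deriv i G y"
      by (intro AE_I2 partial_deriv_LIMSEQ dG)
    show "AE y in lborel. norm (?q n y) \<le> K * exp a * gaussian (a / 2) y" for n
    proof (rule AE_I2)
      fix y :: "real^'d"
      let ?t = "inverse (real (Suc n))"
      have "norm (G (y + ?t *\<^sub>R axis i 1) - G y) \<le> (K * exp a * gaussian (a / 2) y) * ?t"
      proof (rule partial_deriv_increment_le[OF dG])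
        fix s :: real assume s: "0 \<le> s" "s \<le> ?t"
        have "?t \<le> 1" by (simp add: divide_simps)
        then have "s\<^sup>2 \<le> 1" using s by (simp add: power_le_one)
        then have "(norm y)\<^sup>2 / 2 - 1 \<le> (norm (y + s *\<^sub>R axis i 1))\<^sup>2"
          using norm_diff_power2_ge[of y "s *\<^sub>R axis i 1"] by simp
        then have "a * ((norm y)\<^sup>2 / 2 - 1) \<le> a * (norm (y + s *\<^sub>R axis i 1))\<^sup>2"
          using a by (intro mult_left_mono) auto
        then have "gaussian a (y + s *\<^sub>R axis i 1) \<le> exp a * gaussian (a / 2) y"
          by (simp add: exp_add[symmetric] algebra_simps)
        then have "K * gaussian a (y + s *\<^sub>R axis i 1) \<le> K * (exp a * gaussian (a / 2) y)"
          using K by (rule mult_left_mono)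
        with pGK[of "y + s *\<^sub>R axis i 1"]
        show "norm (partial_deriv i G (y + s *\<^sub>R axis i 1)) \<le> K * exp a * gaussian (a / 2) y"
          by (simp add: mult.assoc)
      qed simp
      then show "norm (?q n y) \<le> K * exp a * gaussian (a / 2) y"
        by (simp add: divide_simps mult_ac del: of_nat_Suc)
    qed
  qed measurable
  have zero: "(\<integral>y. ?q n y \<partial>lborel) = 0" for n
  proof -
    have "integrable lborel (\<lambda>y. G (y + inverse (real (Suc n)) *\<^sub>R axis i 1))"
      using integrable_lborel_translate[OF intG, of "inverse (real (Suc n)) *\<^sub>R axis i 1"] by (simp add: add.commute)
    moreover have "(\<integral>y. G (y + inverse (real (Suc n)) *\<^sub>R axis i 1) \<partial>lborel) = (\<integral>y. G y \<partial>lborel)"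
      using integral_lborel_translate[of G "inverse (real (Suc n)) *\<^sub>R axis i 1"] by (simp add: add.commute)
    ultimately show ?thesis using intG by (simp del: of_nat_Suc)
  qed
  have "(\<integral>y. partial_deriv i G y \<partial>lborel) = 0"
    using LIMSEQ_unique[OF lim[unfolded zero] tendsto_const] .
  moreover have "(\<integral>y. partial_deriv i G y \<partial>lborel) = fourier (partial_deriv i g) \<xi> + \<i> * of_real (\<xi> $ i) * fourier g \<xi>"
    unfolding pG[abs_def] fourier_def using intpg intG[unfolded G_def]
    by (subst Bochner_Integration.integral_add) (auto simp: integral_mult_right_zero)
  ultimately show ?thesis by (simp add: add_eq_0_iff)
qed

lemma multi_power_count_list_Cons:
  "multi_power \<xi> (count_list (i # is)) = \<xi> $ i * multi_power \<xi> (count_list is)"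
proof -
  have "multi_power \<xi> (count_list (i # is)) = (\<Prod>j\<in>UNIV. (if j = i then \<xi> $ i else 1) * (\<xi> $ j) ^ count_list is j)"
    unfolding multi_power_def by (intro prod.cong) auto
  then show ?thesis by (simp add: prod.distrib multi_power_def)
qed

lemma GS_fourier_iter_partial:
  fixes f :: "real^'d::finite \<Rightarrow> complex"
  assumes h: "0 < h" and f: "f \<in> GS_step (1/2) h"
  shows "norm (fourier (iter_partial is f) \<xi>) = \<bar>multi_power \<xi> (count_list is)\<bar> * norm (fourier f \<xi>)"
proof (induction "is")
  case Nil
  then show ?case by (simp add: multi_power_def)
next
  case (Cons i "is")
  have "fourier (iter_partial (i # is) f) \<xi> = - \<i> * of_real (\<xi> $ i) * fourier (iter_partial is f) \<xi>"
    unfolding iter_partial_Cons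
  proof (rule fourier_partial_deriv)
    show "smooth (iter_partial is f)" by (intro smooth_iter_partial GS_stepD(1)[OF f h])
    show "0 < 1 / (4 * h\<^sup>2)" using h by simp
  qed (use GS_iter_partial_decay[OF h f, of "is"] GS_iter_partial_decay[OF h f, of "i # is"] in \<open>auto simp: iter_partial_Cons\<close>)
  then show ?case using Cons unfolding multi_power_count_list_Cons by (simp add: norm_mult abs_mult)
qed

text \<open>The Gelfand-Shilov conditions treat powers and derivatives alike, and the Fourier
  transform exchanges the two, so one decay argument gives the same rate on both sides.\<close>

lemma GS_fourier_decay:
  assumes h: "0 < h"
  shows "\<exists>C\<ge>0. \<forall>f\<in>GS_step (1/2) h. \<forall>y::real^'d::finite.
    norm (f y) \<le> C * enn2real (GS_norm (1/2) h f) * gaussian (1 / (4 * h\<^sup>2)) y \<and>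
    norm (fourier f y) \<le> C * enn2real (GS_norm (1/2) h f) * gaussian (1 / (4 * h\<^sup>2)) y"
proof -
  define a where "a = 1 / (4 * h\<^sup>2)"
  have a: "a > 0" using h by (simp add: a_def)
  define I where "I = (\<integral>y. gaussian a y \<partial>(lborel :: (real^'d) measure))"
  have I0: "I \<ge> 0" unfolding I_def by (rule integral_nonneg_AE) auto
  let ?q = "4 ^ CARD('d) :: real"
  define C where "C = max ?q (?q * (?q * I))"
  have "norm (f y) \<le> C * enn2real (GS_norm (1/2) h f) * gaussian a y \<and>
    norm (fourier f y) \<le> C * enn2real (GS_norm (1/2) h f) * gaussian a y"
    if f: "f \<in> GS_step (1/2) h" for f and y :: "real^'d"
  proof
    let ?N = "enn2real (GS_norm (1/2) h f)"
    have mono: "c * ?N * gaussian a y \<le> C * ?N * gaussian a y" if "c \<le> C" for c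
      using that by (intro mult_right_mono) auto
    have "norm (f y) \<le> ?q * ?N * gaussian a y"
      using GS_iter_partial_decay[OF h f, of "[]" y] by (simp add: a_def multi_fact_def)
    also have "\<dots> \<le> C * ?N * gaussian a y" by (rule mono) (simp add: C_def)
    finally show "norm (f y) \<le> C * ?N * gaussian a y" .
    \<comment> \<open>A power times the transform of f has the modulus of the transform of a
      derivative. The L^1 bound of that derivative has exactly the form h^|\<beta>| sqrt (\<beta>!)
      required for Gaussian decay.\<close>
    have "norm (fourier f y) \<le> ?q * (?q * ?N * I) * gaussian (1 / (4 * h\<^sup>2)) y"
    proof (rule gaussian_decay_from_powers[OF h])
      fix \<beta> :: "'d \<Rightarrow> nat"
      obtain "is" where cl: "count_list is = \<beta>" using ex_count_list[of \<beta>] by auto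
      let ?W = "?q * (?N * h ^ length is * sqrt (multi_fact (count_list is)))"
      have sm: "smooth (iter_partial is f)" by (intro smooth_iter_partial GS_stepD(1)[OF f h])
      note [measurable] = smooth_borel_measurable[OF sm]
      have "\<bar>multi_power y \<beta>\<bar> * norm (fourier f y) = norm (fourier (iter_partial is f) y)"
        by (simp add: GS_fourier_iter_partial[OF h f] cl)
      also have "\<dots> \<le> (\<integral>x. ?W * gaussian a x \<partial>(lborel :: (real^'d) measure))"
        unfolding fourier_def
      proof (rule Bochner_Integration.integral_norm_bound_integral)
        show int: "integrable lborel (\<lambda>x::real^'d. ?W * gaussian a x)"
          by (intro integrable_mult_right integrable_gaussian a)
        show le: "norm (iter_partial is f x * iexp (x \<bullet> y)) \<le> ?W * gaussian a x" for x
          using GS_iter_partial_decay[OF h f, of "is" x] by (simp add: norm_mult a_def)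
        show "integrable lborel (\<lambda>x. iter_partial is f x * iexp (x \<bullet> y))"
          by (rule Bochner_Integration.integrable_bound[OF int]) (auto intro!: AE_I2 order_trans[OF le])
      qed
      also have "\<dots> = ?W * I" unfolding I_def by (rule integral_mult_right_zero)
      also have "\<dots> = ?q * ?N * I * (h ^ multi_abs \<beta> * sqrt (multi_fact \<beta>))"
        using multi_abs_count_list[of "is"] by (simp add: cl)
      finally show "\<bar>multi_power y \<beta>\<bar> * norm (fourier f y) \<le> ?q * ?N * I * (h ^ multi_abs \<beta> * sqrt (multi_fact \<beta>))" .
    qed simp
    also have "\<dots> = (?q * (?q * I)) * ?N * gaussian a y" by (simp add: a_def mult_ac)
    also have "\<dots> \<le> C * ?N * gaussian a y" by (rule mono) (simp add: C_def)
    finally show "norm (fourier f y) \<le> C * ?N * gaussian a y" .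
  qed
  moreover have "C \<ge> 0" by (simp add: C_def le_max_iff_disj)
  ultimately show ?thesis unfolding a_def by blast
qed

section \<open>The short-time Fourier transform\<close>

definition gabor_atom :: "'d::finite phase \<Rightarrow> real^'d \<Rightarrow> complex" where
  "gabor_atom X = (\<lambda>y. of_real (gauss_window (y - fst X)) * exp (- (\<i> * of_real (y \<bullet> snd X))))"

text \<open>The pairing of \<open>f\<close> with the complex conjugate of \<open>gabor_atom X\<close>.\<close>

definition stft_pair :: "(real^'d::finite \<Rightarrow> complex) \<Rightarrow> 'd phase \<Rightarrow> complex" where
  "stft_pair f X = fourier (\<lambda>y. f y * of_real (gauss_window (y - fst X))) (snd X)"

lemma gauss_window_eq: "gauss_window x = pi powr (- (real CARD('d) / 4)) * gaussian (1/2) x" for x :: "real^'d::finite"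
  by (simp add: gauss_window_def)

lemma gauss_window_nonneg: "0 \<le> gauss_window x"
  by (simp add: gauss_window_def)

lemma gauss_window_continuous [continuous_intros]:
  "continuous_on S f \<Longrightarrow> continuous_on S (\<lambda>x. gauss_window (f x))"
  unfolding gauss_window_def by (intro continuous_intros) auto

lemma gauss_window_measurable [measurable]: "gauss_window \<in> borel_measurable borel"
  by (intro borel_measurable_continuous_onI continuous_intros)

lemma exp_norm_Pair: "gaussian r (x, y) = gaussian r x * gaussian r y"
  unfolding norm_Pair_power2 exp_add[symmetric] by (simp only: distrib_left)

text \<open>With m = min a (1/2), the rate m / 2 is kept in y for integrability; the remaining m / 2
  passes to x through \<open>norm_diff_power2_ge\<close>, which halves it again.\<close>

lemma gaussian_convolution_le:
  assumes a: "0 < a"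
  shows "\<exists>D\<ge>0. \<forall>x::real^'d::finite. integrable lborel (\<lambda>y. gaussian a y * gaussian (1/2) (x - y)) \<and>
    (\<integral>y. gaussian a y * gaussian (1/2) (x - y) \<partial>lborel) \<le> D * gaussian (min a (1/2) / 4) x"
proof -
  define m where "m = min a (1/2)"
  have m: "0 < m" "m \<le> a" "m \<le> 1/2" using a by (auto simp: m_def)
  define D where "D = (\<integral>y. gaussian (m/2) y \<partial>(lborel :: (real^'d) measure))"
  have le: "gaussian a y * gaussian (1/2) (x - y) \<le> gaussian (m/2) y * gaussian (m/4) x"
    for x y :: "real^'d"
  proof -
    have "(norm x)\<^sup>2 / 2 - (norm y)\<^sup>2 \<le> (norm (x - y))\<^sup>2"
      using norm_diff_power2_ge[of x "- y"] by simp
    then have "m/2 * ((norm x)\<^sup>2 / 2) \<le> m/2 * ((norm (x - y))\<^sup>2 + (norm y)\<^sup>2)"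
      using m by (intro mult_left_mono) auto
    moreover have "m/2 * (norm (x - y))\<^sup>2 \<le> 1/2 * (norm (x - y))\<^sup>2" "m * (norm y)\<^sup>2 \<le> a * (norm y)\<^sup>2"
      using m by (intro mult_right_mono; simp)+
    ultimately have "- a * (norm y)\<^sup>2 + - (1/2) * (norm (x - y))\<^sup>2 \<le> - (m/2) * (norm y)\<^sup>2 + - (m/4) * (norm x)\<^sup>2"
      by (simp add: algebra_simps)
    then show ?thesis unfolding exp_add[symmetric] by (simp only: exp_le_cancel_iff)
  qed
  have int': "integrable lborel (\<lambda>y::real^'d. gaussian (m/2) y * gaussian (m/4) x)" for x :: "real^'d"
    using m by (intro integrable_mult_left integrable_gaussian) auto
  have int: "integrable lborel (\<lambda>y. gaussian a y * gaussian (1/2) (x - y))" for x :: "real^'d"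
    by (rule Bochner_Integration.integrable_bound[OF int'[of x]]) (use le in auto)
  have "(\<integral>y. gaussian a y * gaussian (1/2) (x - y) \<partial>lborel) \<le> D * gaussian (m/4) x" for x :: "real^'d"
  proof -
    have "(\<integral>y. gaussian a y * gaussian (1/2) (x - y) \<partial>lborel) \<le>
      (\<integral>y. gaussian (m/2) y * gaussian (m/4) x \<partial>(lborel :: (real^'d) measure))"
      by (intro integral_mono int int' le)
    then show ?thesis unfolding D_def by (simp only: integral_mult_left_zero)
  qed
  moreover have "D \<ge> 0" unfolding D_def by (rule integral_nonneg_AE) auto
  ultimately show ?thesis using int unfolding m_def by blast
qed

lemma fourier_gauss_window:
  fixes x \<zeta> :: "real^'d::finite"
  shows "fourier (\<lambda>y. of_real (gauss_window (y - x))) \<zeta> = iexp (x \<bullet> \<zeta>) *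
    of_real (pi powr (- (real CARD('d) / 4)) * (sqrt (2 * pi) ^ CARD('d) * exp (- (norm \<zeta>)\<^sup>2 / 2)))"
proof -
  let ?f = "\<lambda>y. complex_of_real (gauss_window (y - x)) * iexp (y \<bullet> \<zeta>)"
  have "fourier (\<lambda>y. of_real (gauss_window (y - x))) \<zeta> = (\<integral>y. ?f (x + y) \<partial>lborel)"
    unfolding fourier_def by (rule integral_lborel_translate[symmetric]) measurable
  also have "?f (x + y) = (iexp (x \<bullet> \<zeta>) * of_real (pi powr (- (real CARD('d) / 4)))) *
      (of_real (gaussian (1 / 2) y) * iexp (y \<bullet> \<zeta>))" for y
    unfolding gauss_window_eq by (simp add: inner_add_left ring_distribs exp_add mult_ac)
  then have "(\<integral>y. ?f (x + y) \<partial>lborel) = (iexp (x \<bullet> \<zeta>) * of_real (pi powr (- (real CARD('d) / 4)))) *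
      (\<integral>y. of_real (gaussian (1 / 2) y) * iexp (y \<bullet> \<zeta>) \<partial>lborel)"
    by (simp only: integral_mult_right_zero)
  also have "\<dots> = (iexp (x \<bullet> \<zeta>) * of_real (pi powr (- (real CARD('d) / 4)))) *
      of_real (sqrt (2 * pi) ^ CARD('d) * exp (- (norm \<zeta>)\<^sup>2 / 2))"
    using fourier_gaussian[of 1 \<zeta>] by simp
  finally show ?thesis by (simp add: mult.assoc)
qed

lemma fst_snd_measurable [measurable]:
  "(fst :: 'a::euclidean_space \<times> 'b::euclidean_space \<Rightarrow> 'a) \<in> borel_measurable borel"
  "(snd :: 'a::euclidean_space \<times> 'b::euclidean_space \<Rightarrow> 'b) \<in> borel_measurable borel"
  by (auto intro!: borel_measurable_continuous_onI continuous_intros)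

lemma stft_pair_measurable:
  assumes f: "f \<in> borel_measurable borel"
  shows "stft_pair f \<in> borel_measurable borel"
proof -
  note [measurable] = f
  have "(\<lambda>X. \<integral>y. f y * of_real (gauss_window (y - fst X)) * iexp (y \<bullet> snd X) \<partial>lborel) \<in> borel_measurable borel"
  proof (rule lborel.borel_measurable_lebesgue_integral)
    show "(\<lambda>(X, y). f y * of_real (gauss_window (y - fst X)) * iexp (y \<bullet> snd X)) \<in> borel_measurable (borel \<Otimes>\<^sub>M lborel)"
      unfolding split_def by measurable
  qed
  then show ?thesis by (simp add: stft_pair_def[abs_def] fourier_def)
qed

text \<open>Decay in \<open>x\<close> comes from the decay of \<open>f\<close>; decay in \<open>\<xi>\<close> from that of its Fourier transform,
  because the Fourier transform turns \<open>f y * gauss_window (y - x)\<close> into a convolution with a Gaussian.\<close>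

lemma stft_pair_decay:
  assumes h: "0 < h"
  shows "\<exists>C\<ge>0. \<exists>r>0. \<forall>f\<in>GS_step (1/2) h. \<forall>X::'d::finite phase.
    norm (stft_pair f X) \<le> C * enn2real (GS_norm (1/2) h f) * gaussian r X"
proof -
  obtain C where C: "C \<ge> 0" and
    Cf: "\<And>f y::real^'d. f \<in> GS_step (1/2) h \<Longrightarrow> norm (f y) \<le> C * enn2real (GS_norm (1/2) h f) * gaussian (1 / (4 * h\<^sup>2)) y" and
    Cg: "\<And>f y::real^'d. f \<in> GS_step (1/2) h \<Longrightarrow> norm (fourier f y) \<le> C * enn2real (GS_norm (1/2) h f) * gaussian (1 / (4 * h\<^sup>2)) y"
    using GS_fourier_decay[OF h, where 'd = 'd] by blast
  define a where "a = 1 / (4 * h\<^sup>2)"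
  have a: "a > 0" using h by (simp add: a_def)
  note Cf = Cf[folded a_def] and Cg = Cg[folded a_def]
  obtain D where D: "D \<ge> 0" and
    int: "\<And>x::real^'d. integrable lborel (\<lambda>y. gaussian a y * gaussian (1/2) (x - y))" and
    DD: "\<And>x::real^'d. (\<integral>y. gaussian a y * gaussian (1/2) (x - y) \<partial>lborel) \<le> D * gaussian (min a (1/2) / 4) x"
    using gaussian_convolution_le[OF a, where 'd = 'd] by blast
  define m where "m = min a (1/2) / 4"
  have m: "m > 0" using a by (simp add: m_def)
  define p where "p = pi powr (- (real CARD('d) / 4))"
  have p: "p > 0" by (simp add: p_def)
  define q where "q = (2 * pi) powr (- real CARD('d)) * sqrt (2 * pi) ^ CARD('d)"
  have q: "q > 0" by (simp add: q_def)
  \<comment> \<open>One constant for both partial bounds: 1 belongs to the decay in x, q to the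
    decay in \<xi>.\<close>
  define E where "E = C * D * p * max 1 q"
  have E: "E \<ge> 0" using C D p q by (simp add: E_def)
  have "norm (stft_pair f (x, \<xi>)) \<le> E * enn2real (GS_norm (1/2) h f) * gaussian (m/2) (x, \<xi>)"
    if f: "f \<in> GS_step (1/2) h" for f and x \<xi> :: "real^'d"
  proof -
    let ?N = "enn2real (GS_norm (1/2) h f)"
    have sm: "smooth f" by (rule GS_stepD(1)[OF f h])
    note [measurable] = smooth_borel_measurable[OF sm] fourier_borel_measurable[OF smooth_borel_measurable[OF sm]]
    have gw: "gauss_window (y - x) = p * gaussian (1/2) (x - y)" for y
      by (simp add: gauss_window_eq p_def norm_minus_commute)
    have b1: "norm (f y * of_real (gauss_window (y - x)) * iexp (y \<bullet> \<xi>)) \<le> (C * ?N * p) * (gaussian a y * gaussian (1/2) (x - y))" for y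
    proof -
      have "norm (f y * of_real (gauss_window (y - x)) * iexp (y \<bullet> \<xi>)) = norm (f y) * gauss_window (y - x)"
        by (simp add: norm_mult gauss_window_nonneg)
      also have "\<dots> \<le> (C * ?N * gaussian a y) * gauss_window (y - x)"
        by (intro mult_right_mono Cf f gauss_window_nonneg)
      finally show ?thesis by (simp add: gw mult_ac)
    qed
    have i1: "integrable lborel (\<lambda>y. f y * of_real (gauss_window (y - x)) * iexp (y \<bullet> \<xi>))"
      by (rule Bochner_Integration.integrable_bound[OF integrable_mult_right[OF int, of "C * ?N * p" x]])
        (auto intro!: AE_I2 order_trans[OF b1])
    have "norm (stft_pair f (x, \<xi>)) \<le> (\<integral>y. (C * ?N * p) * (gaussian a y * gaussian (1/2) (x - y)) \<partial>lborel)"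
      unfolding stft_pair_def fourier_def fst_conv snd_conv
      by (intro Bochner_Integration.integral_norm_bound_integral i1 integrable_mult_right int b1)
    also have "\<dots> \<le> (C * ?N * p) * (D * gaussian m x)"
      unfolding integral_mult_right_zero using C p DD[of x] by (intro mult_left_mono) (auto simp: m_def)
    also have "\<dots> = (C * D * p * 1) * (?N * gaussian m x)" by (simp add: mult_ac)
    also have "\<dots> \<le> E * (?N * gaussian m x)"
      unfolding E_def using C D p by (intro mult_right_mono mult_left_mono) auto
    finally have bx: "norm (stft_pair f (x, \<xi>)) \<le> E * ?N * gaussian m x" by (simp add: mult.assoc)

    let ?c = "complex_of_real ((2 * pi) powr (- real CARD('d)))"
    let ?F = "\<lambda>\<eta> y. fourier f \<eta> * (exp (- (\<i> * of_real (y \<bullet> \<eta>))) * (of_real (gauss_window (y - x)) * iexp (y \<bullet> \<xi>)))"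
    have inv: "f y = ?c * (\<integral>\<eta>. fourier f \<eta> * exp (- (\<i> * of_real (y \<bullet> \<eta>))) \<partial>lborel)" for y
      by (rule fourier_inversion[OF smooth_continuous[OF sm] a Cf[OF f] a Cg[OF f]])
    \<comment> \<open>For fixed x only; it serves as the integrable majorant for Fubini, so the
      growing factor in x does no harm.\<close>
    have gle: "gaussian (1/2) (x - y) \<le> exp ((norm x)\<^sup>2 / 2) * gaussian (1/4) y" for y
      using norm_diff_power2_ge[of y "- x"] by (simp add: exp_add[symmetric] norm_minus_commute)
    have intF: "integrable (lborel \<Otimes>\<^sub>M lborel) (\<lambda>(\<eta>, y). ?F \<eta> y)"
    proof (rule Bochner_Integration.integrable_bound)
      let ?K = "C * ?N * p * exp ((norm x)\<^sup>2 / 2)"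
      let ?B = "\<lambda>X. ?K * (\<lambda>(\<eta>::real^'d, y::real^'d). exp (- a * (norm \<eta>)\<^sup>2) * gaussian (1/4) y) X"
      show "integrable (lborel \<Otimes>\<^sub>M lborel) ?B"
        unfolding lborel_prod using a by (intro integrable_mult_right integrable_gaussian_pair) auto
      show "AE X in lborel \<Otimes>\<^sub>M lborel. norm ((\<lambda>(\<eta>, y). ?F \<eta> y) X) \<le> norm (?B X)"
      proof (rule AE_I2)
        fix X :: "'d phase"
        obtain \<eta> y where X: "X = (\<eta>, y)" by (cases X)
        have "norm (?F \<eta> y) = norm (fourier f \<eta>) * gauss_window (y - x)"
          by (simp add: norm_mult gauss_window_nonneg)
        also have "\<dots> \<le> (C * ?N * exp (- a * (norm \<eta>)\<^sup>2)) * (p * (exp ((norm x)\<^sup>2 / 2) * gaussian (1/4) y))"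
          unfolding gw using C p by (intro mult_mono Cg f mult_left_mono gle) auto
        also have "\<dots> = ?B (\<eta>, y)" by (simp add: mult_ac)
        finally show "norm ((\<lambda>(\<eta>, y). ?F \<eta> y) X) \<le> norm (?B X)"
          unfolding X prod.case real_norm_def by (rule order_trans) (rule abs_ge_self)
      qed
    qed measurable
    have "stft_pair f (x, \<xi>) = (\<integral>y. ?c * (\<integral>\<eta>. ?F \<eta> y \<partial>lborel) \<partial>lborel)"
    proof -
      have "f y * of_real (gauss_window (y - x)) * iexp (y \<bullet> \<xi>) = ?c * (\<integral>\<eta>. ?F \<eta> y \<partial>lborel)" for y
      proof -
        have "(\<integral>\<eta>. ?F \<eta> y \<partial>lborel) = (\<integral>\<eta>. (fourier f \<eta> * exp (- (\<i> * of_real (y \<bullet> \<eta>)))) * (of_real (gauss_window (y - x)) * iexp (y \<bullet> \<xi>)) \<partial>lborel)"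
          by (simp only: mult.assoc)
        also have "\<dots> = (\<integral>\<eta>. fourier f \<eta> * exp (- (\<i> * of_real (y \<bullet> \<eta>))) \<partial>lborel) * (of_real (gauss_window (y - x)) * iexp (y \<bullet> \<xi>))"
          by (rule integral_mult_left_zero)
        finally show ?thesis by (subst inv) (simp only: mult.assoc)
      qed
      then show ?thesis unfolding stft_pair_def fourier_def fst_conv snd_conv by (simp only:)
    qed
    also have "\<dots> = ?c * (\<integral>y. (\<integral>\<eta>. ?F \<eta> y \<partial>lborel) \<partial>lborel)" by (rule integral_mult_right_zero)
    also have "(\<integral>y. (\<integral>\<eta>. ?F \<eta> y \<partial>lborel) \<partial>lborel) = (\<integral>\<eta>. (\<integral>y. ?F \<eta> y \<partial>lborel) \<partial>lborel)"
      by (rule lborel_pair.Fubini_integral[OF intF])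
    finally have st: "stft_pair f (x, \<xi>) = ?c * (\<integral>\<eta>. (\<integral>y. ?F \<eta> y \<partial>lborel) \<partial>lborel)" .
    have inner: "(\<integral>y. ?F \<eta> y \<partial>lborel) = fourier f \<eta> * fourier (\<lambda>y. of_real (gauss_window (y - x))) (\<xi> - \<eta>)" for \<eta>
    proof -
      have "?F \<eta> y = fourier f \<eta> * (of_real (gauss_window (y - x)) * iexp (y \<bullet> (\<xi> - \<eta>)))" for y
        by (simp add: inner_diff_right right_diff_distrib exp_diff exp_minus divide_simps)
      then show ?thesis unfolding fourier_def[of "\<lambda>y. of_real (gauss_window (y - x))"] by (simp only: integral_mult_right_zero)
    qed
    have inner_le: "norm (\<integral>y. ?F \<eta> y \<partial>lborel) \<le> (C * ?N * p * sqrt (2 * pi) ^ CARD('d)) * (exp (- a * (norm \<eta>)\<^sup>2) * gaussian (1/2) (\<xi> - \<eta>))" for \<eta>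
    proof -
      have "norm (\<integral>y. ?F \<eta> y \<partial>lborel) = norm (fourier f \<eta>) * (p * (sqrt (2 * pi) ^ CARD('d) * gaussian (1/2) (\<xi> - \<eta>)))"
        unfolding inner fourier_gauss_window norm_mult p_def[symmetric] norm_of_real using p by (simp add: abs_mult)
      also have "\<dots> \<le> (C * ?N * exp (- a * (norm \<eta>)\<^sup>2)) * (p * (sqrt (2 * pi) ^ CARD('d) * gaussian (1/2) (\<xi> - \<eta>)))"
        using p by (intro mult_right_mono Cg f) auto
      finally show ?thesis by (simp add: mult_ac)
    qed
    have i2: "integrable lborel (\<lambda>\<eta>. \<integral>y. ?F \<eta> y \<partial>lborel)"
      by (rule lborel_pair.integrable_fst[OF intF])
    have "norm (stft_pair f (x, \<xi>)) \<le> (2 * pi) powr (- real CARD('d)) *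
      (\<integral>\<eta>. (C * ?N * p * sqrt (2 * pi) ^ CARD('d)) * (exp (- a * (norm \<eta>)\<^sup>2) * gaussian (1/2) (\<xi> - \<eta>)) \<partial>lborel)"
      unfolding st norm_mult norm_of_real
      by (intro mult_mono Bochner_Integration.integral_norm_bound_integral i2 integrable_mult_right int inner_le) auto
    also have "\<dots> \<le> (2 * pi) powr (- real CARD('d)) * ((C * ?N * p * sqrt (2 * pi) ^ CARD('d)) * (D * exp (- m * (norm \<xi>)\<^sup>2)))"
      unfolding integral_mult_right_zero using C p DD[of \<xi>] by (intro mult_left_mono) (auto simp: m_def)
    also have "\<dots> = (C * D * p * q) * (?N * exp (- m * (norm \<xi>)\<^sup>2))" by (simp add: q_def mult_ac)
    also have "\<dots> \<le> E * (?N * exp (- m * (norm \<xi>)\<^sup>2))"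
      unfolding E_def using C D p by (intro mult_right_mono mult_left_mono) auto
    finally have b\<xi>: "norm (stft_pair f (x, \<xi>)) \<le> E * ?N * exp (- m * (norm \<xi>)\<^sup>2)" by (simp add: mult.assoc)
    have EN: "0 \<le> E * ?N" using E by simp
    \<comment> \<open>Decay in x alone times decay in \<xi> alone bounds the square; taking the root
      gives joint decay at half the rate.\<close>
    have "(norm (stft_pair f (x, \<xi>)))\<^sup>2 \<le> (E * ?N * gaussian m x) * (E * ?N * exp (- m * (norm \<xi>)\<^sup>2))"
      by (subst power2_eq_square, intro mult_mono bx b\<xi>) (use EN in auto)
    also have "\<dots> = (E * ?N * gaussian (m/2) (x, \<xi>))\<^sup>2"
    proof -
      have "(gaussian (m/2) (x, \<xi>))\<^sup>2 = gaussian m (x, \<xi>)"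
        by (simp add: exp_double[symmetric])
      then show ?thesis unfolding power_mult_distrib exp_norm_Pair by (simp add: power2_eq_square mult_ac)
    qed
    finally show ?thesis by (rule power2_le_imp_le) (use EN in auto)
  qed
  then show ?thesis using E m by (intro exI[of _ E] conjI exI[of _ "m/2"]) auto
qed

lemma gauss_window_square_integral: "(\<integral>x. (gauss_window (y - x))\<^sup>2 \<partial>(lborel :: (real^'d::finite) measure)) = 1"
proof -
  have eq: "(gauss_window (y - x))\<^sup>2 = (pi powr (- (real CARD('d) / 4)))\<^sup>2 * gaussian 1 (- y + x)" for x :: "real^'d"
    unfolding gauss_window_eq power_mult_distrib
    by (simp add: exp_double[symmetric] norm_minus_commute)
  have "(\<integral>x. (gauss_window (y - x))\<^sup>2 \<partial>(lborel :: (real^'d) measure)) =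
    (pi powr (- (real CARD('d) / 4)))\<^sup>2 * (\<integral>x. gaussian 1 (- y + x) \<partial>(lborel :: (real^'d) measure))"
    unfolding eq by (rule integral_mult_right_zero)
  also have "(\<integral>x. gaussian 1 (- y + x) \<partial>(lborel :: (real^'d) measure)) = (\<integral>x. gaussian 1 x \<partial>(lborel :: (real^'d) measure))"
    by (rule integral_lborel_translate) measurable
  also have "\<dots> = sqrt (pi / 1) ^ CARD('d)" by (rule integral_gaussian) simp
  also have "(pi powr (- (real CARD('d) / 4)))\<^sup>2 = pi powr (- (real CARD('d) / 2))"
    by (simp add: power2_eq_square powr_add[symmetric])
  also have "sqrt (pi / 1) ^ CARD('d) = pi powr (real CARD('d) / 2)"
    by (simp add: powr_half_sqrt[symmetric] powr_realpow[symmetric] powr_powr)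
  finally show ?thesis by (simp add: powr_add[symmetric])
qed

text \<open>Fourier inversion in \<xi> recovers f y times the window at y - x. A second factor of
  the window, integrated over x, contributes its squared L^2 norm, which is 1.\<close>

lemma stft_inversion:
  fixes f :: "real^'d::finite \<Rightarrow> complex"
  assumes h: "0 < h" and f: "f \<in> GS_step (1/2) h"
  shows "f y = of_real ((2 * pi) powr (- real CARD('d))) * (\<integral>X. stft_pair f X * gabor_atom X y \<partial>lborel)"
    and "integrable lborel (\<lambda>X. stft_pair f X * gabor_atom X y)"
proof -
  let ?N = "enn2real (GS_norm (1/2) h f)"
  let ?c = "complex_of_real ((2 * pi) powr (- real CARD('d)))"
  obtain C r where C: "C \<ge> 0" and r: "r > 0" and
    st: "\<And>X::'d phase. norm (stft_pair f X) \<le> C * ?N * gaussian r X"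
    using stft_pair_decay[OF h, where 'd = 'd] f by blast
  obtain C' where Cf: "\<And>y. norm (f y) \<le> C' * ?N * gaussian (1 / (4 * h\<^sup>2)) y"
    using GS_fourier_decay[OF h, where 'd = 'd] f by blast
  have a: "0 < 1 / (4 * h\<^sup>2)" using h by simp
  have sm: "smooth f" by (rule GS_stepD(1)[OF f h])
  note [measurable] = stft_pair_measurable[OF smooth_borel_measurable[OF sm]]
  define p where "p = pi powr (- (real CARD('d) / 4))"
  have p: "p > 0" by (simp add: p_def)
  have gwp: "gauss_window x \<le> p" for x :: "real^'d"
    using p by (simp add: gauss_window_eq p_def mult_left_le)
  have gm: "(\<lambda>X. stft_pair f X * gabor_atom X y) \<in> borel_measurable borel" for y
    unfolding gabor_atom_def by measurable
  have int: "integrable lborel (\<lambda>X. stft_pair f X * gabor_atom X y)" for y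
  proof (rule Bochner_Integration.integrable_bound)
    let ?B = "\<lambda>X. (C * ?N * p) * (\<lambda>(x::real^'d, \<xi>::real^'d). gaussian r x * exp (- r * (norm \<xi>)\<^sup>2)) X"
    show "integrable lborel ?B" using r by (intro integrable_mult_right integrable_gaussian_pair) auto
    show "AE X in lborel. norm (stft_pair f X * gabor_atom X y) \<le> norm (?B X)"
    proof (rule AE_I2)
      fix X :: "'d phase"
      obtain x \<xi> where X: "X = (x, \<xi>)" by (cases X)
      have "norm (stft_pair f (x, \<xi>) * gabor_atom (x, \<xi>) y) = norm (stft_pair f (x, \<xi>)) * gauss_window (y - x)"
        by (simp add: gabor_atom_def norm_mult gauss_window_nonneg)
      also have "\<dots> \<le> (C * ?N * gaussian r (x, \<xi>)) * p"
        using C by (intro mult_mono st gwp gauss_window_nonneg) auto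
      also have "\<dots> = ?B (x, \<xi>)" unfolding exp_norm_Pair by (simp add: mult_ac)
      finally show "norm (stft_pair f X * gabor_atom X y) \<le> norm (?B X)"
        unfolding X prod.case real_norm_def by (rule order_trans) (rule abs_ge_self)
    qed
  qed (use gm in simp)
  show "integrable lborel (\<lambda>X. stft_pair f X * gabor_atom X y)" by (rule int)
  have inner: "f y * of_real (gauss_window (y - x)) = ?c * (\<integral>\<xi>. stft_pair f (x, \<xi>) * exp (- (\<i> * of_real (y \<bullet> \<xi>))) \<partial>lborel)" for x
  proof -
    let ?g = "\<lambda>y. f y * of_real (gauss_window (y - x))"
    have "continuous_on UNIV ?g" using smooth_continuous[OF sm] by (intro continuous_intros)
    moreover have "norm (?g y) \<le> (C' * ?N * p) * gaussian (1 / (4 * h\<^sup>2)) y" for y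
    proof -
      have "norm (?g y) = norm (f y) * gauss_window (y - x)" by (simp add: norm_mult gauss_window_nonneg)
      also have "\<dots> \<le> (C' * ?N * gaussian (1 / (4 * h\<^sup>2)) y) * p"
        by (intro mult_mono Cf gwp gauss_window_nonneg order_trans[OF norm_ge_zero Cf])
      finally show ?thesis by (simp add: mult_ac)
    qed
    moreover have "norm (fourier ?g \<xi>) \<le> (C * ?N) * exp (- r * (norm \<xi>)\<^sup>2)" for \<xi>
    proof -
      have "norm (fourier ?g \<xi>) \<le> C * ?N * gaussian r (x, \<xi>)"
        using st[of "(x, \<xi>)"] by (simp add: stft_pair_def)
      also have "\<dots> \<le> (C * ?N) * exp (- r * (norm \<xi>)\<^sup>2)"
        using C r unfolding norm_Pair_power2 by (intro mult_left_mono) auto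
      finally show ?thesis .
    qed
    ultimately have "?g y = ?c * (\<integral>\<xi>. fourier ?g \<xi> * exp (- (\<i> * of_real (y \<bullet> \<xi>))) \<partial>lborel)" for y
      using fourier_inversion[of ?g "1 / (4 * h\<^sup>2)" "C' * ?N * p" r "C * ?N"] a r by blast
    from this[of y] show ?thesis unfolding stft_pair_def fst_conv snd_conv .
  qed
  have "f y = (\<integral>x. f y * of_real ((gauss_window (y - x))\<^sup>2) \<partial>lborel)"
    by (simp only: integral_mult_right_zero integral_complex_of_real gauss_window_square_integral) simp
  also have "\<dots> = (\<integral>x. ?c * (\<integral>\<xi>. stft_pair f (x, \<xi>) * gabor_atom (x, \<xi>) y \<partial>lborel) \<partial>lborel)"
  proof (rule Bochner_Integration.integral_cong[OF refl])
    fix x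
    have "f y * of_real ((gauss_window (y - x))\<^sup>2) = (f y * of_real (gauss_window (y - x))) * of_real (gauss_window (y - x))"
      by (simp add: power2_eq_square)
    also have "\<dots> = ?c * ((\<integral>\<xi>. stft_pair f (x, \<xi>) * exp (- (\<i> * of_real (y \<bullet> \<xi>))) \<partial>lborel) * of_real (gauss_window (y - x)))"
      by (simp only: inner mult.assoc)
    also have "(\<integral>\<xi>. stft_pair f (x, \<xi>) * exp (- (\<i> * of_real (y \<bullet> \<xi>))) \<partial>lborel) * of_real (gauss_window (y - x)) =
      (\<integral>\<xi>. stft_pair f (x, \<xi>) * exp (- (\<i> * of_real (y \<bullet> \<xi>))) * of_real (gauss_window (y - x)) \<partial>lborel)"
      by (rule integral_mult_left_zero[symmetric])
    also have "\<dots> = (\<integral>\<xi>. stft_pair f (x, \<xi>) * gabor_atom (x, \<xi>) y \<partial>lborel)"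
      by (simp add: gabor_atom_def mult_ac)
    finally show "f y * of_real ((gauss_window (y - x))\<^sup>2) = ?c * (\<integral>\<xi>. stft_pair f (x, \<xi>) * gabor_atom (x, \<xi>) y \<partial>lborel)" .
  qed
  also have "\<dots> = ?c * (\<integral>x. (\<integral>\<xi>. stft_pair f (x, \<xi>) * gabor_atom (x, \<xi>) y \<partial>lborel) \<partial>lborel)"
    by (rule integral_mult_right_zero)
  also have "(\<integral>x. (\<integral>\<xi>. stft_pair f (x, \<xi>) * gabor_atom (x, \<xi>) y \<partial>lborel) \<partial>lborel) = (\<integral>X. stft_pair f X * gabor_atom X y \<partial>lborel)"
    using lborel_pair.integral_fst'[of "\<lambda>X. stft_pair f X * gabor_atom X y"] int[of y] by (simp add: lborel_prod)
  finally show "f y = ?c * (\<integral>X. stft_pair f X * gabor_atom X y \<partial>lborel)" .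
qed

section \<open>Injectivity of the Bargmann transform\<close>

text \<open>The point at which \<open>to_phase_space\<close> evaluates its argument. The sign of
  \<xi> makes it a conjugate coordinate, and squared norms are halved.\<close>

definition phase_to_complex :: "'d::finite phase \<Rightarrow> complex^'d" where
  "phase_to_complex X = (\<chi> j. complex_of_real (fst X $ j / sqrt 2) - \<i> * complex_of_real (snd X $ j / sqrt 2))"

text \<open>The prefactor in \<open>to_phase_space\<close> without the power of 2 pi. With z =
  \<open>phase_to_complex X\<close> its modulus is exp (- |z|^2 / 2), the reciprocal of the critical
  growth of the kernels.\<close>

definition phase_factor :: "'d::finite phase \<Rightarrow> complex" where
  "phase_factor X = of_real (exp (- (((norm (fst X))\<^sup>2 + (norm (snd X))\<^sup>2) / 4))) * exp (- (\<i> * of_real (fst X \<bullet> snd X) / 2))"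

lemma cbilin_phase_to_complex:
  "cbilin (phase_to_complex X) (phase_to_complex X) = of_real (((norm (fst X))\<^sup>2 - (norm (snd X))\<^sup>2) / 2) - \<i> * of_real (fst X \<bullet> snd X)"
  "of_real (sqrt 2) * cbilin (phase_to_complex X) (\<chi> j. of_real (y $ j)) = of_real (y \<bullet> fst X) - \<i> * of_real (y \<bullet> snd X)"
proof -
  have s: "complex_of_real (sqrt 2) * complex_of_real (sqrt 2) = 2"
    by (simp flip: of_real_mult)
  have "cbilin (phase_to_complex X) (phase_to_complex X) =
    (\<Sum>j\<in>UNIV. of_real (((fst X $ j)\<^sup>2 - (snd X $ j)\<^sup>2) / 2) - \<i> * of_real (fst X $ j * snd X $ j))"
    unfolding cbilin_def phase_to_complex_def
    by (intro sum.cong refl) (simp add: s power2_eq_square algebra_simps diff_divide_distrib add_divide_distrib)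
  then show "cbilin (phase_to_complex X) (phase_to_complex X) = of_real (((norm (fst X))\<^sup>2 - (norm (snd X))\<^sup>2) / 2) - \<i> * of_real (fst X \<bullet> snd X)"
    unfolding norm_vec_power2
    by (simp add: sum_subtractf sum_distrib_left[symmetric] sum_divide_distrib[symmetric] inner_vec_def)
  have "of_real (sqrt 2) * cbilin (phase_to_complex X) (\<chi> j. of_real (y $ j)) =
     (\<Sum>j\<in>UNIV. of_real (y $ j * fst X $ j) - \<i> * of_real (y $ j * snd X $ j))"
    unfolding cbilin_def phase_to_complex_def sum_distrib_left
    by (intro sum.cong refl) (simp add: algebra_simps)
  then show "of_real (sqrt 2) * cbilin (phase_to_complex X) (\<chi> j. of_real (y $ j)) = of_real (y \<bullet> fst X) - \<i> * of_real (y \<bullet> snd X)"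
    by (simp add: sum_subtractf sum_distrib_left[symmetric] inner_vec_def)
qed

text \<open>In the exponent, the phase factor and the z-z term of the kernel add up to - |x|^2 / 2:
  the terms |\<xi>|^2 and x \<bullet> \<xi> cancel. This completes the square with - |y|^2 / 2 + y
  \<bullet> x.\<close>

lemma gabor_atom_eq: "gabor_atom X = (\<lambda>y. phase_factor X * bargmann_kernel (phase_to_complex X) y)"
proof
  fix y
  have n: "(norm (y - fst X))\<^sup>2 = (norm y)\<^sup>2 - 2 * (y \<bullet> fst X) + (norm (fst X))\<^sup>2"
    by (simp add: power2_norm_eq_inner inner_simps inner_commute)
  have "of_real (- (((norm (fst X))\<^sup>2 + (norm (snd X))\<^sup>2) / 4)) + - (\<i> * of_real (fst X \<bullet> snd X) / 2) +
     (- (1/2) * (cbilin (phase_to_complex X) (phase_to_complex X) + complex_of_real ((norm y)\<^sup>2)) +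
       complex_of_real (sqrt 2) * cbilin (phase_to_complex X) (\<chi> j. complex_of_real (y $ j)))
     = of_real (- ((norm (y - fst X))\<^sup>2 / 2)) + - (\<i> * of_real (y \<bullet> snd X))"
    unfolding cbilin_phase_to_complex n by (simp add: field_simps)
  from arg_cong[OF this, of exp]
  have "of_real (exp (- (((norm (fst X))\<^sup>2 + (norm (snd X))\<^sup>2) / 4))) * exp (- (\<i> * of_real (fst X \<bullet> snd X) / 2)) *
     exp (- (1/2) * (cbilin (phase_to_complex X) (phase_to_complex X) + complex_of_real ((norm y)\<^sup>2)) +
       complex_of_real (sqrt 2) * cbilin (phase_to_complex X) (\<chi> j. complex_of_real (y $ j)))
     = of_real (exp (- ((norm (y - fst X))\<^sup>2 / 2))) * exp (- (\<i> * of_real (y \<bullet> snd X)))"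
    by (simp only: exp_add exp_of_real)
  then show "gabor_atom X y = phase_factor X * bargmann_kernel (phase_to_complex X) y"
    unfolding gabor_atom_def phase_factor_def bargmann_kernel_def gauss_window_def of_real_mult
    by (simp only: mult.assoc mult.left_commute)
qed

lemma STFT_eq_to_phase_space:
  assumes u: "u \<in> GS_dual (1/2)"
  shows "STFT u X = to_phase_space (bargmann u) X"
proof -
  obtain x \<xi> where X: "X = (x, \<xi>)" by (cases X)
  have "STFT u X = of_real ((2 * pi) powr (- (real CARD('a) / 2))) * u (gabor_atom X)"
    by (simp add: STFT_def gabor_atom_def X)
  also have "u (gabor_atom X) = phase_factor X * bargmann u (phase_to_complex X)"
    unfolding gabor_atom_eq bargmann_def by (rule GS_dual_linear(2)[OF u bargmann_kernel_GS])
  finally show ?thesis by (simp add: to_phase_space_def phase_factor_def phase_to_complex_def X)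
qed

lemma norm_phase_to_complex: "(norm (phase_to_complex X))\<^sup>2 = (norm X)\<^sup>2 / 2"
proof -
  have "(norm (phase_to_complex X))\<^sup>2 = (\<Sum>j\<in>UNIV. ((fst X $ j)\<^sup>2 + (snd X $ j)\<^sup>2) / 2)"
    unfolding norm_vec_power2 by (intro sum.cong refl) (simp add: phase_to_complex_def cmod_power2 power_divide add_divide_distrib)
  also have "\<dots> = ((norm (fst X))\<^sup>2 + (norm (snd X))\<^sup>2) / 2"
    unfolding norm_vec_power2 by (simp add: sum.distrib sum_divide_distrib[symmetric])
  also have "\<dots> = (norm X)\<^sup>2 / 2" by (cases X) (simp add: norm_Pair_power2)
  finally show ?thesis .
qed

lemma norm_phase_factor: "norm (phase_factor X) = gaussian (1/4) X"
  by (cases X) (simp add: phase_factor_def norm_mult norm_Pair_power2)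

lemma phase_continuous:
  "continuous_on UNIV phase_to_complex" "continuous_on UNIV phase_factor"
  unfolding phase_to_complex_def phase_factor_def by (intro continuous_intros; simp)+

lemma bargmann_kernel_continuous: "continuous_on UNIV (\<lambda>z. bargmann_kernel z y)"
  unfolding bargmann_kernel_def cbilin_def by (intro continuous_intros)

text \<open>The shift by 1, caused by Cauchy estimates on unit discs, costs an arbitrarily small
  increase of the rate and a constant.\<close>

lemma square_plus_one_le:
  fixes t :: real
  assumes "0 < \<delta>" "\<delta> \<le> 1/2" "0 < \<eta>"
  shows "(1/2 + \<delta>) * (t + 1)\<^sup>2 \<le> (1/2 + \<delta> + \<eta>) * t\<^sup>2 + (1 + 1/\<eta>)"
proof -
  have "0 \<le> (sqrt \<eta> * t - 1 / sqrt \<eta>)\<^sup>2" by simp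
  also have "\<dots> = \<eta> * t\<^sup>2 + 1/\<eta> - 2 * t"
    using assms by (simp add: power2_diff power_mult_distrib power_divide)
  finally have "2 * t + 1 \<le> \<eta> * t\<^sup>2 + 1/\<eta> + 1" by simp
  then have "(1/2 + \<delta>) * (2 * t + 1) \<le> (1/2 + \<delta>) * (\<eta> * t\<^sup>2 + 1/\<eta> + 1)"
    using assms by (intro mult_left_mono) auto
  also have "\<dots> \<le> 1 * (\<eta> * t\<^sup>2 + 1/\<eta> + 1)" using assms by (intro mult_right_mono) auto
  finally show ?thesis by (simp add: power2_eq_square algebra_simps)
qed

text \<open>The inversion formula writes \<open>f\<close> as an integral of Bargmann kernels; replacing the kernels by
  those at the values of simple functions gives finite combinations converging to \<open>f\<close> in \<open>GS_norm\<close>.\<close>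

lemma GS_approximation:
  fixes f :: "real^'d::finite \<Rightarrow> complex"
  assumes h0: "0 < h0" and f: "f \<in> GS_step (1/2) h0"
  shows "\<exists>h>0. \<exists>fn e. (\<forall>n. \<exists>S c. finite S \<and> fn n = (\<lambda>y. \<Sum>z\<in>S. c z * bargmann_kernel z y)) \<and> e \<longlonglongrightarrow> (0::real) \<and>
    (\<forall>n x \<beta> is. \<bar>multi_power x \<beta>\<bar> * norm (iter_partial is (\<lambda>y. f y - fn n y) x) \<le> e n * GS_weight (1/2) h is \<beta>)"
proof -
  let ?N = "enn2real (GS_norm (1/2) h0 f)"
  let ?c = "complex_of_real ((2 * pi) powr (- real CARD('d)))"
  let ?z = "phase_to_complex :: 'd phase \<Rightarrow> complex^'d"
  obtain C r where C: "C \<ge> 0" and r: "r > 0" and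
    st: "\<And>X::'d phase. norm (stft_pair f X) \<le> C * ?N * gaussian r X"
    using stft_pair_decay[OF h0, where 'd = 'd] f by blast
  have sm: "smooth f" by (rule GS_stepD(1)[OF f h0])
  note [measurable] = stft_pair_measurable[OF smooth_borel_measurable[OF sm]]
    borel_measurable_continuous_onI[OF phase_continuous(1)] borel_measurable_continuous_onI[OF phase_continuous(2)]
    borel_measurable_continuous_onI[OF bargmann_kernel_continuous]
  \<comment> \<open>The excess growth \<delta> of the kernels has to stay below what the decay rate
    r of the short-time Fourier transform can pay for.\<close>
  define \<delta> where "\<delta> = min r (1/2)"
  have \<delta>: "0 < \<delta>" "\<delta> \<le> 1/2" "\<delta> \<le> r" using r by (auto simp: \<delta>_def)
  obtain h K where h: "h > 0" and K: "K > 0" and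
    bd: "\<And>(z::complex^'d) \<beta> is y. \<bar>multi_power y \<beta>\<bar> * norm (iter_partial is (bargmann_kernel z) y) \<le>
      K * exp ((1/2 + \<delta>) * (norm z)\<^sup>2) * GS_weight (1/2) h is \<beta>" and
    inc: "\<And>(z::complex^'d) z' \<beta> is y. norm z' \<le> norm z + 1 \<Longrightarrow> \<bar>multi_power y \<beta>\<bar> * norm (iter_partial is (bargmann_kernel z') y - iter_partial is (bargmann_kernel z) y) \<le>
      (4 * K * exp ((1/2 + \<delta>) * (norm z + 1)\<^sup>2) * norm (z' - z)) * GS_weight (1/2) h is \<beta>"
    using bargmann_kernel_increment[OF \<delta>(1,2), where 'd = 'd] by blast
  \<comment> \<open>Majorant of the seminorms of all kernels at points of norm at most |?z X| + 1:
    this covers \<open>?z X\<close> itself and the approximating points below.\<close>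
  define b where "b = (\<lambda>X. K * exp ((1/2 + \<delta>) * (norm (?z X) + 1)\<^sup>2))"
  have b0: "b X \<ge> 0" for X using K by (simp add: b_def)
  have [measurable]: "b \<in> borel_measurable borel" unfolding b_def by measurable
  define \<Phi> where "\<Phi> = (\<lambda>X. ?c * (stft_pair f X * phase_factor X))"
  have [measurable]: "\<Phi> \<in> borel_measurable borel" unfolding \<Phi>_def by measurable
  define K' where "K' = norm ?c * (C * ?N) * (K * exp (1 + 2 / r))"
  \<comment> \<open>The rates in |X|^2 are - r and - 1/4 from \<Phi>, and half of 1/2 + r + r/2 from
    b; they sum to - r/4.\<close>
  have \<Phi>b: "norm (\<Phi> X) * b X \<le> K' * gaussian (r/4) X" for X
  proof -
    have "(1/2 + \<delta>) * (norm (?z X) + 1)\<^sup>2 \<le> (1/2 + \<delta> + r/2) * (norm (?z X))\<^sup>2 + (1 + 1/(r/2))"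
      using r by (intro square_plus_one_le \<delta>) auto
    also have "\<dots> \<le> (1/2 + r + r/2) * (norm (?z X))\<^sup>2 + (1 + 2/r)"
      using \<delta> by (intro add_mono mult_right_mono) auto
    finally have "b X \<le> K * exp ((1/2 + r + r/2) * ((norm X)\<^sup>2 / 2) + (1 + 2/r))"
      using K by (simp add: b_def norm_phase_to_complex)
    moreover have "norm (\<Phi> X) \<le> norm ?c * (C * ?N * gaussian r X * gaussian (1/4) X)"
      unfolding \<Phi>_def norm_mult norm_phase_factor by (intro mult_left_mono mult_right_mono st) auto
    ultimately have "norm (\<Phi> X) * b X \<le> (norm ?c * (C * ?N * gaussian r X * gaussian (1/4) X)) *
      (K * exp ((1/2 + r + r/2) * ((norm X)\<^sup>2 / 2) + (1 + 2/r)))"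
      using b0 C by (intro mult_mono) auto
    also have "\<dots> = norm ?c * (C * ?N) * K * exp (- r * (norm X)\<^sup>2 + - (1/4) * (norm X)\<^sup>2 + ((1/2 + r + r/2) * ((norm X)\<^sup>2 / 2) + (1 + 2/r)))"
      by (simp only: exp_add mult_ac)
    also have "- r * (norm X)\<^sup>2 + - (1/4) * (norm X)\<^sup>2 + ((1/2 + r + r/2) * ((norm X)\<^sup>2 / 2) + (1 + 2/r)) = - (r/4) * (norm X)\<^sup>2 + (1 + 2/r)"
      by (simp add: field_simps)
    finally show ?thesis by (simp only: exp_add K'_def mult_ac)
  qed
  have intb: "integrable lborel (\<lambda>X. norm (\<Phi> X) * b X)"
  proof (rule Bochner_Integration.integrable_bound)
    show "integrable lborel (\<lambda>X. K' * (\<lambda>(x::real^'d, \<xi>::real^'d). gaussian (r/4) x * exp (- (r/4) * (norm \<xi>)\<^sup>2)) X)"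
      using r by (intro integrable_mult_right integrable_gaussian_pair) auto
    show "AE X in lborel. norm (norm (\<Phi> X) * b X) \<le> norm (K' * (\<lambda>(x::real^'d, \<xi>::real^'d). gaussian (r/4) x * exp (- (r/4) * (norm \<xi>)\<^sup>2)) X)"
    proof (rule AE_I2)
      fix X :: "'d phase"
      obtain x \<xi> where X: "X = (x, \<xi>)" by (cases X)
      have "norm (norm (\<Phi> X) * b X) = norm (\<Phi> X) * b X" using b0 by simp
      also note \<Phi>b[of X, unfolded X exp_norm_Pair, folded X]
      finally show "norm (norm (\<Phi> X) * b X) \<le> norm (K' * (\<lambda>(x::real^'d, \<xi>::real^'d). gaussian (r/4) x * exp (- (r/4) * (norm \<xi>)\<^sup>2)) X)"
        unfolding X prod.case real_norm_def[of "K' * _"] by (rule order_trans) (rule abs_ge_self)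
    qed
  qed measurable
  have int\<Phi>: "integrable lborel \<Phi>"
  proof (rule Bochner_Integration.integrable_bound[OF integrable_mult_right[OF intb, of "1/K"]])
    have "norm (\<Phi> X) \<le> norm (1/K * (norm (\<Phi> X) * b X))" for X
      using K \<delta> by (simp add: b_def abs_mult mult_le_cancel_left1)
    then show "AE X in lborel. norm (\<Phi> X) \<le> norm (1/K * (norm (\<Phi> X) * b X))" by simp
  qed measurable
  obtain s where s: "\<And>i. simple_function borel (s i)" and slim: "\<And>X. (\<lambda>i. s i X) \<longlonglongrightarrow> ?z X"
    using borel_measurable_implies_sequence_metric[OF borel_measurable_continuous_onI[OF phase_continuous(1)], of 0]
    by auto
  \<comment> \<open>Pointwise convergence does not keep the simple functions within |?z X| + 1.
    Resetting stray values to 0 enforces this bound, retains finite range, and changes nothing from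
    some index on at each X.\<close>
  define t where "t = (\<lambda>i X. if norm (s i X) \<le> norm (?z X) + 1 then s i X else 0)"
  have t: "simple_function borel (t i)" for i
  proof -
    have [measurable]: "s i \<in> borel_measurable borel" using s by (rule borel_measurable_simple_function)
    show ?thesis unfolding t_def by (rule simple_function_If) (use s in auto)
  qed
  have [measurable]: "t i \<in> borel_measurable borel" for i using t by (rule borel_measurable_simple_function)
  have tn: "norm (t i X) \<le> norm (?z X) + 1" for i X by (simp add: t_def)
  have tlim: "(\<lambda>i. t i X) \<longlonglongrightarrow> ?z X" for X
  proof (rule Lim_transform_eventually[OF slim])
    have "(\<lambda>i. norm (s i X)) \<longlonglongrightarrow> norm (?z X)" by (intro tendsto_norm slim)
    then have "\<forall>\<^sub>F i in sequentially. norm (s i X) < norm (?z X) + 1" by (rule order_tendstoD) simp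
    then show "\<forall>\<^sub>F i in sequentially. s i X = t i X" by eventually_elim (simp add: t_def)
  qed
  define fn where "fn = (\<lambda>i y. \<integral>X. \<Phi> X * bargmann_kernel (t i X) y \<partial>lborel)"
  have fin: "finite (range (t i))" for i using simple_functionD(1)[OF t] by simp
  have fn_sum: "fn i = (\<lambda>y. \<Sum>z\<in>range (t i). (\<integral>X. \<Phi> X * indicator (t i -` {z}) X \<partial>lborel) * bargmann_kernel z y)" for i
  proof
    fix y
    have m: "t i -` {z} \<in> sets borel" for z using simple_functionD(2)[OF t, of i "{z}"] by simp
    have "\<Phi> X * bargmann_kernel (t i X) y = (\<Sum>z\<in>range (t i). (\<Phi> X * indicator (t i -` {z}) X) * bargmann_kernel z y)" for X
    proof -
      have "(\<Sum>z\<in>range (t i). (\<Phi> X * indicator (t i -` {z}) X) * bargmann_kernel z y) =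
        (\<Sum>z\<in>range (t i). if z = t i X then \<Phi> X * bargmann_kernel z y else 0)"
        by (intro sum.cong refl) (auto simp: indicator_def)
      also have "\<dots> = \<Phi> X * bargmann_kernel (t i X) y" using fin by (simp add: sum.delta)
      finally show ?thesis ..
    qed
    moreover have "integrable lborel (\<lambda>X. \<Phi> X * indicator (t i -` {z}) X)" for z
      by (rule Bochner_Integration.integrable_bound[OF int\<Phi>]) (use m in \<open>auto simp: indicator_def\<close>)
    ultimately show "fn i y = (\<Sum>z\<in>range (t i). (\<integral>X. \<Phi> X * indicator (t i -` {z}) X \<partial>lborel) * bargmann_kernel z y)"
      unfolding fn_def by (simp add: integral_mult_left_zero)
  qed
  have fn_smooth: "smooth (fn i)" for i
    unfolding fn_sum by (intro smooth_sum fin smooth_cmult smooth_bargmann_kernel)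
  define N where "N = (\<lambda>i X y. bargmann_kernel (?z X) y - bargmann_kernel (t i X) y)"
  have Nsm: "smooth (N i X)" and Nit: "iter_partial is (N i X) y = iter_partial is (bargmann_kernel (?z X)) y - iter_partial is (bargmann_kernel (t i X)) y" for i X "is" y
    unfolding N_def by (simp_all add: smooth_diff smooth_bargmann_kernel)
  \<comment> \<open>The minimum keeps \<open>D i\<close> below 4 b where the approximating point is
    still far away, so the errors \<open>e i\<close> tend to 0 by dominated convergence.\<close>
  define D where "D = (\<lambda>i X. 4 * b X * min 1 (norm (t i X - ?z X)))"
  have [measurable]: "D i \<in> borel_measurable borel" for i unfolding D_def by measurable
  have kb: "\<bar>multi_power y \<beta>\<bar> * norm (iter_partial is (bargmann_kernel w) y) \<le> b X * GS_weight (1/2) h is \<beta>"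
    if "norm w \<le> norm (?z X) + 1" for w :: "complex^'d" and X y \<beta> "is"
  proof (rule order_trans[OF bd mult_right_mono])
    have "(norm w)\<^sup>2 \<le> (norm (?z X) + 1)\<^sup>2" using that by (intro power_mono) auto
    then show "K * exp ((1/2 + \<delta>) * (norm w)\<^sup>2) \<le> b X"
      unfolding b_def using \<delta> K by simp
    show "0 \<le> GS_weight (1/2) h is \<beta>" by (rule less_imp_le[OF GS_weight_pos[OF h]])
  qed
  have ND: "\<bar>multi_power y \<beta>\<bar> * norm (iter_partial is (N i X) y) \<le> D i X * GS_weight (1/2) h is \<beta>" for i X y \<beta> "is"
  proof (cases "norm (t i X - ?z X) \<le> 1")
    case True
    then have "D i X = 4 * K * exp ((1/2 + \<delta>) * (norm (?z X) + 1)\<^sup>2) * norm (t i X - ?z X)"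
      by (simp add: D_def b_def)
    then show ?thesis using inc[OF tn, of y \<beta> "is" i X] unfolding Nit by (simp add: norm_minus_commute)
  next
    case False
    have "\<bar>multi_power y \<beta>\<bar> * norm (iter_partial is (N i X) y) \<le>
      \<bar>multi_power y \<beta>\<bar> * norm (iter_partial is (bargmann_kernel (?z X)) y) + \<bar>multi_power y \<beta>\<bar> * norm (iter_partial is (bargmann_kernel (t i X)) y)"
      unfolding Nit distrib_left[symmetric] by (intro mult_left_mono norm_triangle_ineq4) auto
    also have "\<dots> \<le> b X * GS_weight (1/2) h is \<beta> + b X * GS_weight (1/2) h is \<beta>"
      by (intro add_mono kb tn) auto
    also have "\<dots> \<le> (4 * b X) * GS_weight (1/2) h is \<beta>"
      unfolding distrib_right[symmetric] using b0[of X] GS_weight_pos[OF h, of "is" \<beta> "1/2"] by (intro mult_right_mono) auto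
    finally show ?thesis using False by (simp add: D_def)
  qed
  have Db: "D i X \<le> 4 * b X" for i X using b0[of X] by (simp add: D_def mult_left_le)
  have D0: "0 \<le> D i X" for i X using b0[of X] by (simp add: D_def)
  define e where "e = (\<lambda>i. \<integral>X. norm (\<Phi> X) * D i X \<partial>lborel)"
  have intD: "integrable lborel (\<lambda>X. norm (\<Phi> X) * D i X)" for i
  proof (rule Bochner_Integration.integrable_bound[OF integrable_mult_right[OF intb, of 4]])
    have "norm (norm (\<Phi> X) * D i X) \<le> norm (4 * (norm (\<Phi> X) * b X))" for X
      using mult_left_mono[OF Db[of i X], of "norm (\<Phi> X)"] D0 b0 by (simp add: abs_mult)
    then show "AE X in lborel. norm (norm (\<Phi> X) * D i X) \<le> norm (4 * (norm (\<Phi> X) * b X))" by simp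
  qed measurable
  have "e \<longlonglongrightarrow> (\<integral>X. 0 \<partial>(lborel :: ('d phase) measure))"
    unfolding e_def
  proof (rule integral_dominated_convergence[OF _ _ integrable_mult_right[OF intb, of 4]])
    show "AE X in lborel. (\<lambda>i. norm (\<Phi> X) * D i X) \<longlonglongrightarrow> 0"
    proof (rule AE_I2)
      fix X
      have "(\<lambda>i. norm (\<Phi> X) * (4 * b X * min 1 (norm (t i X - ?z X)))) \<longlonglongrightarrow> norm (\<Phi> X) * (4 * b X * min 1 (norm (?z X - ?z X)))"
        by (intro tendsto_intros tlim)
      then show "(\<lambda>i. norm (\<Phi> X) * D i X) \<longlonglongrightarrow> 0" by (simp add: D_def)
    qed
    have "norm (norm (\<Phi> X) * D i X) \<le> 4 * (norm (\<Phi> X) * b X)" for X i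
      using mult_left_mono[OF Db[of i X], of "norm (\<Phi> X)"] D0 b0 by (simp add: abs_mult)
    then show "AE X in lborel. norm (norm (\<Phi> X) * D i X) \<le> 4 * (norm (\<Phi> X) * b X)" for i by simp
  qed measurable
  then have e0: "e \<longlonglongrightarrow> 0" by simp
  have final: "\<bar>multi_power x \<beta>\<bar> * norm (iter_partial is (\<lambda>y. f y - fn i y) x) \<le> e i * GS_weight (1/2) h is \<beta>" for i x \<beta> "is"
  proof -
    have fint: "f y = (\<integral>X. \<Phi> X * bargmann_kernel (?z X) y \<partial>lborel)" and
      fi: "integrable lborel (\<lambda>X. \<Phi> X * bargmann_kernel (?z X) y)" for y
    proof -
      have *: "\<Phi> X * bargmann_kernel (?z X) y = ?c * (stft_pair f X * gabor_atom X y)" for X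
        by (simp add: \<Phi>_def gabor_atom_eq)
      show "f y = (\<integral>X. \<Phi> X * bargmann_kernel (?z X) y \<partial>lborel)"
        unfolding * integral_mult_right_zero by (rule stft_inversion(1)[OF h0 f])
      show "integrable lborel (\<lambda>X. \<Phi> X * bargmann_kernel (?z X) y)"
        unfolding * by (intro integrable_mult_right stft_inversion(2)[OF h0 f])
    qed
    have w0: "GS_weight (1/2) h is (\<lambda>_. 0) \<ge> 0" for "is" :: "'d list" by (rule less_imp_le[OF GS_weight_pos[OF h]])
    define W0 where "W0 = GS_weight (1/2) h [] (\<lambda>_::'d. 0)"
    have W0: "W0 \<ge> 0" unfolding W0_def by (rule w0)
    have ti: "integrable lborel (\<lambda>X. \<Phi> X * bargmann_kernel (t i X) y)" for y
    proof (rule Bochner_Integration.integrable_bound[OF integrable_mult_right[OF intb, of "W0"]])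
      have "norm (\<Phi> X * bargmann_kernel (t i X) y) \<le> norm (W0 * (norm (\<Phi> X) * b X))" for X
      proof -
        have "norm (bargmann_kernel (t i X) y) \<le> b X * W0"
          using kb[OF tn, of y "\<lambda>_. 0" "[]" i X] by (simp add: multi_power_def W0_def)
        from mult_left_mono[OF this, of "norm (\<Phi> X)"] show ?thesis
          using W0 b0[of X] by (simp add: norm_mult abs_mult mult_ac)
      qed
      then show "AE X in lborel. norm (\<Phi> X * bargmann_kernel (t i X) y) \<le> norm (W0 * (norm (\<Phi> X) * b X))" by simp
    qed measurable
    \<comment> \<open>Differentiation under the integral; the bounds uniform in y come from
      \<open>ND\<close> with the multi-index 0.\<close>
    have "iter_partial is (\<lambda>y. f y - fn i y) x = (\<integral>X. \<Phi> X * iter_partial is (N i X) x \<partial>lborel)"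
      and meas: "(\<lambda>X. iter_partial is (N i X) x) \<in> borel_measurable lborel"
    proof -
      have "(\<lambda>X. iter_partial is (N i X) x) \<in> borel_measurable lborel \<and>
        iter_partial is (\<lambda>y. f y - fn i y) x = (\<integral>X. \<Phi> X * iter_partial is (N i X) x \<partial>lborel)"
      proof (rule iter_partial_integral[where b = b])
        show "smooth (\<lambda>y. f y - fn i y)" by (intro smooth_diff sm fn_smooth)
        show "smooth (N i X)" for X by (rule Nsm)
        show "(\<lambda>X. N i X y) \<in> borel_measurable lborel" for y unfolding N_def by measurable
        show "\<exists>C. \<forall>X y. norm (iter_partial is (N i X) y) \<le> C * b X" for "is"
        proof (intro exI allI)
          fix X y
          have "norm (iter_partial is (N i X) y) \<le> D i X * GS_weight (1/2) h is (\<lambda>_. 0)"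
            using ND[of y "\<lambda>_. 0" "is" i X] by (simp add: multi_power_def)
          also have "\<dots> \<le> (4 * b X) * GS_weight (1/2) h is (\<lambda>_. 0)" by (intro mult_right_mono Db w0)
          finally show "norm (iter_partial is (N i X) y) \<le> (4 * GS_weight (1/2) h is (\<lambda>_. 0)) * b X" by (simp add: mult_ac)
        qed
        show "f y - fn i y = (\<integral>X. \<Phi> X * N i X y \<partial>lborel)" for y
          unfolding N_def right_diff_distrib fint fn_def using fi ti by simp
      qed (use intb in simp_all)
      then show "iter_partial is (\<lambda>y. f y - fn i y) x = (\<integral>X. \<Phi> X * iter_partial is (N i X) x \<partial>lborel)"
        "(\<lambda>X. iter_partial is (N i X) x) \<in> borel_measurable lborel" by auto
    qed
    then have "\<bar>multi_power x \<beta>\<bar> * norm (iter_partial is (\<lambda>y. f y - fn i y) x) =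
      norm (\<integral>X. of_real \<bar>multi_power x \<beta>\<bar> * (\<Phi> X * iter_partial is (N i X) x) \<partial>lborel)"
      by (simp add: integral_mult_right_zero norm_mult)
    also have "\<dots> \<le> (\<integral>X. (norm (\<Phi> X) * D i X) * GS_weight (1/2) h is \<beta> \<partial>lborel)"
    proof (rule Bochner_Integration.integral_norm_bound_integral)
      show I: "integrable lborel (\<lambda>X. (norm (\<Phi> X) * D i X) * GS_weight (1/2) h is \<beta>)"
        by (intro integrable_mult_left intD)
      show le: "norm (of_real \<bar>multi_power x \<beta>\<bar> * (\<Phi> X * iter_partial is (N i X) x)) \<le> (norm (\<Phi> X) * D i X) * GS_weight (1/2) h is \<beta>" for X
        using mult_left_mono[OF ND[of x \<beta> "is" i X], of "norm (\<Phi> X)"] by (simp add: norm_mult mult_ac)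
      show "integrable lborel (\<lambda>X. of_real \<bar>multi_power x \<beta>\<bar> * (\<Phi> X * iter_partial is (N i X) x))"
        by (rule Bochner_Integration.integrable_bound[OF I]) (use meas in \<open>auto intro!: AE_I2 order_trans[OF le]\<close>)
    qed
    also have "\<dots> = e i * GS_weight (1/2) h is \<beta>" unfolding e_def by (rule integral_mult_left_zero)
    finally show ?thesis .
  qed
  show ?thesis
  proof (intro exI conjI allI)
    show "h > 0" by fact
    show "finite (range (t n))" for n by (rule fin)
    show "fn n = (\<lambda>y. \<Sum>z\<in>range (t n). (\<lambda>z. \<integral>X. \<Phi> X * indicator (t n -` {z}) X \<partial>lborel) z * bargmann_kernel z y)" for n
      by (rule fn_sum)
  qed (use e0 final in auto)
qed

text \<open>Two functionals with the same transform agree on finite combinations of kernels; both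
  are bounded on the step in which these approximate a given f. Outside \<open>GS (1/2)\<close> both
  vanish by convention.\<close>

lemma inj_on_bargmann: "inj_on bargmann (GS_dual (1/2) :: ((real^'d::finite \<Rightarrow> complex) \<Rightarrow> complex) set)"
proof (rule inj_onI)
  fix u v :: "(real^'d \<Rightarrow> complex) \<Rightarrow> complex"
  assume u: "u \<in> GS_dual (1/2)" and v: "v \<in> GS_dual (1/2)" and eq: "bargmann u = bargmann v"
  have eqk: "u (bargmann_kernel z) = v (bargmann_kernel z)" for z
    using fun_cong[OF eq, of z] by (simp add: bargmann_def)
  have "u f = v f" if fG: "f \<in> GS (1/2)" for f
  proof -
    obtain h0 where h0: "h0 > 0" and f: "f \<in> GS_step (1/2) h0" using fG by (auto simp: GS_def)
    obtain h and fn :: "nat \<Rightarrow> real^'d \<Rightarrow> complex" and e :: "nat \<Rightarrow> real" where h: "h > 0" and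
      fn: "\<And>n. \<exists>S c. finite S \<and> fn n = (\<lambda>y. \<Sum>z\<in>S. c z * bargmann_kernel z y)" and e: "e \<longlonglongrightarrow> 0" and
      le: "\<And>n x \<beta> is. \<bar>multi_power x \<beta>\<bar> * norm (iter_partial is (\<lambda>y. f y - fn n y) x) \<le> e n * GS_weight (1/2) h is \<beta>"
      using GS_approximation[OF h0 f] by blast
    obtain Cu where Cu: "\<And>g M. smooth g \<Longrightarrow>
      (\<forall>x \<beta> is. \<bar>multi_power x \<beta>\<bar> * norm (iter_partial is g x) \<le> M * GS_weight (1/2) h is \<beta>) \<Longrightarrow> norm (u g) \<le> Cu * M"
      using GS_dual_bound[OF u h] by blast
    obtain Cv where Cv: "\<And>g M. smooth g \<Longrightarrow>
      (\<forall>x \<beta> is. \<bar>multi_power x \<beta>\<bar> * norm (iter_partial is g x) \<le> M * GS_weight (1/2) h is \<beta>) \<Longrightarrow> norm (v g) \<le> Cv * M"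
      using GS_dual_bound[OF v h] by blast
    \<comment> \<open>A step containing every kernel, used for finite linearity only; it needs no
      relation to the step h of the approximation.\<close>
    obtain hk K where hk: "hk > 0" and
      bd: "\<And>(z::complex^'d) \<beta> is y. \<bar>multi_power y \<beta>\<bar> * norm (iter_partial is (bargmann_kernel z) y) \<le>
      K * exp ((1/2 + 1/2) * (norm z)\<^sup>2) * GS_weight (1/2) hk is \<beta>"
      using bargmann_kernel_GS_bound[OF half_gt_zero[OF zero_less_one] order_refl, where 'd = 'd] by blast
    have A: "bargmann_kernel z \<in> GS_step (1/2) hk" for z :: "complex^'d"
      by (rule GS_norm_le(2)[OF smooth_bargmann_kernel hk bd])
    have "norm (u f - v f) \<le> (Cu + Cv) * e n" for n
    proof -
      obtain S c where S: "finite S" and fnS: "fn n = (\<lambda>y. \<Sum>z\<in>S. c z * bargmann_kernel z y)" using fn by blast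
      have fnG: "fn n \<in> GS (1/2)" unfolding fnS by (intro GS_step_imp_GS[OF hk] GS_step_sum hk S A)
      have fns: "smooth (fn n)" unfolding fnS by (intro smooth_sum S smooth_cmult smooth_bargmann_kernel)
      have same: "u (fn n) = v (fn n)" unfolding fnS
        using GS_dual_sum[OF u hk S, of bargmann_kernel c] GS_dual_sum[OF v hk S, of bargmann_kernel c] A by (simp add: eqk)
      have ds: "smooth (\<lambda>y. f y - fn n y)" by (intro smooth_diff GS_stepD(1)[OF f h0] fns)
      have dG: "(\<lambda>y. f y - fn n y) \<in> GS (1/2)"
        by (rule GS_step_imp_GS[OF h GS_norm_le(2)[OF ds h le]])
      have split: "w f = w (\<lambda>y. f y - fn n y) + w (fn n)" if "w \<in> GS_dual (1/2)" for w
        using GS_dual_linear(1)[OF that dG fnG] by simp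
      have "norm (u f - v f) = norm (u (\<lambda>y. f y - fn n y) - v (\<lambda>y. f y - fn n y))"
        unfolding split[OF u] split[OF v] same by simp
      also have "\<dots> \<le> norm (u (\<lambda>y. f y - fn n y)) + norm (v (\<lambda>y. f y - fn n y))" by (rule norm_triangle_ineq4)
      also have "\<dots> \<le> Cu * e n + Cv * e n" using le by (intro add_mono Cu Cv ds) auto
      finally show ?thesis by (simp add: distrib_right)
    qed
    moreover have "(\<lambda>n. (Cu + Cv) * e n) \<longlonglongrightarrow> (Cu + Cv) * 0" by (intro tendsto_intros e)
    ultimately have "norm (u f - v f) \<le> (Cu + Cv) * 0" by (intro LIMSEQ_le_const) auto
    then show ?thesis by simp
  qed
  moreover have "u f = v f" if "f \<notin> GS (1/2)" for f using u v that by (simp add: GS_dual_def)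
  ultimately show "u = v" by blast
qed

section \<open>Growth of entire functions of finite quasi-norm\<close>

lemma entire_line:
  assumes "entire F"
  shows "\<exists>g'. \<forall>t. ((\<lambda>t. F (z + t *s w)) has_field_derivative g' t) (at t)"
proof -
  obtain F' where F': "\<And>z. (F has_derivative F' z) (at z)" and lin: "\<And>z c v. F' z (c *s v) = c * F' z v"
    using assms unfolding entire_def by metis
  have "((\<lambda>t. F (z + t *s w)) has_field_derivative F' (z + t *s w) w) (at t)" for t
  proof -
    have "bounded_linear (\<lambda>h::complex. h *s w)"
      by (rule bounded_linear_intro[where K = "norm w"]) (auto simp: vec_eq_iff norm_smult_complex algebra_simps)
    then have "((\<lambda>t. z + t *s w) has_derivative (\<lambda>h. h *s w)) (at t)"
      by (auto intro!: derivative_eq_intros bounded_linear_imp_has_derivative)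
    from has_derivative_compose[OF this F']
    show ?thesis unfolding has_field_derivative_def lin by (simp only: mult.commute[of _ "F' _ _"])
  qed
  then show ?thesis by (intro exI[of _ "\<lambda>t. F' (z + t *s w) w"]) blast
qed

lemma entire_continuous: "entire F \<Longrightarrow> continuous_on UNIV F"
  unfolding entire_def by (meson continuous_at_imp_continuous_on has_derivative_continuous)

lemma phase_to_complex_add: "phase_to_complex (X + Y) = phase_to_complex X + phase_to_complex Y"
  and phase_to_complex_diff: "phase_to_complex (X - Y) = phase_to_complex X - phase_to_complex Y"
  by (simp_all add: phase_to_complex_def vec_eq_iff add_divide_distrib diff_divide_distrib algebra_simps)

lemma surj_phase_to_complex: "\<exists>X. phase_to_complex X = z"
proof
  show "phase_to_complex (\<chi> j. sqrt 2 * Re (z $ j), \<chi> j. - sqrt 2 * Im (z $ j)) = z"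
    by (simp add: phase_to_complex_def vec_eq_iff complex_eq_iff)
qed

lemma to_phase_space_eq:
  "to_phase_space F X = of_real ((2 * pi) powr (- (real CARD('d) / 2))) * (phase_factor X * F (phase_to_complex X))"
  for X :: "'d::finite phase"
  by (cases X) (simp add: to_phase_space_def phase_factor_def phase_to_complex_def)

lemma sum_list_dist_le:
  fixes xs cs :: "'a::real_normed_vector list"
  assumes "length xs = m" "length cs = m" "\<And>j. j < m \<Longrightarrow> dist (cs ! j) (xs ! j) \<le> \<rho>"
  shows "norm (sum_list xs - sum_list cs) \<le> real m * \<rho>"
proof -
  have "norm (sum_list xs - sum_list cs) = norm (\<Sum>j=0..<m. xs ! j - cs ! j)"
    using assms by (simp add: sum_list_sum_nth sum_subtractf)
  also have "\<dots> \<le> (\<Sum>j=0..<m. \<rho>)"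
    using assms(3) by (intro sum_norm_le) (auto simp: dist_norm norm_minus_commute)
  finally show ?thesis by simp
qed

text \<open>Maximising \<open>norm (F z) * (1 - dist z z0) ^ M\<close> over the unit ball gives a point around which \<open>F\<close> is
  controlled by its value there, hence, by Cauchy estimates, also bounded below.\<close>

lemma entire_lower_bound_near_max:
  fixes F :: "complex^'d::finite \<Rightarrow> complex"
  assumes F: "entire F" and nz: "F z0 \<noteq> 0" and M: "0 < M"
  shows "\<exists>z \<delta>. 0 < \<delta> \<and> \<delta> \<le> 1 \<and> norm (z - z0) \<le> 1 \<and> norm (F z0) \<le> norm (F z) * \<delta> ^ M \<and>
    (\<forall>w. norm (w - z) \<le> (1/2) ^ (M + 3) * \<delta> \<longrightarrow> norm (F z) / 2 \<le> norm (F w))"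
proof -
  have cF: "continuous_on S F" for S using entire_continuous[OF F] continuous_on_subset by blast
  \<comment> \<open>The weight vanishes on the boundary sphere, so a maximiser with nonzero value is
    interior and \<delta> > 0.\<close>
  define \<Psi> where "\<Psi> = (\<lambda>z. norm (F z) * (1 - norm (z - z0)) ^ M)"
  have "continuous_on (cball z0 1) \<Psi>" unfolding \<Psi>_def by (intro continuous_intros cF)
  then obtain z where z: "z \<in> cball z0 1" and mx: "\<And>w. w \<in> cball z0 1 \<Longrightarrow> \<Psi> w \<le> \<Psi> z"
    using continuous_attains_sup[of "cball z0 1" \<Psi>] by (auto simp: compact_cball)
  have z1: "norm (z - z0) \<le> 1" using z by (simp add: dist_norm norm_minus_commute)
  define \<delta> where "\<delta> = 1 - norm (z - z0)"
  have Fz0: "norm (F z0) \<le> norm (F z) * \<delta> ^ M" using mx[of z0] by (simp add: \<Psi>_def \<delta>_def)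
  have "\<delta> \<noteq> 0" using Fz0 nz M by (auto simp: zero_power)
  then have \<delta>: "0 < \<delta>" "\<delta> \<le> 1" using z1 by (auto simp: \<delta>_def)
  \<comment> \<open>Within \<delta> / 2 of the maximiser the weight has dropped by at most the
    factor 2^M, so F has grown by at most that factor.\<close>
  have ub: "norm (F w) \<le> 2 ^ M * norm (F z)" if w: "norm (w - z) \<le> \<delta> / 2" for w
  proof -
    have "norm (w - z0) \<le> norm (w - z) + norm (z - z0)" using norm_triangle_ineq[of "w - z" "z - z0"] by simp
    then have w1: "\<delta> / 2 \<le> 1 - norm (w - z0)" using w by (simp add: \<delta>_def field_simps)
    then have "w \<in> cball z0 1" using \<delta> by (simp add: dist_norm norm_minus_commute)
    have "norm (F w) * (\<delta> / 2) ^ M \<le> \<Psi> w"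
      unfolding \<Psi>_def using w1 \<delta> by (intro mult_left_mono power_mono) auto
    also have "\<dots> \<le> norm (F z) * \<delta> ^ M" using mx[OF \<open>w \<in> cball z0 1\<close>] by (simp add: \<Psi>_def \<delta>_def)
    finally have "\<delta> ^ M * norm (F w) \<le> \<delta> ^ M * (2 ^ M * norm (F z))" by (simp add: power_divide field_simps)
    then show ?thesis using \<delta> by simp
  qed
  have "norm (F z) / 2 \<le> norm (F w)" if w: "norm (w - z) \<le> (1/2) ^ (M + 3) * \<delta>" for w
  proof (cases "w = z")
    case False
    define n where "n = norm (w - z)"
    have n: "n > 0" using False by (simp add: n_def)
    define v where "v = of_real (\<delta> / 2 / n) *s (w - z)"
    have nv: "norm v = \<delta> / 2" using n \<delta> unfolding v_def norm_smult_complex norm_of_real by (simp add: n_def)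
    define \<tau> where "\<tau> = complex_of_real (n / (\<delta> / 2))"
    have \<tau>1: "\<tau> * complex_of_real (\<delta> / 2 / n) = 1"
      unfolding \<tau>_def of_real_mult[symmetric] using n \<delta> by simp
    have wz: "w = z + \<tau> *s v" by (simp only: v_def vector_smult_assoc \<tau>1) simp
    have \<tau>: "norm \<tau> = n / (\<delta> / 2)" unfolding \<tau>_def norm_of_real using n \<delta> by simp
    obtain g' where g': "\<And>t. ((\<lambda>t. F (z + t *s v)) has_field_derivative g' t) (at t)"
      using entire_line[OF F] by blast
    \<comment> \<open>The line is scaled so that the unit disc has radius \<delta> / 2. The Cauchy
      bound 2 * 2^M times |\<tau>| \<le> 2 (1/2)^(M+3) equals 1/2, which explains M + 3.\<close>
    have "n / (\<delta> / 2) \<le> 2 * (1/2) ^ (M + 3)" using w \<delta> by (simp add: n_def field_simps)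
    then have \<tau>le: "norm \<tau> \<le> 2 * (1/2) ^ (M + 3)" by (simp add: \<tau>)
    also have "\<dots> \<le> 1/2" using power_le_one[of "1/2::real" M] by (simp add: power_add power3_eq_cube)
    finally have "norm (F (z + \<tau> *s v) - F (z + 0 *s v)) \<le> 2 * (2 ^ M * norm (F z)) * norm \<tau>"
    proof (rule holomorphic_first_order_bounds(2)[OF g', rotated])
      fix t :: complex assume "norm t \<le> 1"
      then have "norm ((z + t *s v) - z) \<le> \<delta> / 2"
        using \<delta> by (simp add: norm_smult_complex nv mult_left_le_one_le)
      then show "norm (F (z + t *s v)) \<le> 2 ^ M * norm (F z)" by (rule ub)
    qed
    also have "\<dots> \<le> 2 * (2 ^ M * norm (F z)) * (2 * (1/2) ^ (M + 3))"
      by (intro mult_left_mono \<tau>le) auto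
    also have "\<dots> = norm (F z) / 2" by (simp add: power_add power_divide)
    finally have "norm (F w - F z) \<le> norm (F z) / 2" by (simp add: wz)
    then show ?thesis using norm_triangle_ineq3[of "F w" "F z"] by linarith
  qed simp
  then show ?thesis using \<delta> z1 Fz0 by blast
qed

text \<open>The neighbourhood on which F is bounded below may be arbitrarily small, and then the
  quasi-norm bound loses \<rho>^N. The factor \<delta>^M gained at the near-maximum compensates
  this, so the constant is uniform in z0.\<close>

lemma entire_growth:
  fixes F :: "complex^'d::finite \<Rightarrow> complex"
  assumes \<B>: "mixed_quasinorm_space \<B>" and F: "entire F" and fin: "B_norm \<omega> \<B> F < \<infinity>"
    and \<omega>: "\<And>c. c > 0 \<Longrightarrow> \<exists>C>0. \<forall>X. inverse C * gaussian c X \<le> \<omega> X" and \<epsilon>: "0 < \<epsilon>"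
  shows "\<exists>C\<ge>0. \<forall>X. norm (phase_factor X * F (phase_to_complex X)) \<le> C * exp (\<epsilon> * (norm X)\<^sup>2)"
proof -
  define m where "m = length \<B>"
  have sub: "\<forall>(V, p)\<in>set \<B>. subspace V \<and> 0 < p" and ds: "internal_direct_sum (map fst \<B>)"
    using \<B> by (auto simp: mixed_quasinorm_space_def)
  obtain K N where K: "K > 0" and low: "\<And>cs \<rho> A g. \<lbrakk>length cs = length \<B>;
    \<forall>j<length \<B>. cs ! j \<in> fst (\<B> ! j); 0 < \<rho>; \<rho> \<le> 1; 0 \<le> A;
    \<forall>xs. length xs = length \<B> \<longrightarrow> (\<forall>j<length \<B>. dist (cs ! j) (xs ! j) \<le> \<rho>) \<longrightarrow>
       ennreal A \<le> g (sum_list xs)\<rbrakk> \<Longrightarrow> ennreal (A * (K * \<rho> ^ N)) \<le> mixed_quasinorm \<B> g"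
    using mixed_quasinorm_lower_bound[OF sub] by blast
  \<comment> \<open>At least N, to match the lost power of the radius, and positive, as the
    maximisation requires.\<close>
  define M where "M = Suc N"
  \<comment> \<open>Rate for the lower bound on the weight: below 1/4, so that 1/2 + 2 c \<le> 1 at
    the end, and below \<epsilon> / 2, so that 3 c \<le> 2 \<epsilon>.\<close>
  define c where "c = min (\<epsilon> / 2) (1/4)"
  have c: "0 < c" "c \<le> \<epsilon> / 2" "c \<le> 1/4" using \<epsilon> by (auto simp: c_def)
  obtain C where C: "C > 0" and \<omega>C: "\<And>X. inverse C * gaussian c X \<le> \<omega> X" using \<omega>[OF c(1)] by blast
  define Q where "Q = enn2real (B_norm \<omega> \<B> F)"
  have Q: "ennreal Q = B_norm \<omega> \<B> F" "Q \<ge> 0" using fin by (auto simp: Q_def top.not_eq_extremum)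
  define k where "k = (2 * pi) powr (- (real CARD('d) / 2))"
  have k: "k > 0" by (simp add: k_def)
  \<comment> \<open>Moving each of m components by \<kappa> \<delta> moves the sum by at most
    (1/2)^(M+3) \<delta>; the summand 1 allows m = 0.\<close>
  define \<kappa> where "\<kappa> = (1/2) ^ (M + 3) / (real m + 1)"
  have \<kappa>: "0 < \<kappa>" "\<kappa> \<le> 1" "real m * \<kappa> \<le> (1/2) ^ (M + 3)"
  proof -
    show "0 < \<kappa>" by (simp add: \<kappa>_def)
    have "(1/2::real) ^ (M + 3) \<le> 1" by (rule power_le_one) auto
    also have "1 \<le> 1 * (real m + 1)" by simp
    finally have "(1/2::real) ^ (M + 3) \<le> 1 * (real m + 1)" .
    then show "\<kappa> \<le> 1" unfolding \<kappa>_def by (rule pos_divide_le_eq[THEN iffD2, rotated]) simp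
    show "real m * \<kappa> \<le> (1/2) ^ (M + 3)" by (simp add: \<kappa>_def divide_simps)
  qed
  define D where "D = 2 * C * Q / (k * K * \<kappa> ^ M)"
  have D: "D \<ge> 0" using C Q k K \<kappa> by (simp add: D_def)
  have key: "norm (F z0) \<le> D * exp ((1/4 + c) * (2 * (norm z0 + 2)\<^sup>2))" for z0
  proof (cases "F z0 = 0")
    case False
    obtain z \<delta> where \<delta>: "0 < \<delta>" "\<delta> \<le> 1" and z: "norm (z - z0) \<le> 1" and Fz0: "norm (F z0) \<le> norm (F z) * \<delta> ^ M"
      and lb: "\<And>w. norm (w - z) \<le> (1/2) ^ (M + 3) * \<delta> \<Longrightarrow> norm (F z) / 2 \<le> norm (F w)"
      using entire_lower_bound_near_max[OF F False, of M] by (auto simp: M_def)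
    obtain X where X: "phase_to_complex X = z" using surj_phase_to_complex by blast
    obtain cs where cs: "length cs = length \<B>" "\<forall>j<length \<B>. cs ! j \<in> fst (\<B> ! j)" "sum_list cs = X"
      using ds unfolding internal_direct_sum_def by (metis (no_types, lifting) length_map nth_map)
    define \<rho> where "\<rho> = \<kappa> * \<delta>"
    have \<rho>: "0 < \<rho>" "\<rho> \<le> 1" using \<kappa> \<delta> by (auto simp: \<rho>_def mult_le_one)
    \<comment> \<open>Common lower bound for the Gaussians of the phase factor and of the weight:
      each point used maps to within distance 2 of z0.\<close>
    define E where "E = exp (- ((1/4 + c) * (2 * (norm z0 + 2)\<^sup>2)))"
    define A where "A = k * (inverse C * (norm (F z) / 2)) * E"
    have A: "A \<ge> 0" using k C by (simp add: A_def E_def)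
    have "ennreal (A * (K * \<rho> ^ N)) \<le> B_norm \<omega> \<B> F"
      unfolding B_norm_def
    proof (rule low[OF cs(1,2) \<rho> A], intro allI impI)
      fix xs assume xs: "length xs = length \<B>" "\<forall>j<length \<B>. dist (cs ! j) (xs ! j) \<le> \<rho>"
      define Y where "Y = sum_list xs"
      have "norm (Y - X) \<le> real m * \<rho>"
        unfolding Y_def cs(3)[symmetric] by (rule sum_list_dist_le) (use xs cs in \<open>auto simp: m_def\<close>)
      also have "\<dots> \<le> (1/2) ^ (M + 3) * \<delta>"
        using \<kappa>(3) \<delta> unfolding \<rho>_def mult.assoc[symmetric] by (intro mult_right_mono) auto
      finally have YX: "norm (Y - X) \<le> (1/2) ^ (M + 3) * \<delta>" .
      have "(norm (phase_to_complex Y - z))\<^sup>2 \<le> (norm (Y - X))\<^sup>2"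
        unfolding X[symmetric] phase_to_complex_diff[symmetric] norm_phase_to_complex by simp
      then have "norm (phase_to_complex Y - z) \<le> norm (Y - X)" by (rule power2_le_imp_le) simp
      then have Yz: "norm (phase_to_complex Y - z) \<le> (1/2) ^ (M + 3) * \<delta>" using YX by simp
      have "(1/2::real) ^ (M + 3) * \<delta> \<le> 1" using \<delta> by (intro mult_le_one power_le_one) auto
      then have "norm (phase_to_complex Y) \<le> norm z0 + 2"
        using Yz z norm_triangle_ineq[of "phase_to_complex Y - z" "z"] norm_triangle_ineq[of "z - z0" z0] by simp
      then have "(norm (phase_to_complex Y))\<^sup>2 \<le> (norm z0 + 2)\<^sup>2" by (intro power_mono) auto
      then have Y2: "(norm Y)\<^sup>2 \<le> 2 * (norm z0 + 2)\<^sup>2" unfolding norm_phase_to_complex by simp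
      have \<omega>0: "0 \<le> \<omega> Y" using \<omega>C[of Y] C by (meson exp_ge_zero inverse_nonnegative_iff_nonnegative less_imp_le mult_nonneg_nonneg order_trans)
      have "E \<le> exp (- ((1/4 + c) * (norm Y)\<^sup>2))"
        unfolding E_def using Y2 c by simp
      also have "\<dots> = gaussian (1/4) Y * gaussian c Y"
        unfolding exp_add[symmetric] by (simp add: algebra_simps)
      finally have "A \<le> k * (inverse C * (norm (F z) / 2)) * (gaussian (1/4) Y * gaussian c Y)"
        unfolding A_def using k C by (intro mult_left_mono) auto
      also have "\<dots> = k * (gaussian (1/4) Y * (norm (F z) / 2)) * (inverse C * gaussian c Y)"
        by (simp add: mult_ac)
      also have "\<dots> \<le> k * (gaussian (1/4) Y * norm (F (phase_to_complex Y))) * \<omega> Y"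
        using k C by (intro mult_mono mult_left_mono lb Yz \<omega>C) auto
      also have "\<dots> = norm (to_phase_space F Y * of_real (\<omega> Y))"
        using k \<omega>0 unfolding to_phase_space_eq norm_mult norm_phase_factor k_def[symmetric] norm_of_real by simp
      finally show "ennreal A \<le> ennreal (norm (to_phase_space F (sum_list xs) * of_real (\<omega> (sum_list xs))))"
        unfolding Y_def by (rule ennreal_leI)
    qed
    then have "A * (K * \<rho> ^ N) \<le> Q" unfolding Q(1)[symmetric] using Q(2) by (simp add: ennreal_le_iff)
    moreover have "A * (K * \<rho> ^ M) \<le> A * (K * \<rho> ^ N)"
      using A K \<rho> by (intro mult_left_mono power_decreasing) (auto simp: M_def)
    ultimately have AQ: "A * (K * \<rho> ^ M) \<le> Q" by linarith
    \<comment> \<open>As \<rho>^M = \<kappa>^M \<delta>^M, the unknown \<delta> cancels and D does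
      not contain it.\<close>
    have "norm (F z) * \<delta> ^ M = (A * (K * \<rho> ^ M)) * (2 * C / (k * K * \<kappa> ^ M)) * inverse E"
      using k K C \<kappa> by (simp add: A_def \<rho>_def E_def power_mult_distrib field_simps)
    also have "\<dots> \<le> Q * (2 * C / (k * K * \<kappa> ^ M)) * inverse E"
      using k K C \<kappa> by (intro mult_right_mono AQ) (auto simp: E_def)
    also have "\<dots> = D * exp ((1/4 + c) * (2 * (norm z0 + 2)\<^sup>2))"
      by (simp add: D_def E_def exp_minus mult_ac)
    finally show ?thesis using Fz0 by simp
  qed (use D in simp)
  \<comment> \<open>The rate 1/4 cancels against the phase factor; the linear term left by the shift
    2 is absorbed by c s^2.\<close>
  have "norm (phase_factor X * F (phase_to_complex X)) \<le> (D * exp (4 / c + 4)) * exp (\<epsilon> * (norm X)\<^sup>2)" for X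
  proof -
    define s where "s = norm (phase_to_complex X)"
    have X2: "(norm X)\<^sup>2 = 2 * s\<^sup>2" using norm_phase_to_complex[of X] by (simp add: s_def)
    have "norm (phase_factor X * F (phase_to_complex X)) \<le> exp (- (1/4) * (2 * s\<^sup>2)) * (D * exp ((1/4 + c) * (2 * (s + 2)\<^sup>2)))"
      unfolding norm_mult norm_phase_factor X2 using key[of "phase_to_complex X"] by (simp add: s_def)
    also have "\<dots> = D * exp (- (1/4) * (2 * s\<^sup>2) + (1/4 + c) * (2 * (s + 2)\<^sup>2))"
      unfolding exp_add by simp
    also have "\<dots> \<le> D * exp ((4 / c + 4) + \<epsilon> * (2 * s\<^sup>2))"
    proof -
      have "0 \<le> (sqrt c * s - 2 / sqrt c)\<^sup>2" by simp
      also have "\<dots> = c * s\<^sup>2 + 4 / c - 4 * s"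
        using c by (simp add: power2_diff power_mult_distrib power_divide)
      finally have 1: "4 * s \<le> c * s\<^sup>2 + 4 / c" by simp
      have s0: "0 \<le> s" by (simp add: s_def)
      have "- (1/4) * (2 * s\<^sup>2) + (1/4 + c) * (2 * (s + 2)\<^sup>2) = 2 * c * s\<^sup>2 + (1/2 + 2 * c) * (4 * s + 4)"
        by (simp add: power2_eq_square algebra_simps)
      also have "\<dots> \<le> 2 * c * s\<^sup>2 + 1 * (4 * s + 4)"
        using c s0 by (intro add_left_mono mult_right_mono) auto
      also have "\<dots> \<le> 3 * c * s\<^sup>2 + (4 / c + 4)" using 1 by simp
      also have "3 * c * s\<^sup>2 \<le> (\<epsilon> * 2) * s\<^sup>2" using c \<epsilon> by (intro mult_right_mono) auto
      finally show ?thesis using D by (intro mult_left_mono) (auto simp: mult.assoc)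
    qed
    finally show ?thesis unfolding X2 exp_add by simp
  qed
  moreover have "D * exp (4 / c + 4) \<ge> 0" using D by simp
  ultimately show ?thesis by blast
qed

section \<open>Gaussian means of entire functions\<close>

text \<open>Cauchy's integral formula on the unit circle, written as a Lebesgue integral with an
  indicator so that Fubini can be applied to it.\<close>

lemma circle_mean_value:
  assumes g: "\<And>t. (g has_field_derivative g' t) (at t)"
  shows "(\<integral>t. indicator {0..1::real} t *\<^sub>R g (exp (2 * of_real pi * \<i> * of_real t)) \<partial>lborel) = g 0"
proof -
  have hol: "g holomorphic_on S" for S using g by (meson field_differentiable_at_within field_differentiable_def holomorphic_on_def)
  let ?e = "\<lambda>t. exp (2 * of_real pi * \<i> * complex_of_real t)"
  have cont: "continuous_on {0..1} (\<lambda>t. g (?e t))"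
    by (intro continuous_on_compose2[OF holomorphic_on_imp_continuous_on[OF hol[of UNIV]]] continuous_intros) auto
  have si: "set_integrable lborel {0..1} (\<lambda>t. g (?e t))"
    by (rule borel_integrable_atLeastAtMost') (rule cont)
  have "((\<lambda>u. g u / (u - 0)) has_contour_integral (2 * of_real pi * \<i> * g 0)) (circlepath 0 1)"
    by (rule Cauchy_integral_circlepath_simple[OF hol]) auto
  then have "((\<lambda>t. g (?e t) / ?e t * (2 * pi * \<i> * ?e t)) has_integral (2 * of_real pi * \<i> * g 0)) {0..1}"
    unfolding has_contour_integral_def
    by (rule has_integral_eq[rotated]) (subst vector_derivative_circlepath01, auto simp: circlepath)
  then have "((\<lambda>t. (2 * of_real pi * \<i>) * g (?e t)) has_integral (2 * of_real pi * \<i> * g 0)) {0..1}"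
    by (rule has_integral_eq[rotated]) simp
  from has_integral_mult_right[OF this, of "inverse (2 * of_real pi * \<i>)"]
  moreover have inv: "inverse c * (c * w) = w" if "c \<noteq> 0" for c w :: complex
    using that by (simp add: mult.assoc[symmetric])
  have "2 * of_real pi * \<i> \<noteq> (0::complex)" by simp
  note inv[OF this]
  ultimately have "((\<lambda>t. g (?e t)) has_integral g 0) {0..1}" by (simp only:)
  then have "integral {0..1} (\<lambda>t. g (?e t)) = g 0" by (rule integral_unique)
  then show "(\<integral>t. indicator {0..1::real} t *\<^sub>R g (?e t) \<partial>lborel) = g 0"
    using set_borel_integral_eq_integral(2)[OF si] by (simp add: set_lebesgue_integral_def)
qed

section \<open>Invariance of Lebesgue measure on phase space under rotations\<close>

lemma nn_integral_lborel_translate: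
  fixes f :: "'a::euclidean_space \<Rightarrow> ennreal"
  assumes [measurable]: "f \<in> borel_measurable borel"
  shows "(\<integral>\<^sup>+x. f (x + t) \<partial>lborel) = (\<integral>\<^sup>+x. f x \<partial>lborel)"
proof -
  have "(\<integral>\<^sup>+x. f x \<partial>lborel) = (\<integral>\<^sup>+x. f x \<partial>distr lborel borel ((+) t))" by (simp only: lborel_distr_plus)
  also have "\<dots> = (\<integral>\<^sup>+x. f (x + t) \<partial>lborel)" by (subst nn_integral_distr) (auto simp: add.commute)
  finally show ?thesis ..
qed

text \<open>A shear translates each fibre, so Tonelli and translation invariance suffice.\<close>

lemma nn_integral_shear:
  fixes f :: "'a::euclidean_space \<times> 'a \<Rightarrow> ennreal"
  assumes f: "f \<in> borel_measurable borel"
  shows "(\<integral>\<^sup>+X. f (fst X + a *\<^sub>R snd X, snd X) \<partial>lborel) = (\<integral>\<^sup>+X. f X \<partial>lborel)"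
    and "(\<integral>\<^sup>+X. f (fst X, snd X + a *\<^sub>R fst X) \<partial>lborel) = (\<integral>\<^sup>+X. f X \<partial>lborel)"
proof -
  note [measurable] = f
  have Pair[measurable]: "(\<lambda>X. (p X, q X)) \<in> borel_measurable M" if "p \<in> borel_measurable M" "q \<in> borel_measurable M" for p q :: "'c \<Rightarrow> 'a" and M
    using that by (rule borel_measurable_Pair)
  have m: "(\<lambda>X. f (fst X + a *\<^sub>R snd X, snd X)) \<in> borel_measurable (lborel \<Otimes>\<^sub>M lborel)"
    "(\<lambda>X. f (fst X, snd X + a *\<^sub>R fst X)) \<in> borel_measurable (lborel \<Otimes>\<^sub>M lborel)"
    unfolding lborel_prod by (auto intro!: measurable_compose[OF _ f] Pair borel_measurable_add borel_measurable_scaleR simp: measurable_lborel1)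
  have m0: "f \<in> borel_measurable (lborel \<Otimes>\<^sub>M lborel)" unfolding lborel_prod using f by simp
  have s1: "(\<lambda>p. f (p, q)) \<in> borel_measurable borel" "(\<lambda>q. f (p, q)) \<in> borel_measurable borel" for p q
    by (auto intro!: measurable_compose[OF _ f] Pair)
  have "(\<integral>\<^sup>+X. f (fst X + a *\<^sub>R snd X, snd X) \<partial>lborel) = (\<integral>\<^sup>+q. \<integral>\<^sup>+p. f (p + a *\<^sub>R q, q) \<partial>lborel \<partial>lborel)"
    using lborel_pair.nn_integral_snd[OF m(1)] by (simp add: lborel_prod)
  also have "\<dots> = (\<integral>\<^sup>+q. \<integral>\<^sup>+p. f (p, q) \<partial>lborel \<partial>lborel)"
    by (intro nn_integral_cong nn_integral_lborel_translate s1)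
  also have "\<dots> = (\<integral>\<^sup>+X. f X \<partial>lborel)"
    using lborel_pair.nn_integral_snd[OF m0] by (simp add: lborel_prod)
  finally show "(\<integral>\<^sup>+X. f (fst X + a *\<^sub>R snd X, snd X) \<partial>lborel) = (\<integral>\<^sup>+X. f X \<partial>lborel)" .
  have "(\<integral>\<^sup>+X. f (fst X, snd X + a *\<^sub>R fst X) \<partial>lborel) = (\<integral>\<^sup>+p. \<integral>\<^sup>+q. f (p, q + a *\<^sub>R p) \<partial>lborel \<partial>lborel)"
    using lborel.nn_integral_fst[OF m(2)] by (simp add: lborel_prod)
  also have "\<dots> = (\<integral>\<^sup>+p. \<integral>\<^sup>+q. f (p, q) \<partial>lborel \<partial>lborel)"
    by (intro nn_integral_cong nn_integral_lborel_translate s1)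
  also have "\<dots> = (\<integral>\<^sup>+X. f X \<partial>lborel)"
    using lborel.nn_integral_fst[OF m0] by (simp add: lborel_prod)
  finally show "(\<integral>\<^sup>+X. f (fst X, snd X + a *\<^sub>R fst X) \<partial>lborel) = (\<integral>\<^sup>+X. f X \<partial>lborel)" .
qed

text \<open>The simultaneous rotation of all coordinate planes (x_j, \<xi>_j), which
  \<open>phase_to_complex\<close> turns into multiplication by the scalar exp (- i
  \<theta>).\<close>

definition phase_rotation :: "real \<Rightarrow> 'a::euclidean_space \<times> 'a \<Rightarrow> 'a \<times> 'a" where
  "phase_rotation \<theta> X = (cos \<theta> *\<^sub>R fst X - sin \<theta> *\<^sub>R snd X, sin \<theta> *\<^sub>R fst X + cos \<theta> *\<^sub>R snd X)"

lemma phase_rotation_measurable: "phase_rotation \<theta> \<in> borel_measurable borel"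
  unfolding phase_rotation_def by (intro borel_measurable_continuous_onI continuous_intros)

text \<open>A rotation is a product of three shears,
  with parameters \<open>- tan (\<theta>/2)\<close>, \<open>sin \<theta>\<close>, \<open>- tan (\<theta>/2)\<close>; when \<open>tan (\<theta>/2)\<close> is undefined, it is the
  square of the rotation by \<open>\<theta>/2\<close>.\<close>

lemma nn_integral_phase_rotation:
  fixes f :: "'a::euclidean_space \<times> 'a \<Rightarrow> ennreal"
  assumes f: "f \<in> borel_measurable borel"
  shows "(\<integral>\<^sup>+X. f (phase_rotation \<theta> X) \<partial>lborel) = (\<integral>\<^sup>+X. f X \<partial>lborel)"
proof -
  have main: "(\<integral>\<^sup>+X. f (phase_rotation \<theta> X) \<partial>lborel) = (\<integral>\<^sup>+X. f X \<partial>lborel)"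
    if f: "f \<in> borel_measurable borel" and c: "cos (\<theta>/2) \<noteq> 0" for f :: "'a \<times> 'a \<Rightarrow> ennreal" and \<theta>
  proof -
    define t where "t = - tan (\<theta>/2)"
    let ?S = "\<lambda>a (X::'a \<times> 'a). (fst X + a *\<^sub>R snd X, snd X)"
    let ?T = "\<lambda>a (X::'a \<times> 'a). (fst X, snd X + a *\<^sub>R fst X)"
    have sm: "?S a \<in> borel_measurable borel" "?T a \<in> borel_measurable borel" for a
      by (intro borel_measurable_continuous_onI continuous_intros)+
    have s: "sin \<theta> = 2 * sin (\<theta>/2) * cos (\<theta>/2)" and cs: "cos \<theta> = 1 - 2 * (sin (\<theta>/2))\<^sup>2"
      using sin_double[of "\<theta>/2"] cos_double_sin[of "\<theta>/2"] by simp_all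
    have ts: "1 + t * sin \<theta> = cos \<theta>"
      unfolding t_def tan_def s cs using c by (simp add: power2_eq_square)
    have tt: "t + t * cos \<theta> = - sin \<theta>"
    proof -
      have "1 + cos \<theta> = 2 * (cos (\<theta>/2))\<^sup>2" using cos_double_cos[of "\<theta>/2"] by simp
      then have "t * (1 + cos \<theta>) = - sin \<theta>" unfolding t_def tan_def s using c by (simp add: power2_eq_square)
      then show ?thesis by (simp add: distrib_left)
    qed
    have rot: "phase_rotation \<theta> X = ?S t (?T (sin \<theta>) (?S t X))" for X
    proof -
      have "fst (?S t (?T (sin \<theta>) (?S t X))) = (1 + t * sin \<theta>) *\<^sub>R fst X + (t *\<^sub>R snd X + (t * (1 + t * sin \<theta>)) *\<^sub>R snd X)"
        by (simp add: algebra_simps)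
      also have "\<dots> = (1 + t * sin \<theta>) *\<^sub>R fst X + (t + t * (1 + t * sin \<theta>)) *\<^sub>R snd X"
        by (simp only: scaleR_left_distrib)
      also have "\<dots> = cos \<theta> *\<^sub>R fst X - sin \<theta> *\<^sub>R snd X" unfolding ts tt by simp
      finally have 1: "fst (?S t (?T (sin \<theta>) (?S t X))) = cos \<theta> *\<^sub>R fst X - sin \<theta> *\<^sub>R snd X" .
      have "snd (?S t (?T (sin \<theta>) (?S t X))) = sin \<theta> *\<^sub>R fst X + (1 + t * sin \<theta>) *\<^sub>R snd X"
        by (simp add: algebra_simps)
      then have 2: "snd (?S t (?T (sin \<theta>) (?S t X))) = sin \<theta> *\<^sub>R fst X + cos \<theta> *\<^sub>R snd X" unfolding ts .
      show ?thesis using 1 2 by (intro prod_eqI) (simp_all add: phase_rotation_def)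
    qed
    have f1: "(\<lambda>X. f (?S t X)) \<in> borel_measurable borel" using measurable_compose[OF sm(1) f] .
    have f2: "(\<lambda>X. f (?S t (?T (sin \<theta>) X))) \<in> borel_measurable borel" using measurable_compose[OF sm(2) f1] .
    have "(\<integral>\<^sup>+X. f (phase_rotation \<theta> X) \<partial>lborel) = (\<integral>\<^sup>+X. f (?S t (?T (sin \<theta>) X)) \<partial>lborel)"
      unfolding rot using nn_integral_shear(1)[OF f2, of t] by simp
    also have "\<dots> = (\<integral>\<^sup>+X. f (?S t X) \<partial>lborel)" using nn_integral_shear(2)[OF f1, of "sin \<theta>"] by simp
    also have "\<dots> = (\<integral>\<^sup>+X. f X \<partial>lborel)" by (rule nn_integral_shear(1)[OF f])
    finally show ?thesis .
  qed
  show ?thesis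
  proof (cases "cos (\<theta>/2) = 0")
    case True
    \<comment> \<open>Otherwise the double angle formula would give cos (\<theta>/2) = - 1.\<close>
    have "cos (\<theta>/4) \<noteq> 0" using cos_double_cos[of "\<theta>/4"] True by auto
    then have h: "(\<integral>\<^sup>+X. g (phase_rotation (\<theta>/2) X) \<partial>lborel) = (\<integral>\<^sup>+X. g X \<partial>lborel)"
      if "g \<in> borel_measurable borel" for g :: "'a \<times> 'a \<Rightarrow> ennreal"
      using main[OF that, of "\<theta>/2"] by simp
    have "phase_rotation \<theta> X = phase_rotation (\<theta>/2) (phase_rotation (\<theta>/2) X)" for X :: "'a \<times> 'a"
    proof -
      have "cos \<theta> = cos (\<theta>/2) * cos (\<theta>/2) - sin (\<theta>/2) * sin (\<theta>/2)" "sin \<theta> = sin (\<theta>/2) * cos (\<theta>/2) + cos (\<theta>/2) * sin (\<theta>/2)"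
        using cos_add[of "\<theta>/2" "\<theta>/2"] sin_add[of "\<theta>/2" "\<theta>/2"] by simp_all
      then show ?thesis
        by (simp only: phase_rotation_def fst_conv snd_conv scaleR_diff_left scaleR_add_left scaleR_diff_right
            scaleR_add_right scaleR_scaleR) (simp add: algebra_simps)
    qed
    then show ?thesis using h[OF f] h[OF measurable_compose[OF phase_rotation_measurable f], of "\<theta>/2"] by simp
  qed (rule main[OF f])
qed

lemma lborel_distr_phase_rotation: "distr lborel borel (phase_rotation \<theta>) = lborel"
proof (rule measure_eqI)
  fix A :: "('a \<times> 'a) set" assume "A \<in> sets (distr lborel borel (phase_rotation \<theta>))"
  then have A: "A \<in> sets borel" by simp
  have m: "phase_rotation \<theta> \<in> lborel \<rightarrow>\<^sub>M borel" using phase_rotation_measurable by simp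
  have "emeasure (distr lborel borel (phase_rotation \<theta>)) A = (\<integral>\<^sup>+X. indicator A X \<partial>distr lborel borel (phase_rotation \<theta>))"
    using A by simp
  also have "\<dots> = (\<integral>\<^sup>+X. indicator A (phase_rotation \<theta> X) \<partial>lborel)"
    using A by (intro nn_integral_distr m) simp
  also have "\<dots> = (\<integral>\<^sup>+X. indicator A X \<partial>lborel)" using A by (intro nn_integral_phase_rotation) simp
  finally show "emeasure (distr lborel borel (phase_rotation \<theta>)) A = emeasure lborel A" using A by simp
qed simp

lemma integral_phase_rotation:
  fixes f :: "'a::euclidean_space \<times> 'a \<Rightarrow> complex"
  assumes f: "f \<in> borel_measurable borel"
  shows "(\<integral>X. f (phase_rotation \<theta> X) \<partial>lborel) = (\<integral>X. f X \<partial>lborel)"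
proof -
  have m: "phase_rotation \<theta> \<in> lborel \<rightarrow>\<^sub>M borel" using phase_rotation_measurable by simp
  have "(\<integral>X. f X \<partial>lborel) = (\<integral>X. f X \<partial>distr lborel borel (phase_rotation \<theta>))" by (simp only: lborel_distr_phase_rotation)
  also have "\<dots> = (\<integral>X. f (phase_rotation \<theta> X) \<partial>lborel)" by (rule integral_distr[OF m f])
  finally show ?thesis ..
qed

lemma phase_to_complex_rotation:
  "phase_to_complex (phase_rotation \<theta> X) = exp (- \<i> * of_real \<theta>) *s phase_to_complex X"
  by (simp add: phase_to_complex_def phase_rotation_def vec_eq_iff complex_eq_iff Re_exp Im_exp add_divide_distrib diff_divide_distrib algebra_simps)

lemma norm_phase_rotation: "norm (phase_rotation \<theta> X) = norm X" for X :: "'d::finite phase"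
proof -
  have "(norm (phase_to_complex (phase_rotation \<theta> X)))\<^sup>2 = (norm (phase_to_complex X))\<^sup>2"
    unfolding phase_to_complex_rotation norm_smult_complex by (simp add: norm_exp_eq_Re)
  then show ?thesis unfolding norm_phase_to_complex by (simp add: power2_eq_iff_nonneg)
qed

lemma integrable_gaussian_phase:
  assumes a: "0 < a"
  shows "integrable lborel (\<lambda>X::'d::finite phase. gaussian a X)"
proof -
  have "gaussian a X = (\<lambda>(x::real^'d, \<xi>::real^'d). gaussian a x * exp (- a * (norm \<xi>)\<^sup>2)) X" for X
    by (cases X) (simp add: exp_norm_Pair[of a, simplified])
  then show ?thesis using integrable_gaussian_pair[OF a a, where 'd = 'd] by simp
qed

lemma integral_gaussian_phase:
  "(\<integral>X. gaussian (1/2) X \<partial>(lborel :: ('d::finite phase) measure)) = (2 * pi) powr real CARD('d)"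
proof -
  let ?I = "\<integral>x. gaussian (1/2) x \<partial>(lborel :: (real^'d) measure)"
  have "integrable (lborel \<Otimes>\<^sub>M lborel) (\<lambda>X::'d phase. gaussian (1/2) X)"
    unfolding lborel_prod by (rule integrable_gaussian_phase) simp
  from lborel_pair.integral_fst'[OF this]
  have "(\<integral>X. gaussian (1/2) X \<partial>(lborel :: ('d phase) measure)) =
    (\<integral>x. \<integral>\<xi>. gaussian (1/2) (x::real^'d, \<xi>::real^'d) \<partial>lborel \<partial>lborel)"
    by (simp add: lborel_prod)
  also have "\<dots> = ?I * ?I"
    unfolding exp_norm_Pair by (simp only: integral_mult_right_zero integral_mult_left_zero)
  also have "?I = sqrt (2 * pi) ^ CARD('d)" using integral_gaussian[of "1/2", where 'd = 'd] by (simp add: mult.commute)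
  also have "sqrt (2 * pi) ^ CARD('d) * sqrt (2 * pi) ^ CARD('d) = (2 * pi) powr real CARD('d)"
    by (subst power_mult_distrib[symmetric]) (simp add: powr_realpow)
  finally show ?thesis .
qed

text \<open>The Gaussian is invariant under the rotations, so G may be replaced by its average over
  each circle, which is G 0. Since |z|^2 = |X|^2 / 2, growth at a rate b < 1 leaves Gaussian decay
  at rate (1 - b) / 2.\<close>

lemma entire_gaussian_mean:
  fixes G :: "complex^'d::finite \<Rightarrow> complex"
  assumes G: "entire G" and b: "b < 1" and le: "\<And>z. norm (G z) \<le> C * exp (b * (norm z)\<^sup>2)"
  shows "(\<integral>X. of_real (gaussian (1/2) X) * G (phase_to_complex X) \<partial>lborel) = of_real ((2 * pi) powr real CARD('d)) * G 0"
proof -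
  define H where "H = (\<lambda>X. complex_of_real (gaussian (1/2) X) * G (phase_to_complex X))"
  have cG: "continuous_on S G" for S using entire_continuous[OF G] continuous_on_subset by blast
  have cH: "continuous_on UNIV H" unfolding H_def
    by (intro continuous_intros continuous_on_compose2[OF cG[of UNIV]] phase_continuous) auto
  have [measurable]: "H \<in> borel_measurable borel" by (rule borel_measurable_continuous_onI[OF cH])
  define a where "a = (1 - b) / 2"
  have a: "a > 0" using b by (simp add: a_def)
  have Hle: "norm (H X) \<le> C * gaussian a X" for X
  proof -
    have "norm (H X) \<le> gaussian (1/2) X * (C * exp (b * (norm (phase_to_complex X))\<^sup>2))"
      unfolding H_def norm_mult norm_of_real by (intro mult_mono le) auto
    also have "\<dots> = C * exp (- (1/2) * (norm X)\<^sup>2 + b * ((norm X)\<^sup>2 / 2))"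
      unfolding norm_phase_to_complex exp_add by simp
    also have "- (1/2) * (norm X)\<^sup>2 + b * ((norm X)\<^sup>2 / 2) = - a * (norm X)\<^sup>2" by (simp add: a_def field_simps)
    finally show ?thesis .
  qed
  have C: "0 \<le> C" using order_trans[OF norm_ge_zero Hle[of 0]] by simp
  let ?e = "\<lambda>t. exp (2 * of_real pi * \<i> * complex_of_real t)"
  \<comment> \<open>The angle is negative because \<open>phase_rotation \<theta>\<close> acts as exp
    (- i \<theta>); thus z becomes exp (2 pi i t) z.\<close>
  let ?k = "\<lambda>(t::real) X. indicator {0..1} t *\<^sub>R H (phase_rotation (- 2 * pi * t) X)"
  have k_eq: "?k t X = of_real (gaussian (1/2) X) * (indicator {0..1} t *\<^sub>R G (?e t *s phase_to_complex X))" for t X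
    unfolding H_def norm_phase_rotation phase_to_complex_rotation by (simp add: mult_ac)
  have int: "integrable (lborel \<Otimes>\<^sub>M lborel) (\<lambda>(t, X). ?k t X)"
  proof (rule lborel_pair.Fubini_integrable)
    have "continuous_on UNIV (\<lambda>Z::real \<times> ('d phase). H (phase_rotation (- 2 * pi * fst Z) (snd Z)))"
      unfolding phase_rotation_def by (intro continuous_on_compose2[OF cH] continuous_intros) auto
    then have [measurable]: "(\<lambda>Z::real \<times> ('d phase). H (phase_rotation (- 2 * pi * fst Z) (snd Z))) \<in> borel_measurable (lborel \<Otimes>\<^sub>M lborel)"
      unfolding lborel_prod by (simp add: borel_measurable_continuous_onI)
    show "(\<lambda>(t, X). ?k t X) \<in> borel_measurable (lborel \<Otimes>\<^sub>M lborel)"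
      unfolding split_def by measurable
    have ki: "integrable lborel (\<lambda>X. ?k t X)" for t
    proof (rule Bochner_Integration.integrable_bound)
      show "integrable lborel (\<lambda>X::'d phase. C * gaussian a X)"
        by (intro integrable_mult_right integrable_gaussian_phase a)
      show "(\<lambda>X. ?k t X) \<in> borel_measurable lborel"
        using measurable_compose[OF phase_rotation_measurable, of H borel] by simp
      show "AE X in lborel. norm (?k t X) \<le> norm (C * gaussian a X)"
      proof (rule AE_I2)
        fix X :: "'d phase"
        have "norm (?k t X) \<le> norm (H (phase_rotation (- 2 * pi * t) X))" by (simp add: indicator_def)
        also have "\<dots> \<le> C * gaussian a X" using Hle[of "phase_rotation (- 2 * pi * t) X"] unfolding norm_phase_rotation .
        finally show "norm (?k t X) \<le> norm (C * gaussian a X)" unfolding real_norm_def by (rule order_trans) (rule abs_ge_self)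
      qed
    qed
    then show "AE t in lborel. integrable lborel (\<lambda>X. case (t, X) of (t, X) \<Rightarrow> ?k t X)" by simp
    have E: "(\<integral>X. norm (?k t X) \<partial>lborel) = indicator {0..1} t * (\<integral>X. norm (H X) \<partial>lborel)" for t
    proof -
      have m: "phase_rotation (- 2 * pi * t) \<in> lborel \<rightarrow>\<^sub>M borel" using phase_rotation_measurable by simp
      have "(\<integral>X. norm (H X) \<partial>lborel) = (\<integral>X. norm (H X) \<partial>distr lborel borel (phase_rotation (- 2 * pi * t)))" by (simp only: lborel_distr_phase_rotation)
      also have "\<dots> = (\<integral>X. norm (H (phase_rotation (- 2 * pi * t) X)) \<partial>lborel)" by (rule integral_distr[OF m]) measurable
      finally show ?thesis by (simp add: integral_mult_right_zero[symmetric] del: integral_mult_right_zero)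
    qed
    show "integrable lborel (\<lambda>t. \<integral>X. norm (case (t, X) of (t, X) \<Rightarrow> ?k t X) \<partial>lborel)"
      unfolding prod.case E by simp
  qed
  have "(\<integral>X. H X \<partial>lborel) = (\<integral>t. indicator {0..1::real} t *\<^sub>R (\<integral>X. H X \<partial>lborel) \<partial>lborel)"
    by simp
  also have "\<dots> = (\<integral>t. (\<integral>X. ?k t X \<partial>lborel) \<partial>lborel)"
    using integral_phase_rotation[of H] by simp
  also have "\<dots> = (\<integral>X. (\<integral>t. ?k t X \<partial>lborel) \<partial>lborel)"
    by (rule lborel_pair.Fubini_integral[OF int, symmetric])
  also have "\<dots> = (\<integral>X. of_real (gaussian (1/2) X) * G 0 \<partial>(lborel :: ('d phase) measure))"
  proof (rule Bochner_Integration.integral_cong[OF refl])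
    fix X :: "'d phase"
    obtain g' where g': "\<And>t. ((\<lambda>t. G (0 + t *s phase_to_complex X)) has_field_derivative g' t) (at t)"
      using entire_line[OF G] by blast
    from circle_mean_value[OF g'] show "(\<integral>t. ?k t X \<partial>lborel) = of_real (gaussian (1/2) X) * G 0"
      unfolding k_eq integral_mult_right_zero by simp
  qed
  also have "\<dots> = of_real ((2 * pi) powr real CARD('d)) * G 0"
    by (simp only: integral_mult_left_zero integral_complex_of_real integral_gaussian_phase)
  finally show ?thesis by (simp add: H_def)
qed

section \<open>The reproducing formula and surjectivity\<close>

text \<open>This is the reproducing kernel of the short-time Fourier transform, centred at X0: the
  product of two windows is a Gaussian around the midpoint of their centres, whose transform is
  explicit.\<close>

lemma stft_pair_gabor_atom:
  fixes X0 Y :: "'d::finite phase"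
  shows "stft_pair (gabor_atom X0) (X0 + Y) =
    of_real (gaussian (1/4) Y) * iexp (snd Y \<bullet> (fst X0 + (1/2) *\<^sub>R fst Y))"
proof -
  obtain x0 \<xi>0 p q where X0: "X0 = (x0, \<xi>0)" and Y: "Y = (p, q)" by (cases X0, cases Y)
  define k where "k = pi powr (- (real CARD('d) / 4))"
  \<comment> \<open>Midpoint of the window centres x0 and x0 + p; translating by it separates the
    variables.\<close>
  define m where "m = x0 + (1/2) *\<^sub>R p"
  let ?f = "\<lambda>y. gabor_atom X0 y * of_real (gauss_window (y - (x0 + p))) * iexp (y \<bullet> (\<xi>0 + q))"
  have [measurable]: "gabor_atom X0 \<in> borel_measurable borel" unfolding gabor_atom_def by measurable
  have "stft_pair (gabor_atom X0) (X0 + Y) = (\<integral>y. ?f y \<partial>lborel)"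
    unfolding stft_pair_def fourier_def X0 Y by simp
  also have "\<dots> = (\<integral>v. ?f (m + v) \<partial>lborel)"
    by (rule integral_lborel_translate[symmetric]) measurable
  also have "?f (m + v) = (of_real (k\<^sup>2 * gaussian (1/4) p) * iexp (m \<bullet> q)) * (of_real (gaussian (2 / 2) v) * iexp (v \<bullet> q))" for v
  proof -
    have "(norm (m + v - x0))\<^sup>2 + (norm (m + v - (x0 + p)))\<^sup>2 = 2 * (norm v)\<^sup>2 + (norm p)\<^sup>2 / 2"
      unfolding m_def by (simp add: power2_norm_eq_inner inner_simps inner_commute algebra_simps)
    then have "- (1/2) * (norm (m + v - x0))\<^sup>2 + - (1/2) * (norm (m + v - (x0 + p)))\<^sup>2 = - (1/4) * (norm p)\<^sup>2 + - (2/2) * (norm v)\<^sup>2"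
      by simp
    from arg_cong[OF this, of exp]
    have "gauss_window (m + v - x0) * gauss_window (m + v - (x0 + p)) = k\<^sup>2 * gaussian (1/4) p * gaussian (2/2) v"
      unfolding exp_add gauss_window_eq k_def[symmetric] by (simp only: power2_eq_square mult_ac)
    then have g: "complex_of_real (gauss_window (m + v - x0)) * complex_of_real (gauss_window (m + v - (x0 + p))) =
      of_real (k\<^sup>2 * gaussian (1/4) p) * of_real (gaussian (2/2) v)"
      by (simp only: of_real_mult[symmetric])
    have "- (\<i> * of_real ((m + v) \<bullet> \<xi>0)) + \<i> * of_real ((m + v) \<bullet> (\<xi>0 + q)) = \<i> * of_real (m \<bullet> q) + \<i> * complex_of_real (v \<bullet> q)"
      by (simp add: inner_simps algebra_simps)
    from arg_cong[OF this, of exp]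
    have e: "exp (- (\<i> * of_real ((m + v) \<bullet> \<xi>0))) * iexp ((m + v) \<bullet> (\<xi>0 + q)) = iexp (m \<bullet> q) * iexp (v \<bullet> q)"
      unfolding exp_add .
    have "?f (m + v) = (complex_of_real (gauss_window (m + v - x0)) * complex_of_real (gauss_window (m + v - (x0 + p)))) *
      (exp (- (\<i> * of_real ((m + v) \<bullet> \<xi>0))) * iexp ((m + v) \<bullet> (\<xi>0 + q)))"
      by (simp add: gabor_atom_def X0 mult_ac)
    then show ?thesis unfolding g e by (simp only: mult_ac)
  qed
  then have "(\<integral>v. ?f (m + v) \<partial>lborel) = (of_real (k\<^sup>2 * gaussian (1/4) p) * iexp (m \<bullet> q)) *
     (\<integral>v. of_real (gaussian (2 / 2) v) * iexp (v \<bullet> q) \<partial>(lborel :: (real^'d) measure))"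
    by (simp only: integral_mult_right_zero)
  also have "\<dots> = (of_real (k\<^sup>2 * gaussian (1/4) p) * iexp (m \<bullet> q)) * of_real (sqrt pi ^ CARD('d) * gaussian (1/4) q)"
    using fourier_gaussian[of 2 q] by simp
  also have "\<dots> = of_real ((k\<^sup>2 * sqrt pi ^ CARD('d)) * (gaussian (1/4) p * gaussian (1/4) q)) * iexp (m \<bullet> q)"
    by (simp only: of_real_mult mult_ac)
  also have "k\<^sup>2 * sqrt pi ^ CARD('d) = 1"
  proof -
    have "k\<^sup>2 = pi powr (- (real CARD('d) / 2))"
      by (simp add: k_def power2_eq_square powr_add[symmetric])
    moreover have "sqrt pi ^ CARD('d) = pi powr (real CARD('d) / 2)"
      by (simp add: powr_half_sqrt[symmetric] powr_realpow[symmetric] powr_powr)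
    ultimately show ?thesis by (simp add: powr_add[symmetric])
  qed
  finally show ?thesis unfolding X0 Y exp_norm_Pair m_def by (simp add: inner_commute)
qed

text \<open>The vector of the fst X0 $ j + i (snd X0 $ j) is sqrt 2 times the conjugate of
  \<open>phase_to_complex X0\<close>, so this is the pairing in the exponent of the Fock space
  kernel.\<close>

lemma cbilin_phase_dual:
  fixes X0 Y :: "'d::finite phase"
  shows "of_real (1 / sqrt 2) * cbilin (\<chi> j. of_real (fst X0 $ j) + \<i> * of_real (snd X0 $ j)) (phase_to_complex Y) =
    of_real ((fst X0 \<bullet> fst Y + snd X0 \<bullet> snd Y) / 2) + \<i> * of_real ((snd X0 \<bullet> fst Y - fst X0 \<bullet> snd Y) / 2)"
proof -
  have s: "complex_of_real (sqrt 2) * complex_of_real (sqrt 2) = 2"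
    by (simp flip: of_real_mult)
  have "of_real (1 / sqrt 2) * cbilin (\<chi> j. of_real (fst X0 $ j) + \<i> * of_real (snd X0 $ j)) (phase_to_complex Y) =
    (\<Sum>j\<in>UNIV. of_real ((fst X0 $ j * fst Y $ j + snd X0 $ j * snd Y $ j) / 2) + \<i> * of_real ((snd X0 $ j * fst Y $ j - fst X0 $ j * snd Y $ j) / 2))"
    unfolding cbilin_def phase_to_complex_def sum_distrib_left
    by (intro sum.cong refl) (simp add: s field_simps)
  also have "\<dots> = of_real ((fst X0 \<bullet> fst Y + snd X0 \<bullet> snd Y) / 2) + \<i> * of_real ((snd X0 \<bullet> fst Y - fst X0 \<bullet> snd Y) / 2)"
    unfolding inner_vec_def sum.distrib sum_distrib_left[symmetric] of_real_sum[symmetric] sum_divide_distrib[symmetric] sum_subtractf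
    by simp
  finally show ?thesis .
qed

text \<open>Recentred at X0, all factors that are not holomorphic combine into one centred Gaussian;
  what remains is an entire function of \<open>phase_to_complex Y\<close>, ready for the Gaussian
  mean.\<close>

lemma reproducing_integrand:
  fixes F :: "complex^'d::finite \<Rightarrow> complex" and X0 Y :: "'d phase"
  defines "w \<equiv> (\<chi> j. of_real (fst X0 $ j) + \<i> * of_real (snd X0 $ j)) :: complex^'d"
  shows "stft_pair (gabor_atom X0) (X0 + Y) * (phase_factor (X0 + Y) * F (phase_to_complex (X0 + Y))) =
    phase_factor X0 * (of_real (gaussian (1/2) Y) *
      (exp (- (of_real (1 / sqrt 2) * cbilin w (phase_to_complex Y))) * F (phase_to_complex X0 + phase_to_complex Y)))"
proof -
  obtain x0 \<xi>0 p q where X0: "X0 = (x0, \<xi>0)" and Y: "Y = (p, q)" by (cases X0, cases Y)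
  have n: "(norm (x0 + p))\<^sup>2 = (norm x0)\<^sup>2 + 2 * (x0 \<bullet> p) + (norm p)\<^sup>2" "(norm (\<xi>0 + q))\<^sup>2 = (norm \<xi>0)\<^sup>2 + 2 * (\<xi>0 \<bullet> q) + (norm q)\<^sup>2"
    by (simp_all add: power2_norm_eq_inner inner_simps inner_commute)
  have "of_real (- (1/4) * ((norm p)\<^sup>2 + (norm q)\<^sup>2)) + \<i> * of_real (q \<bullet> (x0 + (1/2) *\<^sub>R p)) +
     (of_real (- (((norm (x0 + p))\<^sup>2 + (norm (\<xi>0 + q))\<^sup>2) / 4)) + - (\<i> * of_real ((x0 + p) \<bullet> (\<xi>0 + q)) / 2)) =
     of_real (- (((norm x0)\<^sup>2 + (norm \<xi>0)\<^sup>2) / 4)) + - (\<i> * of_real (x0 \<bullet> \<xi>0) / 2) +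
     (of_real (- (1/2) * ((norm p)\<^sup>2 + (norm q)\<^sup>2)) + - (of_real ((x0 \<bullet> p + \<xi>0 \<bullet> q) / 2) + \<i> * complex_of_real ((\<xi>0 \<bullet> p - x0 \<bullet> q) / 2)))"
    unfolding n by (simp add: complex_eq_iff inner_simps inner_commute field_simps)
  then have "of_real (- (1/4) * (norm Y)\<^sup>2) + \<i> * of_real (snd Y \<bullet> (fst X0 + (1/2) *\<^sub>R fst Y)) +
     (of_real (- (((norm (fst (X0 + Y)))\<^sup>2 + (norm (snd (X0 + Y)))\<^sup>2) / 4)) + - (\<i> * of_real (fst (X0 + Y) \<bullet> snd (X0 + Y)) / 2)) =
     of_real (- (((norm (fst X0))\<^sup>2 + (norm (snd X0))\<^sup>2) / 4)) + - (\<i> * of_real (fst X0 \<bullet> snd X0) / 2) +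
     (of_real (- (1/2) * (norm Y)\<^sup>2) + - (of_real (1 / sqrt 2) * cbilin w (phase_to_complex Y)))"
    unfolding w_def cbilin_phase_dual unfolding X0 Y norm_Pair_power2 by simp
  from arg_cong[OF this, of exp]
  have "(of_real (gaussian (1/4) Y) * iexp (snd Y \<bullet> (fst X0 + (1/2) *\<^sub>R fst Y))) * phase_factor (X0 + Y) =
    phase_factor X0 * (of_real (gaussian (1/2) Y) * exp (- (of_real (1 / sqrt 2) * cbilin w (phase_to_complex Y))))"
    by (simp only: exp_add exp_of_real phase_factor_def)
  then show ?thesis unfolding stft_pair_gabor_atom phase_to_complex_add mult.assoc[symmetric] by (simp only:)
qed

lemma bounded_linear_cbilin: "bounded_linear (cbilin w)"
proof (rule bounded_linear_intro[where K = "\<Sum>j\<in>UNIV. norm (w $ j)"])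
  fix z
  have "norm (cbilin w z) \<le> (\<Sum>j\<in>UNIV. norm (w $ j) * norm z)"
    unfolding cbilin_def by (rule sum_norm_le) (auto simp: norm_mult intro!: mult_left_mono Finite_Cartesian_Product.norm_nth_le)
  then show "norm (cbilin w z) \<le> norm z * (\<Sum>j\<in>UNIV. norm (w $ j))" by (simp add: sum_distrib_left mult.commute)
qed (auto simp: cbilin_def sum.distrib algebra_simps scaleR_sum_right)

lemma entire_exp_linear_mult_shift:
  assumes F: "entire F"
  shows "entire (\<lambda>z. exp (- (c * cbilin w z)) * F (a + z))"
  unfolding entire_def
proof
  fix z
  obtain F' where F': "(F has_derivative F') (at (a + z))" and lin: "\<And>c v. F' (c *s v) = c * F' v"
    using F unfolding entire_def by blast
  have s: "((\<lambda>z. F (a + z)) has_derivative F') (at z)"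
    using has_derivative_compose[OF has_derivative_add[OF has_derivative_const has_derivative_ident] F'] by simp
  have "((\<lambda>z. - (c * cbilin w z)) has_derivative (\<lambda>v. - (c * cbilin w v))) (at z)"
    by (intro has_derivative_minus has_derivative_mult_right bounded_linear_imp_has_derivative bounded_linear_cbilin)
  from has_derivative_compose[OF this DERIV_exp[unfolded has_field_derivative_def]]
  have e: "((\<lambda>z. exp (- (c * cbilin w z))) has_derivative (\<lambda>v. exp (- (c * cbilin w z)) * - (c * cbilin w v))) (at z)" .
  have cl: "cbilin w (k *s v) = k * cbilin w v" for k v
    by (simp add: cbilin_def sum_distrib_left mult_ac)
  show "\<exists>F'. ((\<lambda>z. exp (- (c * cbilin w z)) * F (a + z)) has_derivative F') (at z) \<and> (\<forall>k v. F' (k *s v) = k * F' v)"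
    by (rule exI, rule conjI, rule has_derivative_mult[OF e s]) (simp add: cl lin algebra_simps)
qed

text \<open>After translation by X0 the integral is the Gaussian mean of an entire G with G 0 = F
  (\<open>phase_to_complex X0\<close>). The rate 1/16 is one convenient choice below 1/4; it keeps
  the growth of G below the critical rate 1.\<close>

lemma reproducing_formula:
  fixes F :: "complex^'d::finite \<Rightarrow> complex"
  assumes F: "entire F" and C: "\<And>X. norm (phase_factor X * F (phase_to_complex X)) \<le> C * exp (1/16 * (norm X)\<^sup>2)"
  shows "(\<integral>X. stft_pair (gabor_atom X0) X * (phase_factor X * F (phase_to_complex X)) \<partial>lborel) =
    of_real ((2 * pi) powr real CARD('d)) * (phase_factor X0 * F (phase_to_complex X0))"
proof -
  define w where "w = ((\<chi> j. of_real (fst X0 $ j) + \<i> * of_real (snd X0 $ j)) :: complex^'d)"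
  define G where "G = (\<lambda>z. exp (- (of_real (1 / sqrt 2) * cbilin w z)) * F (phase_to_complex X0 + z))"
  have G: "entire G" unfolding G_def by (rule entire_exp_linear_mult_shift[OF F])
  have C0: "0 \<le> C" using order_trans[OF norm_ge_zero C[of 0]] by simp
  \<comment> \<open>In terms of X the rate is 1/4 + 1/16 = 5/16, and in terms of z it
    doubles.\<close>
  have FC: "norm (F z) \<le> C * exp (5/8 * (norm z)\<^sup>2)" for z
  proof -
    obtain X where X: "phase_to_complex X = z" using surj_phase_to_complex by blast
    have X2: "(norm X)\<^sup>2 = 2 * (norm z)\<^sup>2" using norm_phase_to_complex[of X] by (simp add: X)
    have "gaussian (1/4) X * norm (F z) \<le> C * exp (1/16 * (norm X)\<^sup>2)"
      using C[of X] by (simp add: norm_mult norm_phase_factor X)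
    then have "exp (1/4 * (norm X)\<^sup>2) * (gaussian (1/4) X * norm (F z)) \<le> exp (1/4 * (norm X)\<^sup>2) * (C * exp (1/16 * (norm X)\<^sup>2))"
      by (rule mult_left_mono) simp
    then have "(exp (1/4 * (norm X)\<^sup>2) * gaussian (1/4) X) * norm (F z) \<le> C * (exp (1/4 * (norm X)\<^sup>2) * exp (1/16 * (norm X)\<^sup>2))"
      by (simp only: mult_ac)
    moreover have "exp (1/4 * (norm X)\<^sup>2) * gaussian (1/4) X = 1" unfolding exp_add[symmetric] by simp
    moreover have "exp (1/4 * (norm X)\<^sup>2) * exp (1/16 * (norm X)\<^sup>2) = exp (5/8 * (norm z)\<^sup>2)"
      unfolding exp_add[symmetric] X2 by (simp add: algebra_simps)
    ultimately show ?thesis by (simp only: mult_1_left)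
  qed
  define k where "k = (\<Sum>j\<in>UNIV. norm (w $ j))"
  have k: "0 \<le> k" by (simp add: k_def sum_nonneg)
  define a where "a = norm (phase_to_complex X0)"
  \<comment> \<open>Coefficient of the linear term in s: 5/4 a from the shifted square and k from
    the exponential factor. Absorbing it takes s^2 / 8, and 5/8 + 1/8 = 3/4.\<close>
  define m where "m = 5/4 * a + k"
  have "norm (G z) \<le> (C * exp (5/8 * a\<^sup>2 + 2 * m\<^sup>2)) * exp (3/4 * (norm z)\<^sup>2)" for z
  proof -
    define s where "s = norm z"
    have s0: "0 \<le> s" by (simp add: s_def)
    have "norm (cbilin w z) \<le> k * s"
      unfolding cbilin_def k_def s_def sum_distrib_right by (rule sum_norm_le) (auto simp: norm_mult intro!: mult_left_mono Finite_Cartesian_Product.norm_nth_le)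
    then have "(1 / sqrt 2) * norm (cbilin w z) \<le> 1 * (k * s)" by (intro mult_mono) auto
    then have n: "norm (of_real (1 / sqrt 2) * cbilin w z) \<le> k * s" unfolding norm_mult norm_of_real by simp
    have "Re (- (of_real (1 / sqrt 2) * cbilin w z)) \<le> k * s"
      by (rule order_trans[OF complex_Re_le_cmod]) (simp only: norm_minus_cancel n)
    then have e: "norm (exp (- (of_real (1 / sqrt 2) * cbilin w z))) \<le> exp (k * s)"
      unfolding norm_exp_eq_Re by (simp only: exp_le_cancel_iff)
    have "norm (phase_to_complex X0 + z) \<le> a + s" unfolding a_def s_def by (rule norm_triangle_ineq)
    then have "(norm (phase_to_complex X0 + z))\<^sup>2 \<le> (a + s)\<^sup>2" by (rule power_mono) simp
    then have FCs: "C * exp (5/8 * (norm (phase_to_complex X0 + z))\<^sup>2) \<le> C * exp (5/8 * (a + s)\<^sup>2)"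
      using C0 by (intro mult_left_mono) auto
    then have "norm (G z) \<le> exp (k * s) * (C * exp (5/8 * (a + s)\<^sup>2))"
      unfolding G_def norm_mult by (intro mult_mono e order_trans[OF FC FCs]) auto
    also have "\<dots> = C * exp (k * s + 5/8 * (a + s)\<^sup>2)" by (simp add: exp_add)
    also have "\<dots> \<le> C * exp ((5/8 * a\<^sup>2 + 2 * m\<^sup>2) + 3/4 * s\<^sup>2)"
    proof -
      have "0 \<le> (s - 4 * m)\<^sup>2" by simp
      then have "m * s \<le> s\<^sup>2 / 8 + 2 * m\<^sup>2" by (simp add: power2_eq_square field_simps)
      then have "k * s + 5/8 * (a + s)\<^sup>2 \<le> (5/8 * a\<^sup>2 + 2 * m\<^sup>2) + 3/4 * s\<^sup>2"
        unfolding m_def by (simp add: power2_eq_square algebra_simps)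
      then show ?thesis using C0 by (intro mult_left_mono) auto
    qed
    finally show ?thesis by (simp add: exp_add s_def mult.assoc)
  qed
  from entire_gaussian_mean[OF G _ this]
  have mean: "(\<integral>Y. of_real (gaussian (1/2) Y) * G (phase_to_complex Y) \<partial>lborel) = of_real ((2 * pi) powr real CARD('d)) * G 0"
    by simp
  let ?h = "\<lambda>X. stft_pair (gabor_atom X0) X * (phase_factor X * F (phase_to_complex X))"
  have cF: "continuous_on S F" for S using entire_continuous[OF F] continuous_on_subset by blast
  have "gabor_atom X0 \<in> borel_measurable borel" unfolding gabor_atom_def by measurable
  note [measurable] = stft_pair_measurable[OF this]
  have [measurable]: "(\<lambda>X. phase_factor X * F (phase_to_complex X)) \<in> borel_measurable borel"
    by (intro borel_measurable_continuous_onI continuous_intros continuous_on_compose2[OF cF[of UNIV]] phase_continuous) auto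
  have "(\<integral>X. ?h X \<partial>lborel) = (\<integral>Y. ?h (X0 + Y) \<partial>lborel)"
    by (rule integral_lborel_translate[symmetric]) measurable
  also have "\<dots> = phase_factor X0 * (\<integral>Y. of_real (gaussian (1/2) Y) * G (phase_to_complex Y) \<partial>lborel)"
    unfolding reproducing_integrand integral_mult_right_zero G_def w_def ..
  also have "\<dots> = of_real ((2 * pi) powr real CARD('d)) * (phase_factor X0 * F (phase_to_complex X0))"
    unfolding mean by (simp add: G_def cbilin_def)
  finally show ?thesis .
qed

section \<open>Construction of the functional with a prescribed Bargmann transform\<close>

lemma GS_step_mono:
  fixes f :: "real^'d::finite \<Rightarrow> complex"
  assumes h: "0 < h" "h \<le> h'" and f: "f \<in> GS_step s h"
  shows "f \<in> GS_step s h'"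
proof (rule GS_norm_le(2)[OF GS_stepD(1)[OF f h(1)]])
  show "0 < h'" using h by simp
  fix x and \<beta> :: "'d \<Rightarrow> nat" and "is"
  have "GS_weight s h is \<beta> \<le> GS_weight s h' is \<beta>"
    using h by (intro mult_right_mono power_mono) auto
  then have "enn2real (GS_norm s h f) * GS_weight s h is \<beta> \<le> enn2real (GS_norm s h f) * GS_weight s h' is \<beta>"
    by (rule mult_left_mono) simp
  with GS_stepD(2)[OF f h(1), of x \<beta> "is"]
  show "\<bar>multi_power x \<beta>\<bar> * norm (iter_partial is f x) \<le> enn2real (GS_norm s h f) * GS_weight s h' is \<beta>" by linarith
qed

lemma GS_add: "f \<in> GS s \<Longrightarrow> g \<in> GS s \<Longrightarrow> (\<lambda>x. f x + g x) \<in> GS s"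
proof -
  assume "f \<in> GS s" "g \<in> GS s"
  then obtain h h' where h: "0 < h" "f \<in> GS_step s h" "0 < h'" "g \<in> GS_step s h'" by (auto simp: GS_def)
  then have "f \<in> GS_step s (max h h')" "g \<in> GS_step s (max h h')" by (auto intro: GS_step_mono)
  then show ?thesis using h by (intro GS_step_imp_GS[of "max h h'"] GS_step_add) auto
qed

lemma GS_cmult: "f \<in> GS s \<Longrightarrow> (\<lambda>x. c * f x) \<in> GS s"
  by (auto simp: GS_def intro: GS_step_cmult)

lemma stft_pair_linear:
  fixes f g :: "real^'d::finite \<Rightarrow> complex"
  assumes "f \<in> GS (1/2)" "g \<in> GS (1/2)"
  shows "stft_pair (\<lambda>x. f x + g x) X = stft_pair f X + stft_pair g X"
    and "stft_pair (\<lambda>x. c * f x) X = c * stft_pair f X"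
proof -
  have int: "integrable lborel (\<lambda>y. f y * of_real (gauss_window (y - fst X)) * iexp (y \<bullet> snd X))" if fG: "f \<in> GS (1/2)" for f :: "real^'d \<Rightarrow> complex"
  proof -
    obtain h where h: "0 < h" and f: "f \<in> GS_step (1/2) h" using fG by (auto simp: GS_def)
    obtain C where C: "C \<ge> 0" "\<And>y. norm (f y) \<le> C * enn2real (GS_norm (1/2) h f) * gaussian (1 / (4 * h\<^sup>2)) y"
      using GS_fourier_decay[OF h, where 'd = 'd] f by blast
    note [measurable] = smooth_borel_measurable[OF GS_stepD(1)[OF f h]]
    show ?thesis
    proof (rule integrable_gaussian_bound)
      show "0 < 1 / (4 * h\<^sup>2)" using h by simp
      fix y
      have "gauss_window (y - fst X) \<le> pi powr (- (real CARD('d) / 4))"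
        by (simp add: gauss_window_eq mult_left_le)
      then have "norm (f y) * gauss_window (y - fst X) \<le> (C * enn2real (GS_norm (1/2) h f) * gaussian (1 / (4 * h\<^sup>2)) y) * pi powr (- (real CARD('d) / 4))"
        using C by (intro mult_mono gauss_window_nonneg) auto
      then show "norm (f y * of_real (gauss_window (y - fst X)) * iexp (y \<bullet> snd X)) \<le>
        (C * enn2real (GS_norm (1/2) h f) * pi powr (- (real CARD('d) / 4))) * gaussian (1 / (4 * h\<^sup>2)) y"
        by (simp add: norm_mult gauss_window_nonneg mult_ac)
    qed measurable
  qed
  show "stft_pair (\<lambda>x. f x + g x) X = stft_pair f X + stft_pair g X"
    unfolding stft_pair_def fourier_def distrib_right
    by (rule Bochner_Integration.integral_add[OF int[OF assms(1)] int[OF assms(2)]])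
  show "stft_pair (\<lambda>x. c * f x) X = c * stft_pair f X"
    unfolding stft_pair_def fourier_def mult.assoc by (rule integral_mult_right_zero)
qed

lemma gabor_atom_GS: "gabor_atom X \<in> GS (1/2)"
  unfolding gabor_atom_eq by (intro GS_cmult bargmann_kernel_GS)

text \<open>The functional is forced: pairing u with the inversion formula for f leaves u evaluated
  at Gabor atoms, that is, \<open>phase_factor X\<close> times the transform at
  \<open>phase_to_complex X\<close>. Replacing the transform by F gives the definition, and the
  reproducing formula verifies it.\<close>

lemma bargmann_surjective:
  fixes F :: "complex^'d::finite \<Rightarrow> complex"
  assumes F: "entire F"
    and growth: "\<And>\<epsilon>. 0 < \<epsilon> \<Longrightarrow> \<exists>C\<ge>0. \<forall>X. norm (phase_factor X * F (phase_to_complex X)) \<le> C * exp (\<epsilon> * (norm X)\<^sup>2)"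
  shows "\<exists>u\<in>GS_dual (1/2). bargmann u = F"
proof -
  define S where "S = (\<lambda>X. phase_factor X * F (phase_to_complex X))"
  let ?c = "complex_of_real ((2 * pi) powr (- real CARD('d)))"
  have cF: "continuous_on A F" for A using entire_continuous[OF F] continuous_on_subset by blast
  have [measurable]: "S \<in> borel_measurable borel" unfolding S_def
    by (intro borel_measurable_continuous_onI continuous_intros continuous_on_compose2[OF cF[of UNIV]] phase_continuous) auto
  have bound: "\<exists>D\<ge>0. \<forall>f\<in>GS_step (1/2) h. integrable lborel (\<lambda>X. stft_pair f X * S X) \<and>
    norm (\<integral>X. stft_pair f X * S X \<partial>lborel) \<le> D * enn2real (GS_norm (1/2) h f)" if h: "0 < h" for h
  proof -
    obtain C r where C: "C \<ge> 0" and r: "r > 0" and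
      st: "\<And>f X. f \<in> GS_step (1/2) h \<Longrightarrow> norm (stft_pair f (X::'d phase)) \<le> C * enn2real (GS_norm (1/2) h f) * gaussian r X"
      using stft_pair_decay[OF h, where 'd = 'd] by blast
    \<comment> \<open>The growth bound is used at half the decay rate r belonging to this h;
      continuity on every step therefore needs it at every positive rate.\<close>
    obtain C' where C': "C' \<ge> 0" and S: "\<And>X. norm (S X) \<le> C' * exp (r/2 * (norm X)\<^sup>2)"
      using growth[of "r/2"] r unfolding S_def by auto
    define I where "I = (\<integral>X. gaussian (r/2) X \<partial>(lborel :: ('d phase) measure))"
    have I: "I \<ge> 0" unfolding I_def by (rule integral_nonneg_AE) auto
    have "integrable lborel (\<lambda>X. stft_pair f X * S X) \<and>
      norm (\<integral>X. stft_pair f X * S X \<partial>lborel) \<le> (C * C' * I) * enn2real (GS_norm (1/2) h f)" if f: "f \<in> GS_step (1/2) h" for f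
    proof
      let ?N = "enn2real (GS_norm (1/2) h f)"
      note [measurable] = stft_pair_measurable[OF smooth_borel_measurable[OF GS_stepD(1)[OF f h]]]
      have le: "norm (stft_pair f X * S X) \<le> (C * C' * ?N) * gaussian (r/2) X" for X
      proof -
        have "norm (stft_pair f X * S X) \<le> (C * ?N * gaussian r X) * (C' * exp (r/2 * (norm X)\<^sup>2))"
          unfolding norm_mult using C by (intro mult_mono st f S) auto
        also have "\<dots> = (C * C' * ?N) * exp (- r * (norm X)\<^sup>2 + r/2 * (norm X)\<^sup>2)" by (simp only: exp_add mult_ac)
        also have "- r * (norm X)\<^sup>2 + r/2 * (norm X)\<^sup>2 = - (r/2) * (norm X)\<^sup>2" by (simp add: field_simps)
        finally show ?thesis .
      qed
      have intr: "integrable lborel (\<lambda>X::'d phase. (C * C' * ?N) * gaussian (r/2) X)"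
        using r by (intro integrable_mult_right integrable_gaussian_phase) auto
      show int: "integrable lborel (\<lambda>X. stft_pair f X * S X)"
      proof (rule Bochner_Integration.integrable_bound[OF intr])
        show "AE X in lborel. norm (stft_pair f X * S X) \<le> norm ((C * C' * ?N) * gaussian (r/2) X)"
          unfolding real_norm_def by (intro AE_I2 order_trans[OF le] abs_ge_self)
      qed measurable
      have "norm (\<integral>X. stft_pair f X * S X \<partial>lborel) \<le> (\<integral>X. (C * C' * ?N) * gaussian (r/2) X \<partial>(lborel :: ('d phase) measure))"
        by (rule Bochner_Integration.integral_norm_bound_integral) (rule int, rule intr, rule le)
      also have "\<dots> = (C * C' * ?N) * I" unfolding I_def by (rule integral_mult_right_zero)
      finally show "norm (\<integral>X. stft_pair f X * S X \<partial>lborel) \<le> (C * C' * I) * ?N" by (simp add: mult_ac)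
    qed
    moreover have "C * C' * I \<ge> 0" using C C' I by simp
    ultimately show ?thesis by blast
  qed
  have int: "integrable lborel (\<lambda>X. stft_pair f X * S X)" if "f \<in> GS (1/2)" for f
    using that bound unfolding GS_def by blast
  \<comment> \<open>The value 0 outside \<open>GS (1/2)\<close> is the normalisation built into
    \<open>GS_dual\<close>.\<close>
  define u where "u = (\<lambda>f. if f \<in> GS (1/2) then ?c * (\<integral>X. stft_pair f X * S X \<partial>lborel) else 0)"
  have u: "u \<in> GS_dual (1/2)"
    unfolding GS_dual_def
  proof (intro CollectI conjI ballI allI impI)
    fix f g :: "real^'d \<Rightarrow> complex" assume f: "f \<in> GS (1/2)" and g: "g \<in> GS (1/2)"
    have "(\<integral>X. stft_pair (\<lambda>x. f x + g x) X * S X \<partial>lborel) = (\<integral>X. stft_pair f X * S X \<partial>lborel) + (\<integral>X. stft_pair g X * S X \<partial>lborel)"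
      unfolding stft_pair_linear(1)[OF f g] distrib_right by (rule Bochner_Integration.integral_add[OF int[OF f] int[OF g]])
    then show "u (\<lambda>x. f x + g x) = u f + u g"
      using f g GS_add[OF f g] by (simp add: u_def distrib_left)
  next
    fix c and f :: "real^'d \<Rightarrow> complex" assume f: "f \<in> GS (1/2)"
    have "(\<integral>X. stft_pair (\<lambda>x. c * f x) X * S X \<partial>lborel) = c * (\<integral>X. stft_pair f X * S X \<partial>lborel)"
      unfolding stft_pair_linear(2)[OF f f] mult.assoc by (rule integral_mult_right_zero)
    then show "u (\<lambda>x. c * f x) = c * u f" using f GS_cmult[OF f] by (simp add: u_def)
  next
    fix h :: real assume h: "0 < h"
    obtain D where D: "D \<ge> 0" "\<And>f. f \<in> GS_step (1/2) h \<Longrightarrow> norm (\<integral>X. stft_pair f X * S X \<partial>lborel) \<le> D * enn2real (GS_norm (1/2) h f)"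
      using bound[OF h] by blast
    show "\<exists>C::real. \<forall>f\<in>GS_step (1/2) h. ennreal (norm (u f)) \<le> ennreal C * GS_norm (1/2) h f"
    proof (intro exI ballI)
      fix f :: "real^'d \<Rightarrow> complex" assume f: "f \<in> GS_step (1/2) h"
      let ?N = "enn2real (GS_norm (1/2) h f)"
      have N: "GS_norm (1/2) h f = ennreal ?N" using f by (simp add: GS_step_def top.not_eq_extremum)
      have "norm (u f) = norm ?c * norm (\<integral>X. stft_pair f X * S X \<partial>lborel)"
        using GS_step_imp_GS[OF h f] by (simp add: u_def norm_mult)
      also have "\<dots> \<le> norm ?c * (D * ?N)" by (intro mult_left_mono D f) auto
      finally have "ennreal (norm (u f)) \<le> ennreal ((norm ?c * D) * ?N)" by (simp add: mult.assoc ennreal_leI)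
      also have "\<dots> = ennreal (norm ?c * D) * GS_norm (1/2) h f"
        using D by (subst N) (rule ennreal_mult, auto)
      finally show "ennreal (norm (u f)) \<le> ennreal (norm ?c * D) * GS_norm (1/2) h f" .
    qed
  next
    fix f :: "real^'d \<Rightarrow> complex" assume "f \<notin> GS (1/2)"
    then show "u f = 0" by (simp add: u_def)
  qed
  obtain C where C: "\<And>X. norm (phase_factor X * F (phase_to_complex X)) \<le> C * exp (1/16 * (norm X)\<^sup>2)"
    using growth[of "1/16"] by auto
  have "bargmann u z = F z" for z
  proof -
    obtain X where X: "phase_to_complex X = z" using surj_phase_to_complex by blast
    have "phase_factor X * bargmann u z = u (gabor_atom X)"
      unfolding gabor_atom_eq bargmann_def X using GS_dual_linear(2)[OF u bargmann_kernel_GS, of "phase_factor X" z] by simp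
    also have "\<dots> = ?c * (\<integral>Y. stft_pair (gabor_atom X) Y * (phase_factor Y * F (phase_to_complex Y)) \<partial>lborel)"
      by (simp add: u_def gabor_atom_GS S_def)
    also have "\<dots> = (?c * of_real ((2 * pi) powr real CARD('d))) * (phase_factor X * F z)"
      unfolding reproducing_formula[OF F C] X by (simp only: mult.assoc)
    also have "?c * of_real ((2 * pi) powr real CARD('d)) = 1"
      by (simp add: powr_add[symmetric] flip: of_real_mult)
    finally have "phase_factor X * bargmann u z = phase_factor X * F z" by simp
    moreover have "phase_factor X \<noteq> 0" using norm_phase_factor[of X] by (metis exp_not_eq_zero norm_zero)
    ultimately show ?thesis by simp
  qed
  then have "bargmann u = F" by blast
  with u show ?thesis by blast
qed

theorem theorem4p4:
  fixes \<B> :: "((real^'d::finite) \<times> (real^'d)) mixed_space"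
    and \<omega> :: "(real^'d) \<times> (real^'d) \<Rightarrow> real"
  assumes "mixed_quasinorm_space \<B>"
    and "\<omega> \<in> weights_PQ0"
  shows "A0_space \<omega> \<B> = A_space \<omega> \<B>
    \<and> (\<forall>F\<in>A0_space \<omega> \<B>. A0_norm \<omega> \<B> F = A_norm \<omega> \<B> F)
    \<and> (\<forall>f\<in>modulation_space \<omega> \<B>. A_norm \<omega> \<B> (bargmann f) = modulation_norm \<omega> \<B> f)
    \<and> bij_betw bargmann (modulation_space \<omega> \<B>) (A_space \<omega> \<B>)"
proof -
  have sub: "modulation_space \<omega> \<B> \<subseteq> GS_dual (1/2)" by (auto simp: modulation_space_def)
  have norm_eq: "A_norm \<omega> \<B> (bargmann u) = modulation_norm \<omega> \<B> u" if "u \<in> GS_dual (1/2)" for u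
    unfolding B_norm_def modulation_norm_def STFT_eq_to_phase_space[OF that] ..
  have inj: "inj_on bargmann (modulation_space \<omega> \<B>)" by (rule inj_on_subset[OF inj_on_bargmann sub])
  have img: "bargmann ` modulation_space \<omega> \<B> = A_space \<omega> \<B>"
  proof (intro equalityI subsetI)
    fix F assume "F \<in> bargmann ` modulation_space \<omega> \<B>"
    then show "F \<in> A_space \<omega> \<B>"
      by (auto simp: A_space_def modulation_space_def norm_eq intro: entire_bargmann)
  next
    fix F assume "F \<in> A_space \<omega> \<B>"
    then have F: "entire F" "A_norm \<omega> \<B> F < \<infinity>" by (auto simp: A_space_def)
    have \<omega>: "\<exists>C>0. \<forall>X. inverse C * gaussian c X \<le> \<omega> X" if "c > 0" for c
      using assms(2) that unfolding weights_PQ0_def by blast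
    obtain u where u: "u \<in> GS_dual (1/2)" "bargmann u = F"
      using bargmann_surjective[OF F(1) entire_growth[OF assms(1) F \<omega>]] by blast
    moreover have "modulation_norm \<omega> \<B> u < \<infinity>" using norm_eq[OF u(1)] u(2) F(2) by simp
    ultimately show "F \<in> bargmann ` modulation_space \<omega> \<B>" by (auto simp: modulation_space_def)
  qed
  \<comment> \<open>\<open>A0_norm\<close> selects a preimage through \<open>inv_into\<close>;
    injectivity on the modulation space identifies it with u.\<close>
  have "A0_norm \<omega> \<B> F = A_norm \<omega> \<B> F" if F: "F \<in> A0_space \<omega> \<B>" for F
  proof -
    obtain u where u: "u \<in> modulation_space \<omega> \<B>" "F = bargmann u" using F by (auto simp: A0_space_def)
    have "u \<in> GS_dual (1/2)" using u(1) sub by blast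
    then show ?thesis unfolding A0_norm_def u(2) inv_into_f_f[OF inj u(1)] by (simp only: norm_eq)
  qed
  then show ?thesis using img inj norm_eq sub by (auto simp: A0_space_def bij_betw_def)
qed

end
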